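(* Let $X$ be a Hilbert space and let $A\colon D(A)\to X$, $D(A)\subseteq X$, be a densely defined, self-adjoint operator such that $A\colon D(A)\to X$ is bijective with $A^{-1}\in L(X)$. Let $X_n$ and $X_{-n}$ denote the $n$-th interpolation and the $n$-th extrapolation space of $A$. Then there is an isomorphism of topological vector spaces $$\Bigl(\operatorname*{proj}_{n\in\mathbb{N}} X_n\Bigr)'_b\;\cong\;\operatorname*{ind}_{n\in\mathbb{N}} X_{-n}.$$ In particular, the inductive limit $\operatorname{ind}_{n\in\mathbb{N}} X_{-n}$ is complete.
   Context: $L(X)$ denotes the bounded linear operators on $X$. Powers of the unbounded operator $A$ are defined on the natural domain: $D(A^{n+1})=\{x\in D(A^n) : A^nx\in D(A)\}$. Interpolation spaces: for $n\ge 1$, $X_n=(D(A^n),\|\cdot\|_n)$ with the graph norm $\|x\|_n=\|x\|_X+\|A^nx\|_X$. One has $X_{n+1}\subseteq X_n$ with continuous inclusion. Projective limit: $\operatorname{proj}_{n\in\mathbb{N}}X_n$ is the intersection $\bigcap_{n}X_n$ with the coarsest linear topology making all inclusions into $X_k$, $k\in\mathbb{N}$, continuous. Extrapolation spaces: for $n\ge 1$, $X_{-n}$ is the completion of $X$ with respect to the norm $\|x\|_{-n}=\|A^{-n}x\|_X$, where $A^{-n}=(A^{-1})^n$. The linking map $X_{-n}\to X_{-(n+1)}$ is the unique continuous linear extension of the identity $\mathrm{id}_X$ (it exists since $\|x\|_{-(n+1)}\leq\|A^{-1}\|\,\|x\|_{-n}$); it is injective, so $X_{-n}$ is regarded as a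 subspace of $X_{-(n+1)}$. Inductive limit: $\operatorname{ind}_{n\in\mathbb{N}}X_{-n}$ is the union $\bigcup_nX_{-n}$ (the algebraic direct limit along the linking maps) with the finest linear topology making all canonical maps from $X_{-k}$, $k\in\mathbb{N}$, continuous. For a locally convex space $E$, $E'_b$ denotes the strong dual, i.e. the space of continuous linear functionals with the topology of uniform convergence on bounded subsets of $E$. *)

theory Defs
  imports "HOL-Analysis.Analysis"
begin

section \<open>Scalars and Hilbert spaces\<close>

text \<open>
  Up to isometric isomorphism the only members of this class are \<open>real\<close> and \<open>complex\<close>
  with their usual conjugation (lemma \<open>rc_field_real_or_complex\<close>), so a type variable of
  this class treats real and complex Hilbert spaces simultaneously.
\<close>

class rc_field = real_normed_field +
  fixes kcnj :: "'a \<Rightarrow> 'a"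
  assumes kcnj_add: "kcnj (x + y) = kcnj x + kcnj y"
    and kcnj_mult: "kcnj (x * y) = kcnj x * kcnj y"
    and kcnj_kcnj: "kcnj (kcnj x) = x"
    and mult_kcnj_scaleR: "x * kcnj x = (norm x)\<^sup>2 *\<^sub>R 1"

lemma mult_kcnj: "x * kcnj x = of_real ((norm x)\<^sup>2)" for x :: "'k::rc_field"
  by (simp add: mult_kcnj_scaleR of_real_def)

instantiation real :: rc_field
begin
definition kcnj_real :: "real \<Rightarrow> real" where "kcnj_real x = x"
instance by standard (simp_all add: kcnj_real_def power2_eq_square)
end

instantiation complex :: rc_field
begin
definition kcnj_complex :: "complex \<Rightarrow> complex" where "kcnj_complex = cnj"
instance by standard (simp_all add: kcnj_complex_def complex_norm_square[symmetric] scaleR_conv_of_real)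
end

lemma rc_field_real_or_complex:
  "(\<forall>x::'k::rc_field. \<exists>a. x = of_real a \<and> kcnj x = x) \<or>
   (\<exists>i::'k. i * i = -1 \<and> kcnj i = - i \<and> norm i = 1 \<and>
      (\<forall>x. \<exists>a b. x = of_real a + of_real b * i \<and> kcnj x = of_real a - of_real b * i))"
proof -
  have cr: "kcnj (of_real r :: 'k) = of_real r" for r
  proof (cases "r = 0")
    case True
    have "kcnj (0::'k) + kcnj 0 = kcnj 0" using kcnj_add[of "0::'k" 0] by simp
    then show ?thesis using True by simp
  next
    case False
    have "(of_real r :: 'k) * kcnj (of_real r) = of_real r * of_real r"
      using mult_kcnj[of "of_real r :: 'k"] by (simp add: power2_eq_square)
    then show ?thesis using False by simp
  qed
  have neg: "kcnj (- x) = - kcnj x" for x :: 'k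
    using kcnj_mult[of "of_real (-1)" x] cr[of "-1"] by simp
  have herm: "\<exists>a. x = of_real a" if "kcnj x = x" for x :: 'k
  proof -
    have "x * x = of_real (norm x) * of_real (norm x)"
      using mult_kcnj[of x] that by (simp add: power2_eq_square)
    then have "x = of_real (norm x) \<or> x = - of_real (norm x)" by (simp add: square_eq_iff)
    then show ?thesis by (metis of_real_minus)
  qed
  show ?thesis
  proof (cases "\<forall>x::'k. kcnj x = x")
    case True
    then show ?thesis using herm by blast
  next
    case False
    then obtain w :: 'k where w: "kcnj w \<noteq> w" by blast
    define v where "v = w - kcnj w"
    have v0: "v \<noteq> 0" using w by (simp add: v_def)
    have cv: "kcnj v = - v"
      using kcnj_add[of w "- kcnj w"] by (simp add: v_def neg kcnj_kcnj)
    define i where "i = of_real (1 / norm v) * v"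
    have ci: "kcnj i = - i"
      using kcnj_mult[of "of_real (1 / norm v)" v] cr[of "1 / norm v"] cv by (simp add: i_def)
    have ni: "norm i = 1" using v0 by (simp add: i_def norm_mult norm_divide)
    have ii: "i * i = -1"
      using mult_kcnj[of i] ci ni by (metis minus_equation_iff mult_minus_right of_real_1 one_power2)
    have "\<exists>a b. x = of_real a + of_real b * i \<and> kcnj x = of_real a - of_real b * i" for x :: 'k
    proof -
      have "kcnj (x + kcnj x) = x + kcnj x" by (simp add: kcnj_add kcnj_kcnj)
      then obtain a where a: "x + kcnj x = of_real a" using herm by blast
      have cd: "kcnj (x - kcnj x) = - (x - kcnj x)"
        using kcnj_add[of x "- kcnj x"] by (simp add: neg kcnj_kcnj)
      have "kcnj ((x - kcnj x) * i) = (x - kcnj x) * i" 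
        unfolding kcnj_mult cd ci by (rule minus_mult_minus)
      then obtain b where b: "(x - kcnj x) * i = of_real b" using herm by blast
      have "(x - kcnj x) * (i * i) = of_real b * i" using b by (metis mult.assoc)
      then have "kcnj x - x = of_real b * i" by (simp add: ii)
      then have d: "x - kcnj x = - (of_real b * i)" by (metis minus_diff_eq)
      have "x + x = (x + kcnj x) + (x - kcnj x)" by simp
      then have x2: "x + x = of_real a - of_real b * i" unfolding a d by simp
      have "kcnj x + kcnj x = (x + kcnj x) - (x - kcnj x)" by simp
      then have y2: "kcnj x + kcnj x = of_real a + of_real b * i" unfolding a d by simp
      have "x = of_real (a / 2) + of_real (- b / 2) * i"
        using x2 by (simp add: field_simps)
      moreover have "kcnj x = of_real (a / 2) - of_real (- b / 2) * i"
        using y2 by (simp add: field_simps)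
      ultimately show ?thesis by blast
    qed
    then show ?thesis using ii ci ni by blast
  qed
qed

locale hilbert_space = vector_space smul
  for smul :: "'k::rc_field \<Rightarrow> 'a::banach \<Rightarrow> 'a" +
  fixes ip :: "'a \<Rightarrow> 'a \<Rightarrow> 'k"
  assumes scale_of_real: "smul (of_real r) x = r *\<^sub>R x"
    and ip_add_left: "ip (x + y) z = ip x z + ip y z"
    and ip_scale_left: "ip (smul c x) y = c * ip x y"
    and ip_commute: "ip y x = kcnj (ip x y)"
    and ip_self: "ip x x = of_real ((norm x)\<^sup>2)"


section \<open>Unbounded operators\<close>

text \<open>
  An unbounded operator is a pair of a domain \<open>D\<close> and a total function \<open>A\<close> whose values
  outside \<open>D\<close> are irrelevant.
\<close>

definition bounded_operator :: "('k::rc_field \<Rightarrow> 'a::banach \<Rightarrow> 'a) \<Rightarrow> ('a \<Rightarrow> 'a) \<Rightarrow> bool"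
  where "bounded_operator smul B \<longleftrightarrow>
    Vector_Spaces.linear smul smul B \<and> (\<exists>K. \<forall>x. norm (B x) \<le> K * norm x)"

definition linear_operator :: "('k::rc_field \<Rightarrow> 'a::banach \<Rightarrow> 'a) \<Rightarrow> 'a set \<Rightarrow> ('a \<Rightarrow> 'a) \<Rightarrow> bool"
  where "linear_operator smul D A \<longleftrightarrow>
    module.subspace smul D \<and>
    (\<forall>x\<in>D. \<forall>y\<in>D. A (x + y) = A x + A y) \<and>
    (\<forall>c. \<forall>x\<in>D. A (smul c x) = smul c (A x))"

definition densely_defined :: "'a::banach set \<Rightarrow> bool"
  where "densely_defined D \<longleftrightarrow> closure D = UNIV"

definition adjoint_domain :: "('a \<Rightarrow> 'a \<Rightarrow> 'k) \<Rightarrow> 'a set \<Rightarrow> ('a \<Rightarrow> 'a) \<Rightarrow> 'a set"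
  where "adjoint_domain ip D A = {y. \<exists>z. \<forall>x\<in>D. ip (A x) y = ip x z}"

definition adjoint_operator :: "('a \<Rightarrow> 'a \<Rightarrow> 'k) \<Rightarrow> 'a set \<Rightarrow> ('a \<Rightarrow> 'a) \<Rightarrow> 'a \<Rightarrow> 'a"
  where "adjoint_operator ip D A y = (THE z. \<forall>x\<in>D. ip (A x) y = ip x z)"

definition self_adjoint :: "('a \<Rightarrow> 'a \<Rightarrow> 'k) \<Rightarrow> 'a set \<Rightarrow> ('a \<Rightarrow> 'a) \<Rightarrow> bool"
  where "self_adjoint ip D A \<longleftrightarrow>
    adjoint_domain ip D A = D \<and> (\<forall>y\<in>D. adjoint_operator ip D A y = A y)"

primrec power_domain :: "'a set \<Rightarrow> ('a \<Rightarrow> 'a) \<Rightarrow> nat \<Rightarrow> 'a set"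
  where
    "power_domain D A 0 = UNIV"
  | "power_domain D A (Suc n) = {x \<in> power_domain D A n. (A ^^ n) x \<in> D}"


section \<open>Vector spaces, normed spaces and topological vector spaces with explicit carriers\<close>

record ('k, 'v) vspace =
  car :: "'v set"
  vadd :: "'v \<Rightarrow> 'v \<Rightarrow> 'v"
  vzero :: "'v"
  vsmul :: "'k \<Rightarrow> 'v \<Rightarrow> 'v"

record ('k, 'v) nspace = "('k, 'v) vspace" +
  nnorm :: "'v \<Rightarrow> real"

record ('k, 'v) tvspace = "('k, 'v) vspace" +
  topo :: "'v topology"

definition vector_space_on :: "('k::field, 'v, 'z) vspace_scheme \<Rightarrow> bool"
  where "vector_space_on V \<longleftrightarrow>
    vzero V \<in> car V \<and>
    (\<forall>x\<in>car V. \<forall>y\<in>car V. vadd V x y \<in> car V) \<and>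
    (\<forall>c. \<forall>x\<in>car V. vsmul V c x \<in> car V) \<and>
    (\<forall>x\<in>car V. \<forall>y\<in>car V. \<forall>z\<in>car V. vadd V (vadd V x y) z = vadd V x (vadd V y z)) \<and>
    (\<forall>x\<in>car V. \<forall>y\<in>car V. vadd V x y = vadd V y x) \<and>
    (\<forall>x\<in>car V. vadd V (vzero V) x = x) \<and>
    (\<forall>x\<in>car V. \<exists>y\<in>car V. vadd V x y = vzero V) \<and>
    (\<forall>c. \<forall>x\<in>car V. \<forall>y\<in>car V. vsmul V c (vadd V x y) = vadd V (vsmul V c x) (vsmul V c y)) \<and>
    (\<forall>b c. \<forall>x\<in>car V. vsmul V (b + c) x = vadd V (vsmul V b x) (vsmul V c x)) \<and>
    (\<forall>b c. \<forall>x\<in>car V. vsmul V (b * c) x = vsmul V b (vsmul V c x)) \<and>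
    (\<forall>x\<in>car V. vsmul V 1 x = x)"

definition vdiff :: "('k::field, 'v, 'z) vspace_scheme \<Rightarrow> 'v \<Rightarrow> 'v \<Rightarrow> 'v"
  where "vdiff V x y = vadd V x (vsmul V (-1) y)"

definition linear_on :: "('k::field, 'v, 'y) vspace_scheme \<Rightarrow> ('k, 'w, 'z) vspace_scheme
    \<Rightarrow> ('v \<Rightarrow> 'w) \<Rightarrow> bool"
  where "linear_on V W f \<longleftrightarrow>
    f \<in> car V \<rightarrow> car W \<and>
    (\<forall>x\<in>car V. \<forall>y\<in>car V. f (vadd V x y) = vadd W (f x) (f y)) \<and>
    (\<forall>c. \<forall>x\<in>car V. f (vsmul V c x) = vsmul W c (f x))"

text \<open>
  The locale \<open>Metric_space\<close> requires symmetry and nonnegativity of the distance also outside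
  the carrier, hence the default value 0 there.
\<close>

definition ndist :: "('k::field, 'v) nspace \<Rightarrow> 'v \<Rightarrow> 'v \<Rightarrow> real"
  where "ndist N x y = (if x \<in> car N \<and> y \<in> car N then nnorm N (vdiff N x y) else 0)"

definition norm_topology :: "('k::field, 'v) nspace \<Rightarrow> 'v topology"
  where "norm_topology N = Metric_space.mtopology (car N) (ndist N)"

definition linear_topology ::
    "('k::real_normed_field, 'v, 'z) vspace_scheme \<Rightarrow> 'v topology \<Rightarrow> bool"
  where "linear_topology V T \<longleftrightarrow>
    topspace T = car V \<and>
    continuous_map (prod_topology T T) T (\<lambda>(x, y). vadd V x y) \<and>
    continuous_map (prod_topology euclidean T) T (\<lambda>(c, x). vsmul V c x)"

definition coarser :: "'v topology \<Rightarrow> 'v topology \<Rightarrow> bool"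
  where "coarser S T \<longleftrightarrow> (\<forall>U. openin S U \<longrightarrow> openin T U)"

definition coarsest_linear_topology ::
    "('k::real_normed_field, 'v, 'z) vspace_scheme \<Rightarrow> ('v topology \<Rightarrow> bool) \<Rightarrow> 'v topology"
  where "coarsest_linear_topology V P =
    (THE T. linear_topology V T \<and> P T \<and>
       (\<forall>T'. linear_topology V T' \<and> P T' \<longrightarrow> coarser T T'))"

definition finest_linear_topology ::
    "('k::real_normed_field, 'v, 'z) vspace_scheme \<Rightarrow> ('v topology \<Rightarrow> bool) \<Rightarrow> 'v topology"
  where "finest_linear_topology V P =
    (THE T. linear_topology V T \<and> P T \<and>
       (\<forall>T'. linear_topology V T' \<and> P T' \<longrightarrow> coarser T' T))"

definition tvs :: "('k::real_normed_field, 'v) tvspace \<Rightarrow> bool"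
  where "tvs E \<longleftrightarrow> vector_space_on E \<and> linear_topology E (topo E)"

definition tvs_isomorphic ::
    "('k::real_normed_field, 'v) tvspace \<Rightarrow> ('k, 'w) tvspace \<Rightarrow> bool"
  where "tvs_isomorphic E F \<longleftrightarrow>
    tvs E \<and> tvs F \<and>
    (\<exists>f. linear_on E F f \<and> homeomorphic_map (topo E) (topo F) f)"

definition cauchy_filter :: "('k::real_normed_field, 'v) tvspace \<Rightarrow> 'v filter \<Rightarrow> bool"
  where "cauchy_filter E F \<longleftrightarrow>
    F \<noteq> bot \<and> eventually (\<lambda>x. x \<in> car E) F \<and>
    (\<forall>U. openin (topo E) U \<and> vzero E \<in> U \<longrightarrow>
       (\<exists>S. eventually (\<lambda>x. x \<in> S) F \<and> (\<forall>x\<in>S. \<forall>y\<in>S. vdiff E x y \<in> U)))"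

definition complete_tvs :: "('k::real_normed_field, 'v) tvspace \<Rightarrow> bool"
  where "complete_tvs E \<longleftrightarrow>
    (\<forall>F. cauchy_filter E F \<longrightarrow> (\<exists>l. limitin (topo E) (\<lambda>x. x) l F))"


section \<open>Strong dual\<close>

definition tvs_bounded :: "('k::real_normed_field, 'v) tvspace \<Rightarrow> 'v set \<Rightarrow> bool"
  where "tvs_bounded E B \<longleftrightarrow>
    B \<subseteq> car E \<and>
    (\<forall>U. openin (topo E) U \<and> vzero E \<in> U \<longrightarrow>
       (\<exists>r>0. \<forall>c. norm c \<ge> r \<longrightarrow> B \<subseteq> vsmul E c ` U))"

definition dual_carrier :: "('k::real_normed_field, 'v) tvspace \<Rightarrow> ('v \<Rightarrow> 'k) set"
  where "dual_carrier E =
    {f \<in> extensional (car E).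
       (\<forall>x\<in>car E. \<forall>y\<in>car E. f (vadd E x y) = f x + f y) \<and>
       (\<forall>c. \<forall>x\<in>car E. f (vsmul E c x) = c * f x) \<and>
       continuous_map (topo E) euclidean f}"

definition strong_open :: "('k::real_normed_field, 'v) tvspace \<Rightarrow> ('v \<Rightarrow> 'k) set \<Rightarrow> bool"
  where "strong_open E W \<longleftrightarrow>
    W \<subseteq> dual_carrier E \<and>
    (\<forall>f\<in>W. \<exists>B e. tvs_bounded E B \<and> e > 0 \<and>
       {g \<in> dual_carrier E. \<forall>x\<in>B. norm (g x - f x) < e} \<subseteq> W)"

lemma istopology_strong_open: "istopology (strong_open E)"
  unfolding istopology_def
proof (intro conjI allI impI)
  fix S T assume S: "strong_open E S" and T: "strong_open E T"
  show "strong_open E (S \<inter> T)"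
    unfolding strong_open_def
  proof (intro conjI ballI)
    show "S \<inter> T \<subseteq> dual_carrier E" using S by (auto simp: strong_open_def)
    fix f assume f: "f \<in> S \<inter> T"
    obtain B e where B: "tvs_bounded E B" "e > 0"
      "{g \<in> dual_carrier E. \<forall>x\<in>B. norm (g x - f x) < e} \<subseteq> S"
      using S f unfolding strong_open_def by blast
    obtain C d where C: "tvs_bounded E C" "d > 0"
      "{g \<in> dual_carrier E. \<forall>x\<in>C. norm (g x - f x) < d} \<subseteq> T"
      using T f unfolding strong_open_def by blast
    have "tvs_bounded E (B \<union> C)"
      unfolding tvs_bounded_def
    proof (intro conjI allI impI)
      show "B \<union> C \<subseteq> car E" using B(1) C(1) by (simp add: tvs_bounded_def)
      fix U assume U: "openin (topo E) U \<and> vzero E \<in> U"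
      obtain r where r: "r > 0" "\<forall>c. norm c \<ge> r \<longrightarrow> B \<subseteq> vsmul E c ` U"
        using B(1) U unfolding tvs_bounded_def by blast
      obtain s where s: "s > 0" "\<forall>c. norm c \<ge> s \<longrightarrow> C \<subseteq> vsmul E c ` U"
        using C(1) U unfolding tvs_bounded_def by blast
      have "\<forall>c. norm c \<ge> max r s \<longrightarrow> B \<union> C \<subseteq> vsmul E c ` U"
        using r(2) s(2) by simp
      then show "\<exists>r>0. \<forall>c. norm c \<ge> r \<longrightarrow> B \<union> C \<subseteq> vsmul E c ` U"
        using r(1) by (intro exI[of _ "max r s"]) auto
    qed
    moreover have "min e d > 0" using B(2) C(2) by simp
    moreover have "{g \<in> dual_carrier E. \<forall>x\<in>B \<union> C. norm (g x - f x) < min e d} \<subseteq> S \<inter> T"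
      using B(3) C(3) by auto
    ultimately show "\<exists>B e. tvs_bounded E B \<and> e > 0 \<and>
        {g \<in> dual_carrier E. \<forall>x\<in>B. norm (g x - f x) < e} \<subseteq> S \<inter> T"
      by blast
  qed
next
  fix K assume "\<forall>S\<in>K. strong_open E S"
  then show "strong_open E (\<Union>K)"
    unfolding strong_open_def by (meson Sup_le_iff UnionE Union_upper order_trans)
qed

definition strong_dual :: "('k::real_normed_field, 'v) tvspace \<Rightarrow> ('k, 'v \<Rightarrow> 'k) tvspace"
  where "strong_dual E =
    \<lparr>car = dual_carrier E,
     vadd = (\<lambda>f g. \<lambda>x\<in>car E. f x + g x),
     vzero = (\<lambda>x\<in>car E. 0),
     vsmul = (\<lambda>c f. \<lambda>x\<in>car E. c * f x),
     topo = topology (strong_open E)\<rparr>"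


section \<open>Completion of a normed space\<close>

text \<open>
  The completion consists of the equivalence classes of Cauchy sequences modulo null
  sequences. The unions over representatives in the operations are unions of one and the
  same class.
\<close>

definition cauchy_seqs :: "('k::field, 'v) nspace \<Rightarrow> (nat \<Rightarrow> 'v) set"
  where "cauchy_seqs N = {s. Metric_space.MCauchy (car N) (ndist N) s}"

definition cauchy_class :: "('k::field, 'v) nspace \<Rightarrow> (nat \<Rightarrow> 'v) \<Rightarrow> (nat \<Rightarrow> 'v) set"
  where "cauchy_class N s = {t \<in> cauchy_seqs N. (\<lambda>i. ndist N (s i) (t i)) \<longlonglongrightarrow> 0}"

definition completion :: "('k::field, 'v) nspace \<Rightarrow> ('k, (nat \<Rightarrow> 'v) set) nspace"
  where "completion N =
    \<lparr>car = cauchy_class N ` cauchy_seqs N,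
     vadd = (\<lambda>P Q. \<Union>s\<in>P. \<Union>t\<in>Q. cauchy_class N (\<lambda>i. vadd N (s i) (t i))),
     vzero = cauchy_class N (\<lambda>_. vzero N),
     vsmul = (\<lambda>c P. \<Union>s\<in>P. cauchy_class N (\<lambda>i. vsmul N c (s i))),
     nnorm = (\<lambda>P. THE r. \<exists>s\<in>P. (\<lambda>i. nnorm N (s i)) \<longlonglongrightarrow> r)\<rparr>"

definition completion_embed :: "('k::field, 'v) nspace \<Rightarrow> 'v \<Rightarrow> (nat \<Rightarrow> 'v) set"
  where "completion_embed N x = cauchy_class N (\<lambda>_. x)"


section \<open>Projective and inductive limits of sequences of normed spaces\<close>

text \<open>
  All sequences of spaces are indexed by the natural numbers \<open>n \<ge> 1\<close>. In the projective
  limit the \<open>N n\<close> are meant to be vector subspaces of \<open>V\<close>.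
\<close>

definition proj_limit_vs :: "('k, 'v) vspace \<Rightarrow> (nat \<Rightarrow> ('k, 'v) nspace) \<Rightarrow> ('k, 'v) vspace"
  where "proj_limit_vs V N =
    \<lparr>car = (\<Inter>n\<in>{1..}. car (N n)), vadd = vadd V, vzero = vzero V, vsmul = vsmul V\<rparr>"

definition proj_limit ::
    "('k::real_normed_field, 'v) vspace \<Rightarrow> (nat \<Rightarrow> ('k, 'v) nspace) \<Rightarrow> ('k, 'v) tvspace"
  where "proj_limit V N =
    (let E = proj_limit_vs V N in
     \<lparr>car = car E, vadd = vadd E, vzero = vzero E, vsmul = vsmul E,
      topo = coarsest_linear_topology E
        (\<lambda>T. \<forall>k\<ge>1. continuous_map T (norm_topology (N k)) (\<lambda>x. x))\<rparr>)"

text \<open>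
  \<open>transit l m j\<close> is the composite linking map from the \<open>m\<close>-th to the \<open>(m + j)\<close>-th space.
  The inductive limit is the quotient of the disjoint union of the \<open>N n\<close> in which \<open>(m, x)\<close>
  and \<open>(n, y)\<close> are identified if they have the same image in some later space; again
  the unions over representatives are unions of one and the same class.
\<close>

primrec transit :: "(nat \<Rightarrow> 'v \<Rightarrow> 'v) \<Rightarrow> nat \<Rightarrow> nat \<Rightarrow> 'v \<Rightarrow> 'v"
  where
    "transit l m 0 = (\<lambda>x. x)"
  | "transit l m (Suc j) = (\<lambda>x. l (m + j) (transit l m j x))"

definition ind_class :: "(nat \<Rightarrow> ('k, 'v) nspace) \<Rightarrow> (nat \<Rightarrow> 'v \<Rightarrow> 'v) \<Rightarrow> nat \<Rightarrow> 'v \<Rightarrow> (nat \<times> 'v) set"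
  where "ind_class N l n x =
    {(m, y). m \<ge> 1 \<and> y \<in> car (N m) \<and>
       (\<exists>i j. m + i = n + j \<and> transit l m i y = transit l n j x)}"

definition ind_limit_vs ::
    "(nat \<Rightarrow> ('k, 'v) nspace) \<Rightarrow> (nat \<Rightarrow> 'v \<Rightarrow> 'v) \<Rightarrow> ('k, (nat \<times> 'v) set) vspace"
  where "ind_limit_vs N l =
    \<lparr>car = (\<Union>n\<in>{1..}. ind_class N l n ` car (N n)),
     vadd = (\<lambda>P Q. \<Union>(m, x)\<in>P. \<Union>(n, y)\<in>Q.
               ind_class N l (m + n) (vadd (N (m + n)) (transit l m n x) (transit l n m y))),
     vzero = ind_class N l 1 (vzero (N 1)),
     vsmul = (\<lambda>c P. \<Union>(m, x)\<in>P. ind_class N l m (vsmul (N m) c x))\<rparr>"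

definition ind_limit ::
    "(nat \<Rightarrow> ('k::real_normed_field, 'v) nspace) \<Rightarrow> (nat \<Rightarrow> 'v \<Rightarrow> 'v)
      \<Rightarrow> ('k, (nat \<times> 'v) set) tvspace"
  where "ind_limit N l =
    (let L = ind_limit_vs N l in
     \<lparr>car = car L, vadd = vadd L, vzero = vzero L, vsmul = vsmul L,
      topo = finest_linear_topology L
        (\<lambda>T. \<forall>k\<ge>1. continuous_map (norm_topology (N k)) T (ind_class N l k))\<rparr>)"


section \<open>Interpolation and extrapolation spaces\<close>

definition whole_space :: "('k::rc_field \<Rightarrow> 'a::banach \<Rightarrow> 'a) \<Rightarrow> ('k, 'a) vspace"
  where "whole_space smul = \<lparr>car = UNIV, vadd = (+), vzero = 0, vsmul = smul\<rparr>"

definition interpolation_space ::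
    "('k::rc_field \<Rightarrow> 'a::banach \<Rightarrow> 'a) \<Rightarrow> 'a set \<Rightarrow> ('a \<Rightarrow> 'a) \<Rightarrow> nat \<Rightarrow> ('k, 'a) nspace"
  where "interpolation_space smul D A n =
    \<lparr>car = power_domain D A n, vadd = (+), vzero = 0, vsmul = smul,
     nnorm = (\<lambda>x. norm x + norm ((A ^^ n) x))\<rparr>"

definition negative_norm_space ::
    "('k::rc_field \<Rightarrow> 'a::banach \<Rightarrow> 'a) \<Rightarrow> 'a set \<Rightarrow> ('a \<Rightarrow> 'a) \<Rightarrow> nat \<Rightarrow> ('k, 'a) nspace"
  where "negative_norm_space smul D A n =
    \<lparr>car = UNIV, vadd = (+), vzero = 0, vsmul = smul,
     nnorm = (\<lambda>x. norm ((inv_into D A ^^ n) x))\<rparr>"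

text \<open>\<open>extrapolation_space smul D A n\<close> is the space with index \<open>-n\<close>.\<close>

definition extrapolation_space ::
    "('k::rc_field \<Rightarrow> 'a::banach \<Rightarrow> 'a) \<Rightarrow> 'a set \<Rightarrow> ('a \<Rightarrow> 'a) \<Rightarrow> nat
      \<Rightarrow> ('k, (nat \<Rightarrow> 'a) set) nspace"
  where "extrapolation_space smul D A n = completion (negative_norm_space smul D A n)"

definition linking_map ::
    "('k::rc_field \<Rightarrow> 'a::banach \<Rightarrow> 'a) \<Rightarrow> 'a set \<Rightarrow> ('a \<Rightarrow> 'a) \<Rightarrow> nat
      \<Rightarrow> (nat \<Rightarrow> 'a) set \<Rightarrow> (nat \<Rightarrow> 'a) set"
  where "linking_map smul D A n =
    (THE f. f \<in> extensional (car (extrapolation_space smul D A n)) \<and>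
       linear_on (extrapolation_space smul D A n) (extrapolation_space smul D A (Suc n)) f \<and>
       continuous_map (norm_topology (extrapolation_space smul D A n))
         (norm_topology (extrapolation_space smul D A (Suc n))) f \<and>
       (\<forall>x. f (completion_embed (negative_norm_space smul D A n) x) =
            completion_embed (negative_norm_space smul D A (Suc n)) x))"

definition proj_interpolation ::
    "('k::rc_field \<Rightarrow> 'a::banach \<Rightarrow> 'a) \<Rightarrow> 'a set \<Rightarrow> ('a \<Rightarrow> 'a) \<Rightarrow> ('k, 'a) tvspace"
  where "proj_interpolation smul D A =
    proj_limit (whole_space smul) (interpolation_space smul D A)"

definition ind_extrapolation ::
    "('k::rc_field \<Rightarrow> 'a::banach \<Rightarrow> 'a) \<Rightarrow> 'a set \<Rightarrow> ('a \<Rightarrow> 'a)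
      \<Rightarrow> ('k, (nat \<times> (nat \<Rightarrow> 'a) set) set) tvspace"
  where "ind_extrapolation smul D A =
    ind_limit (extrapolation_space smul D A) (linking_map smul D A)"

end

theory Submission
  imports Defs "HOL-Library.Function_Algebras"
begin

text \<open>
  Put \<open>B = A\<^sup>-\<^sup>1\<close> and \<open>E = \<Inter>\<^sub>n D(A\<^sup>n)\<close>. As \<open>A\<^sup>n\<close> is a bijection of \<open>E\<close>, the continuous functionals on \<open>E\<close> are, by
  the Riesz theorem, the maps \<open>\<Theta> n y = (x \<mapsto> \<langle>A\<^sup>n x, J y\<rangle>)\<close>, where \<open>J\<close> is a conjugation commuting with \<open>A\<close>
  which makes the parametrisation linear. Since \<open>B\<^sup>n\<close> extends to an isometry of \<open>X\<^sub>-\<^sub>n\<close> onto \<open>X\<close> and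
  \<open>\<Theta> (n + 1) (B y) = \<Theta> n y\<close>, the dual of \<open>E\<close> is algebraically the direct limit of the \<open>X\<^sub>-\<^sub>n\<close>.

  The strong topology makes all \<open>\<Theta> n\<close> continuous. It is the finest such linear topology because
  every set \<open>{\<Sum>n. \<Theta> n y\<^sub>n | \<parallel>y\<^sub>n\<parallel> < \<epsilon>\<^sub>n}\<close> of finite sums contains the polar of the bounded set
  \<open>{x. \<forall>n. \<parallel>A\<^sup>n x\<parallel> \<le> 1/\<epsilon>\<^sub>n}\<close>, up to strict inequality; this is where the Hilbert space structure enters.
  Completeness holds because a linear functional on \<open>E\<close> that is bounded on bounded sets is continuous.
\<close>

section \<open>Scalars\<close>

text \<open>Two obstacles shape the argument. The topologies competing on the inductive limit are
  merely linear, so neighbourhoods of zero cannot be taken convex. They are replaced by a sequence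
  in which the sum of two copies of each member lies in the previous one; this is the origin of the
  sets of finite sums and of the radii \<epsilon>_n. Secondly, a functional that is small on the
  bounded set must be written as such a finite sum exactly, not only approximated. A quadratic
  minimisation does this: its infimum is shown to be below 1, and then a nearly minimal
  representation is itself the required finite sum, whether or not a minimiser exists. The limits,
  the completions and the linking maps are given by universal properties or by equivalence classes.
  Each is identified with a concrete model: seminorms on E, the space X itself in place of X_{-n},
  and B in place of the linking map. Everything else takes place in X.\<close>

lemma kcnj_of_real [simp]: "kcnj (of_real r :: 'k::rc_field) = of_real r"
proof (cases "r = 0")
  case True
  have "kcnj (0::'k) + kcnj 0 = kcnj 0" using kcnj_add[of "0::'k" 0] by simp
  then show ?thesis using True by simp
next
  case False
  have "(of_real r :: 'k) * kcnj (of_real r) = of_real r * of_real r"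
    using mult_kcnj[of "of_real r :: 'k"] by (simp add: power2_eq_square)
  then show ?thesis using False by simp
qed

lemma kcnj_0 [simp]: "kcnj (0::'k::rc_field) = 0"
  using kcnj_of_real[of 0] by simp

lemma kcnj_1 [simp]: "kcnj (1::'k::rc_field) = 1"
  using kcnj_of_real[of 1] by simp

lemma kcnj_minus [simp]: "kcnj (- x) = - kcnj (x::'k::rc_field)"
  using kcnj_mult[of "of_real (-1)" x] kcnj_of_real[of "-1", where 'k='k] by simp

lemma norm_kcnj [simp]: "norm (kcnj x) = norm (x::'k::rc_field)"
proof -
  have "(of_real ((norm (kcnj x))\<^sup>2) :: 'k) = of_real ((norm x)\<^sup>2)"
    using mult_kcnj[of x] mult_kcnj[of "kcnj x"] by (simp add: kcnj_kcnj mult.commute)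
  then have "(norm (kcnj x))\<^sup>2 = (norm x)\<^sup>2" by (simp only: of_real_eq_iff)
  then show ?thesis by simp
qed

text \<open>Completeness is inherited from the reals or the complex numbers, of which the scalar
  field is an isometric copy. Point evaluations along a Cauchy filter in the dual converge because
  of this.\<close>

lemma complete_rc_field: "complete (UNIV :: 'k::rc_field set)"
  using rc_field_real_or_complex[where 'k='k]
proof
  assume "\<forall>x::'k. \<exists>a. x = of_real a \<and> kcnj x = x"
  then have "(UNIV :: 'k set) = of_real ` (UNIV :: real set)" by auto
  moreover have "complete ((of_real :: real \<Rightarrow> 'k) ` UNIV)"
    by (rule complete_isometric_image[where e=1])
       (auto simp: bounded_linear_of_real complete_UNIV)
  ultimately show ?thesis by simp
next
  assume "\<exists>i::'k. i * i = -1 \<and> kcnj i = - i \<and> norm i = 1 \<and>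
      (\<forall>x. \<exists>a b. x = of_real a + of_real b * i \<and> kcnj x = of_real a - of_real b * i)"
  then obtain i :: 'k where i: "i * i = -1" "kcnj i = - i" "norm i = 1"
    and ex: "\<And>x. \<exists>a b. x = of_real a + of_real b * i \<and> kcnj x = of_real a - of_real b * i"
    by blast
  define h :: "complex \<Rightarrow> 'k" where "h z = of_real (Re z) + of_real (Im z) * i" for z
  have nh: "norm (h z) = norm z" for z
  proof -
    have "of_real ((norm (h z))\<^sup>2) = h z * kcnj (h z)" by (simp add: mult_kcnj)
    also have "\<dots> = of_real (Re z) * of_real (Re z) - of_real (Im z) * of_real (Im z) * (i * i)"
      by (simp add: h_def kcnj_add kcnj_mult i(2) algebra_simps)
    also have "\<dots> = of_real ((norm z)\<^sup>2)"
      by (simp add: i(1) cmod_def power2_eq_square)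
    finally have "(norm (h z))\<^sup>2 = (norm z)\<^sup>2" by (simp only: of_real_eq_iff)
    then show ?thesis by simp
  qed
  have bl: "bounded_linear h"
    by (rule bounded_linear_intro[where K=1])
       (auto simp: nh, auto simp: h_def algebra_simps scaleR_conv_of_real)
  have "x \<in> range h" for x
  proof -
    obtain a b where "x = of_real a + of_real b * i" using ex by blast
    then have "x = h (Complex a b)" by (simp add: h_def)
    then show ?thesis by blast
  qed
  then have "(UNIV :: 'k set) = range h" by blast
  moreover have "complete (range h)"
    by (rule complete_isometric_image[where e=1]) (auto simp: bl nh complete_UNIV)
  ultimately show ?thesis by simp
qed

lemma bounded_linear_kcnj: "bounded_linear (kcnj :: 'k::rc_field \<Rightarrow> 'k)"
  by (rule bounded_linear_intro[where K=1])
     (auto simp: kcnj_add kcnj_mult scaleR_conv_of_real)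


section \<open>Approximate projections in a semi-inner product space\<close>

text \<open>The bound has the shape delivered by \<open>near_projection\<close>. It is used with C =
  1 for projections in X and with C the square of a weight for single coordinates.\<close>

lemma Cauchy_if_square_bound:
  fixes u :: "nat \<Rightarrow> 'b::real_normed_vector"
  assumes C: "C \<ge> 0" and le: "\<And>i j. (norm (u i - u j))\<^sup>2 \<le> C * (2 / real (Suc i) + 2 / real (Suc j))"
  shows "Cauchy u"
proof (rule CauchyI)
  fix e :: real assume e: "e > 0"
  obtain N where N: "(4 * C + 1) / e\<^sup>2 < real N" using reals_Archimedean2 by blast
  have N0: "0 < real N" using N e C by (smt (verit) divide_pos_pos zero_less_power)
  have "norm (u i - u j) < e" if "i \<ge> N" "j \<ge> N" for i j
  proof -
    have "2 / real (Suc i) \<le> 2 / real N" "2 / real (Suc j) \<le> 2 / real N"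
      using that N0 by (intro divide_left_mono; simp)+
    then have "2 / real (Suc i) + 2 / real (Suc j) \<le> 4 / real N" by simp
    then have "(norm (u i - u j))\<^sup>2 \<le> C * (4 / real N)"
      using order_trans[OF le mult_left_mono[OF _ C]] by blast
    also have "\<dots> < e\<^sup>2" using N e N0 by (simp add: field_simps)
    finally show ?thesis using e by (simp add: power2_less_imp_less)
  qed
  then show "\<exists>M. \<forall>m\<ge>M. \<forall>n\<ge>M. norm (u m - u n) < e" by blast
qed

text \<open>In an incomplete space with a degenerate form the projection of y onto K may not exist.
  What survives is a minimising sequence in the coset y + K, which is asymptotically orthogonal to K
  and Cauchy for the form.\<close>

lemma near_projection:
  fixes G :: "'b::real_vector \<Rightarrow> 'b \<Rightarrow> real"
  assumes S: "real_vector.subspace S" and K: "real_vector.subspace K" and KS: "K \<subseteq> S"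
    and y: "y \<in> S"
    and sym: "\<And>u v. u \<in> S \<Longrightarrow> v \<in> S \<Longrightarrow> G u v = G v u"
    and add: "\<And>u v w. u \<in> S \<Longrightarrow> v \<in> S \<Longrightarrow> w \<in> S \<Longrightarrow> G (u + v) w = G u w + G v w"
    and scale: "\<And>r u v. u \<in> S \<Longrightarrow> v \<in> S \<Longrightarrow> G (r *\<^sub>R u) v = r * G u v"
    and pos: "\<And>u. u \<in> S \<Longrightarrow> G u u \<ge> 0"
  obtains u d where "\<And>j::nat. y - u j \<in> K" "d \<ge> 0"
    "\<And>i j. G (u i - u j) (u i - u j) \<le> 2 / real (Suc i) + 2 / real (Suc j)"
    "\<And>w. w \<in> K \<Longrightarrow> (\<lambda>j. G w (u j)) \<longlonglongrightarrow> 0"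
    "(\<lambda>j. G (u j) (u j)) \<longlonglongrightarrow> d"
    "(\<lambda>j. G y (u j)) \<longlonglongrightarrow> d"
proof -
  note Sub = subspace_add[OF S] subspace_diff[OF S] subspace_scale[OF S]
  note Kub = subspace_add[OF K] subspace_diff[OF K] subspace_scale[OF K] subspace_0[OF K]
  have diff: "G (u - v) w = G u w - G v w" if "u \<in> S" "v \<in> S" "w \<in> S" for u v w
    using add[of u "(-1) *\<^sub>R v" w] scale[of v w "-1"] that Sub(3)[of v "-1"] by simp
  have diff2: "G w (u - v) = G w u - G w v" if "u \<in> S" "v \<in> S" "w \<in> S" for u v w
    using diff sym that Sub by metis
  have add2: "G w (u + v) = G w u + G w v" if "u \<in> S" "v \<in> S" "w \<in> S" for u v w
    using add sym that Sub by metis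
  have scale2: "G v (r *\<^sub>R u) = r * G v u" if "u \<in> S" "v \<in> S" for u v r
    using scale sym that Sub by metis
  have sq_diff: "G (u - v) (u - v) = G u u - 2 * G v u + G v v" if "u \<in> S" "v \<in> S" for u v
    using that sym[of u v] by (simp add: diff diff2 Sub)
  have sq_add: "G (u + v) (u + v) = G u u + 2 * G v u + G v v" if "u \<in> S" "v \<in> S" for u v
    using that sym[of u v] by (simp add: add add2 Sub)
  define Q where "Q = (\<lambda>k. G (y - k) (y - k)) ` K"
  define d where "d = Inf Q"
  have Qne: "Q \<noteq> {}" using Kub(4) by (auto simp: Q_def)
  have Qpos: "q \<ge> 0" if "q \<in> Q" for q using that KS y pos Sub by (auto simp: Q_def)
  have bdd: "bdd_below Q" using Qpos by (meson bdd_belowI)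
  have d0: "d \<ge> 0" unfolding d_def using Qne Qpos by (rule cInf_greatest)
  have dle: "d \<le> G (y - k) (y - k)" if "k \<in> K" for k
    unfolding d_def using bdd that by (intro cInf_lower) (auto simp: Q_def)
  have "\<exists>k\<in>K. G (y - k) (y - k) < d + 1 / real (Suc j)" for j
  proof -
    have "Inf Q < d + 1 / real (Suc j)" by (simp add: d_def)
    then show ?thesis using cInf_less_iff[OF Qne bdd] by (auto simp: Q_def)
  qed
  then obtain k where k: "\<And>j. k j \<in> K" "\<And>j. G (y - k j) (y - k j) < d + 1 / real (Suc j)"
    by metis
  define u where "u j = y - k j" for j
  have uS: "u j \<in> S" for j using k(1)[of j] KS y Sub(2) by (auto simp: u_def)
  have yu: "y - u j \<in> K" for j using k(1) by (simp add: u_def)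
  have up: "G (u j) (u j) < d + 1 / real (Suc j)" for j using k(2) by (simp add: u_def)
  have dle': "d \<le> G (u j - w) (u j - w)" if "w \<in> K" for j w
    using dle[of "k j + w"] that k(1) Kub by (simp add: u_def diff_diff_eq)
  have lo: "d \<le> G (u j) (u j)" for j using dle k(1) by (simp add: u_def)
  have cauchy: "G (u i - u j) (u i - u j) \<le> 2 / real (Suc i) + 2 / real (Suc j)" for i j
  proof -
    \<comment> \<open>The midpoint of \<open>u i\<close> and \<open>u j\<close> is
      \<open>u i - w\<close> with \<open>w\<close> in \<open>K\<close>, so it stays in the coset and
      its square is at least \<open>d\<close>. The parallelogram law then bounds the
      difference.\<close>
    define w where "w = (1/2) *\<^sub>R (u i - u j)"
    have "u i - u j = k j - k i" by (simp add: u_def)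
    then have wK: "w \<in> K" using k(1) Kub by (simp add: w_def)
    have wS: "w \<in> S" using wK KS by blast
    have eq: "u i - w = (1/2) *\<^sub>R (u i + u j)"
      by (simp add: w_def algebra_simps flip: scaleR_add_left)
    have "d \<le> G (u i - w) (u i - w)" using dle'[OF wK] .
    also have "\<dots> = (1/4) * G (u i + u j) (u i + u j)"
      unfolding eq by (simp add: scale scale2 Sub uS)
    finally have "4 * d \<le> G (u i + u j) (u i + u j)" by simp
    then show ?thesis using up[of i] up[of j] sq_add[OF uS[of i] uS[of j]] sq_diff[OF uS[of i] uS[of j]]
      by simp
  qed
  have small: "(G w (u j))\<^sup>2 \<le> G w w / real (Suc j)" if w: "w \<in> K" for w j
  proof -
    have wS: "w \<in> S" using w KS by blast
    \<comment> \<open>Moving \<open>u j\<close> by a multiple of \<open>w\<close> cannot push the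
      square below \<open>d\<close>, and \<open>u j\<close> is within 1/(j+1) of \<open>d\<close>.
      The best t is \<open>G w (u j) / G w w\<close>; if \<open>G w w\<close> vanishes, the linear
      term alone forces \<open>G w (u j) = 0\<close>.\<close>
    have *: "2 * t * G w (u j) \<le> 1 / real (Suc j) + t\<^sup>2 * G w w" for t
    proof -
      have "d \<le> G (u j - t *\<^sub>R w) (u j - t *\<^sub>R w)" using dle'[of "t *\<^sub>R w"] w Kub by blast
      also have "\<dots> = G (u j) (u j) - 2 * t * G w (u j) + t\<^sup>2 * G w w"
        by (subst sq_diff) (simp_all add: uS wS Sub scale scale2 power2_eq_square)
      finally show ?thesis using up[of j] by simp
    qed
    show ?thesis
    proof (cases "G w w = 0")
      case True
      have "G w (u j) = 0"
      proof (rule ccontr)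
        assume "G w (u j) \<noteq> 0"
        then show False using *[of "1 / G w (u j)"] True
          by (simp add: field_simps)
      qed
      then show ?thesis using True by simp
    next
      case False
      then have pw: "G w w > 0" using pos[OF wS] by simp
      define g where "g = G w (u j)"
      have "2 * (g / G w w) * g \<le> 1 / real (Suc j) + (g / G w w)\<^sup>2 * G w w"
        using *[of "g / G w w"] by (simp add: g_def)
      moreover have "2 * (g / G w w) * g = 2 * (g\<^sup>2 / G w w)" "(g / G w w)\<^sup>2 * G w w = g\<^sup>2 / G w w"
        using pw by (simp_all add: power2_eq_square)
      ultimately have "g\<^sup>2 / G w w \<le> 1 / real (Suc j)" by linarith
      then have "g\<^sup>2 \<le> (1 / real (Suc j)) * G w w" using pw by (simp add: divide_le_eq)
      then show ?thesis by (simp add: g_def)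
    qed
  qed
  \<comment> \<open>The vector of \<open>K\<close> may vary with j as long as its square stays
    bounded. Applied to \<open>y - u j\<close>, this turns the limit of \<open>G (u j) (u j)\<close>
    into that of \<open>G y (u j)\<close>.\<close>
  have lim0: "(\<lambda>j. G (w j) (u j)) \<longlonglongrightarrow> 0"
    if w: "\<And>j. w j \<in> K" and M: "\<And>j. G (w j) (w j) \<le> M" for w M
  proof -
    have "(\<lambda>j. (G (w j) (u j))\<^sup>2) \<longlonglongrightarrow> 0"
    proof (rule tendsto_sandwich[where f="\<lambda>_. 0" and h="\<lambda>j. M / real (Suc j)"])
      show "\<forall>\<^sub>F j in sequentially. (G (w j) (u j))\<^sup>2 \<le> M / real (Suc j)"
        using small[OF w] M by (intro always_eventually allI) (meson divide_right_mono of_nat_0_le_iff order_trans)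
      show "(\<lambda>j. M / real (Suc j)) \<longlonglongrightarrow> 0"
        using LIMSEQ_Suc[OF lim_const_over_n] by simp
    qed auto
    from tendsto_real_sqrt[OF this] show ?thesis by (simp add: tendsto_rabs_zero_iff)
  qed
  have limu: "(\<lambda>j. G (u j) (u j)) \<longlonglongrightarrow> d"
  proof (rule tendsto_sandwich[where f="\<lambda>_. d" and h="\<lambda>j. d + 1 / real (Suc j)"])
    show "(\<lambda>j. d + 1 / real (Suc j)) \<longlonglongrightarrow> d"
      using tendsto_add[OF tendsto_const LIMSEQ_Suc[OF lim_const_over_n[of 1]], of d] by simp
  qed (use lo up less_imp_le in \<open>auto intro!: always_eventually\<close>)
  have "(\<lambda>j. G (y - u j) (u j)) \<longlonglongrightarrow> 0"
  proof (rule lim0[OF yu])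
    fix j
    have "0 \<le> G (y + u j) (y + u j)" using pos y uS Sub by blast
    then have "G (y - u j) (y - u j) \<le> 2 * G y y + 2 * G (u j) (u j)"
      using sq_diff[OF y uS[of j]] sq_add[OF y uS[of j]] by simp
    also have "\<dots> \<le> 2 * G y y + 2 * (d + 1)"
      using up[of j] by (smt (verit) divide_le_eq_1_pos of_nat_Suc of_nat_0_le_iff)
    finally show "G (y - u j) (y - u j) \<le> 2 * G y y + 2 * (d + 1)" .
  qed
  from tendsto_add[OF this limu] have "(\<lambda>j. G y (u j)) \<longlonglongrightarrow> d"
    using y uS by (simp add: diff)
  then show thesis
    using that[of u d] yu d0 cauchy lim0[of "\<lambda>_. w" "G w w" for w] limu by blast
qed


section \<open>Hilbert spaces\<close>

context hilbert_space
begin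

lemma smul_scaleR: "smul c (r *\<^sub>R x) = r *\<^sub>R smul c x"
  by (metis scale_of_real scale_scale mult.commute)

lemma ip_0_left [simp]: "ip 0 y = 0"
  using ip_scale_left[of 0 0 y] by simp

lemma ip_minus_left [simp]: "ip (- x) y = - ip x y"
  using ip_add_left[of x "- x" y] by (simp add: eq_neg_iff_add_eq_0 add.commute)

lemma ip_diff_left: "ip (x - y) z = ip x z - ip y z"
  using ip_add_left[of x "- y" z] by simp

lemma ip_add_right: "ip z (x + y) = ip z x + ip z y"
  by (metis ip_add_left ip_commute kcnj_add)

lemma ip_scale_right: "ip x (smul c y) = kcnj c * ip x y"
  by (metis ip_scale_left ip_commute kcnj_mult)

lemma ip_0_right [simp]: "ip x 0 = 0"
  using ip_scale_right[of x 0 0] by simp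

lemma ip_minus_right [simp]: "ip x (- y) = - ip x y"
  using ip_add_right[of x y "- y"] by (simp add: eq_neg_iff_add_eq_0 add.commute)

lemma ip_diff_right: "ip z (x - y) = ip z x - ip z y"
  using ip_add_right[of z x "- y"] by simp

lemma ip_scaleR_left: "ip (r *\<^sub>R x) y = of_real r * ip x y"
  using ip_scale_left[of "of_real r" x y] by (simp add: scale_of_real)

lemma ip_scaleR_right: "ip x (r *\<^sub>R y) = of_real r * ip x y"
  using ip_scale_right[of x "of_real r" y] by (simp add: scale_of_real)

lemma norm_smul: "norm (smul c x) = norm c * norm x"
proof -
  have "(of_real ((norm (smul c x))\<^sup>2) :: 'k) = (c * kcnj c) * ip x x"
    by (simp only: ip_self[symmetric] ip_scale_left ip_scale_right mult_ac)
  also have "\<dots> = of_real ((norm c * norm x)\<^sup>2)"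
    by (simp add: mult_kcnj ip_self power_mult_distrib)
  finally have "(norm (smul c x))\<^sup>2 = (norm c * norm x)\<^sup>2" by (simp only: of_real_eq_iff)
  then show ?thesis by simp
qed

text \<open>This is the real part of \<open>ip\<close>, obtained by polarisation because the
  abstract scalar field comes without a real-part map. It is the real inner product to which
  \<open>near_projection\<close> is applied.\<close>

definition rip :: "'a \<Rightarrow> 'a \<Rightarrow> real"
  where "rip x y = ((norm (x + y))\<^sup>2 - (norm x)\<^sup>2 - (norm y)\<^sup>2) / 2"

lemma of_real_rip: "(of_real (rip x y) :: 'k) = (ip x y + ip y x) / 2"
proof -
  have "(of_real ((norm (x + y))\<^sup>2) :: 'k) = of_real ((norm x)\<^sup>2) + of_real ((norm y)\<^sup>2) + ip x y + ip y x"
    by (simp only: ip_self[symmetric] ip_add_left ip_add_right add_ac)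
  then show ?thesis by (simp add: rip_def)
qed

lemma rip_eqI:
  assumes "(ip x y + ip y x :: 'k) = ip u v + ip v u" shows "rip x y = rip u v"
proof -
  have "(of_real (rip x y) :: 'k) = of_real (rip u v)" by (simp only: of_real_rip assms)
  then show ?thesis by (simp only: of_real_eq_iff)
qed

lemma rip_of_real: "ip x y = of_real r \<Longrightarrow> rip x y = r"
proof -
  assume "ip x y = of_real r"
  moreover from this have "ip y x = of_real r" by (metis ip_commute kcnj_of_real)
  ultimately have "(of_real (rip x y) :: 'k) = of_real r" by (simp add: of_real_rip)
  then show ?thesis by (simp only: of_real_eq_iff)
qed

lemma rip_commute: "rip x y = rip y x"
  by (simp add: rip_def add.commute)

lemma rip_add_left: "rip (x + y) z = rip x z + rip y z"
proof -
  have "(of_real (rip (x + y) z) :: 'k) = of_real (rip x z + rip y z)"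
    by (simp add: of_real_rip ip_add_left ip_add_right add_divide_distrib)
  then show ?thesis by (simp only: of_real_eq_iff)
qed

lemma rip_scaleR_left: "rip (r *\<^sub>R x) y = r * rip x y"
proof -
  have "(of_real (rip (r *\<^sub>R x) y) :: 'k) = of_real (r * rip x y)"
    by (simp add: of_real_rip ip_scaleR_left ip_scaleR_right algebra_simps)
  then show ?thesis by (simp only: of_real_eq_iff)
qed

lemma rip_self: "rip x x = (norm x)\<^sup>2"
  by (rule rip_of_real) (rule ip_self)

lemma rip_add_right: "rip z (x + y) = rip z x + rip z y"
  by (metis rip_add_left rip_commute)

lemma rip_scaleR_right: "rip x (r *\<^sub>R y) = r * rip x y"
  by (metis rip_scaleR_left rip_commute)

lemma rip_le: "\<bar>rip x y\<bar> \<le> norm x * norm y"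
proof -
  have 1: "rip x y \<le> norm x * norm y" for x y
  proof -
    have "(norm (x + y))\<^sup>2 \<le> (norm x + norm y)\<^sup>2"
      by (intro power_mono norm_triangle_ineq) simp
    then show ?thesis by (simp add: rip_def power2_sum)
  qed
  have "rip (- x) y = - rip x y"
    using rip_scaleR_left[of "-1" x y] by simp
  then show ?thesis using 1[of x y] 1[of "- x" y] by simp
qed

text \<open>Multiplying x by the conjugate of its inner product with y rotates that product onto the
  nonnegative real axis. In this way orthogonality and the Cauchy-Schwarz inequality pass from
  \<open>rip\<close> to \<open>ip\<close>.\<close>

lemma rip_smul_kcnj: "rip (smul (kcnj (ip x y)) x) y = (norm (ip x y))\<^sup>2"
  by (rule rip_of_real) (simp add: ip_scale_left mult.commute mult_kcnj)

lemma ip_eq_0_if_rip: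
  assumes "\<And>c. rip (smul c x) y = 0" shows "ip x y = 0"
  using assms[of "kcnj (ip x y)"] by (simp add: rip_smul_kcnj)

lemma ip_le: "norm (ip x y) \<le> norm x * norm y"
proof (cases "ip x y = 0")
  case False
  have "norm (ip x y) * norm (ip x y) \<le> norm (ip x y) * (norm x * norm y)"
    using rip_le[of "smul (kcnj (ip x y)) x" y]
    by (simp add: rip_smul_kcnj norm_smul power2_eq_square mult.assoc)
  then show ?thesis using False by simp
qed simp

lemma rip_le_norm_ip: "rip x y \<le> norm (ip x y)"
proof -
  have "norm (of_real (rip x y) :: 'k) \<le> (norm (ip x y) + norm (ip y x)) / 2"
    using norm_triangle_ineq[of "ip x y" "ip y x"] by (simp add: of_real_rip norm_divide)
  also have "norm (ip y x) = norm (ip x y)" by (subst ip_commute) simp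
  finally show ?thesis by simp
qed

lemma bounded_linear_rip: "bounded_linear (\<lambda>x. rip x y)"
  by (rule bounded_linear_intro[where K="norm y"])
     (auto simp: rip_add_left rip_scaleR_left rip_le)

lemma bounded_linear_rip_right: "bounded_linear (rip y)"
  using bounded_linear_rip[of y] by (simp add: rip_commute[of y, abs_def])

lemma bounded_linear_ip: "bounded_linear (\<lambda>x. ip x y)"
  by (rule bounded_linear_intro[where K="norm y"])
     (auto simp: ip_add_left ip_scaleR_left ip_le scaleR_conv_of_real)

lemma bounded_linear_smul: "bounded_linear (smul c)"
  by (rule bounded_linear_intro[where K="norm c"])
     (auto simp: scale_right_distrib smul_scaleR norm_smul)

lemma eq_0_if_rip_dense:
  assumes "closure T = UNIV" "\<And>x. x \<in> T \<Longrightarrow> rip x y = 0"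
  shows "y = 0"
proof -
  have "continuous_on (closure T) (\<lambda>x. rip x y)"
    by (intro linear_continuous_on bounded_linear_rip)
  then have "rip y y = 0"
    by (rule continuous_constant_on_closure) (use assms in auto)
  then show ?thesis by (simp add: rip_self)
qed

lemma eq_0_if_ip_dense:
  assumes "closure T = UNIV" "\<And>x. x \<in> T \<Longrightarrow> ip x y = 0"
  shows "y = 0"
  using assms by (intro eq_0_if_rip_dense[of T]) (auto intro: rip_of_real)

text \<open>Completeness of X makes the minimising sequence of \<open>near_projection\<close>
  converge. The subspace is only real and perhaps not closed: it is applied to the kernel of a
  functional on a non-closed domain and to the real subspace behind the conjugation.\<close>

lemma projection:
  assumes K: "real_vector.subspace K"
  obtains z where "y - z \<in> closure K" "\<And>w. w \<in> K \<Longrightarrow> rip w z = 0"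
proof -
  obtain u d where u: "\<And>j::nat. y - u j \<in> K"
    and c: "\<And>i j. rip (u i - u j) (u i - u j) \<le> 2 / real (Suc i) + 2 / real (Suc j)"
    and w: "\<And>w. w \<in> K \<Longrightarrow> (\<lambda>j. rip w (u j)) \<longlonglongrightarrow> 0"
    by (rule near_projection[of UNIV K y rip])
       (use K in \<open>auto simp: rip_add_left rip_scaleR_left rip_self intro: rip_commute\<close>)
  have "Cauchy u"
    by (rule Cauchy_if_square_bound[of 1]) (use c in \<open>auto simp: rip_self\<close>)
  then obtain z where z: "u \<longlonglongrightarrow> z" using Cauchy_convergent convergent_def by blast
  have "(\<lambda>j. y - u j) \<longlonglongrightarrow> y - z" by (intro tendsto_intros z)
  then have "y - z \<in> closure K"
    unfolding closure_sequential using u by (intro exI[of _ "\<lambda>j. y - u j"]) blast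
  moreover have "rip v z = 0" if "v \<in> K" for v
    using LIMSEQ_unique[OF w[OF that] bounded_linear.tendsto[OF bounded_linear_rip_right z]]
    by simp
  ultimately show thesis using that by blast
qed

text \<open>The functional is not extended beyond \<open>T\<close>, which need not be closed. The
  usual construction is carried out with the closure of the kernel, and boundedness serves to keep
  \<open>x1\<close> out of that closure. The application is \<open>T = E\<close>.\<close>

lemma riesz:
  assumes T: "subspace T"
    and add: "\<And>x y. x \<in> T \<Longrightarrow> y \<in> T \<Longrightarrow> f (x + y) = f x + f y"
    and scale: "\<And>c x. x \<in> T \<Longrightarrow> f (smul c x) = c * f x"
    and le: "\<And>x. x \<in> T \<Longrightarrow> norm (f x) \<le> M * norm x"
  obtains y where "\<And>x. x \<in> T \<Longrightarrow> f x = ip x y"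
proof (cases "\<forall>x\<in>T. f x = 0")
  case True
  then show thesis using that[of 0] by simp
next
  case False
  then obtain x1 where x1: "x1 \<in> T" "f x1 \<noteq> 0" by blast
  have diff: "f (x - y) = f x - f y" if "x \<in> T" "y \<in> T" for x y
    using add[of "x - y" y] that T subspace_diff by simp
  define K where "K = {x \<in> T. f x = 0}"
  have "r *\<^sub>R x = smul (of_real r) x" for r x by (simp add: scale_of_real)
  then have K: "real_vector.subspace K"
    using T scale[of 0 0]
    by (intro real_vector.subspaceI) (auto simp: K_def add scale subspace_add subspace_0 subspace_scale)
  obtain z where z: "x1 - z \<in> closure K" and orth: "\<And>w. w \<in> K \<Longrightarrow> rip w z = 0"
    using projection[OF K] by metis
  have ipK: "ip w z = 0" if "w \<in> K" for w
    by (rule ip_eq_0_if_rip, rule orth) (use that T in \<open>simp add: K_def scale subspace_scale\<close>)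
  have "continuous_on (closure K) (\<lambda>x. ip x z)"
    by (intro linear_continuous_on bounded_linear_ip)
  then have "ip (x1 - z) z = 0"
    by (rule continuous_constant_on_closure[where x="x1 - z"]) (use ipK z in auto)
  then have ip1: "ip x1 z = of_real ((norm z)\<^sup>2)" by (simp add: ip_diff_left ip_self)
  \<comment> \<open>If z vanished, \<open>x1\<close> would be a limit of elements of the kernel, and
    the bound on f would force \<open>f x1 = 0\<close>.\<close>
  have z0: "z \<noteq> 0"
  proof
    assume "z = 0"
    then obtain w where w: "\<And>n. w n \<in> K" "w \<longlonglongrightarrow> x1"
      using z unfolding closure_sequential by auto
    have "(\<lambda>n. M * norm (x1 - w n)) \<longlonglongrightarrow> M * norm (x1 - x1)"
      by (intro tendsto_intros w)
    moreover have "norm (f x1) \<le> M * norm (x1 - w n)" for n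
      using le[of "x1 - w n"] w(1)[of n] x1 T subspace_diff by (simp add: K_def diff)
    ultimately have "norm (f x1) \<le> M * norm (x1 - x1)"
      by (intro LIMSEQ_le_const[where X="\<lambda>n. M * norm (x1 - w n)"]) auto
    then show False using x1 by simp
  qed
  \<comment> \<open>The scalar is conjugated because \<open>ip\<close> is conjugate linear in its
    second argument; the denominator is the value of \<open>ip x1 z\<close>.\<close>
  define y where "y = smul (kcnj (f x1 / of_real ((norm z)\<^sup>2))) z"
  show thesis
  proof (rule that)
    fix x assume x: "x \<in> T"
    have "x - smul (f x / f x1) x1 \<in> K"
      using x x1 T by (simp add: K_def diff scale subspace_scale subspace_diff)
    then have "ip (x - smul (f x / f x1) x1) z = 0" by (rule ipK)
    then have "ip x z = f x / f x1 * of_real ((norm z)\<^sup>2)"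
      by (simp add: ip_diff_left ip_scale_left ip1)
    then show "f x = ip x y"
      using x1 z0 by (simp add: y_def ip_scale_right kcnj_kcnj)
  qed
qed

text \<open>
  The conjugation turns the antilinear Riesz isomorphism into a linear one. Over the complex
  numbers it is \<open>a + i b \<mapsto> a - i b\<close> for \<open>a, b\<close> in a maximal \<open>B\<close>-invariant set \<open>S\<close> on which
  the inner product is real; every element whose inner products with \<open>S\<close> are
  real belongs to \<open>S\<close>, because \<open>\<langle>B\<^sup>n x, x\<rangle>\<close> is always real.
\<close>

lemma conjugation_commuting:
  assumes Badd: "\<And>x y. B (x + y) = B x + B y" and Bscale: "\<And>c x. B (smul c x) = smul c (B x)"
    and sym: "\<And>x y. ip (B x) y = ip x (B y)"
  obtains J where "\<And>x y. J (x + y) = J x + J y" "\<And>c x. J (smul c x) = smul (kcnj c) (J x)"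
    "\<And>x. J (J x) = x" "\<And>x y. ip (J x) (J y) = ip y x" "\<And>x. J (B x) = B (J x)"
  using rc_field_real_or_complex[where 'k='k]
proof
  assume R: "\<forall>x::'k. \<exists>a. x = of_real a \<and> kcnj x = x"
  have "kcnj c = c" for c :: 'k using R by blast
  moreover from this have "ip x y = ip y x" for x y by (metis ip_commute)
  ultimately show thesis using that[of "\<lambda>x. x"] by simp
next
  assume "\<exists>i::'k. i * i = -1 \<and> kcnj i = - i \<and> norm i = 1 \<and>
      (\<forall>x. \<exists>a b. x = of_real a + of_real b * i \<and> kcnj x = of_real a - of_real b * i)"
  then obtain i :: 'k where i: "i * i = -1" "kcnj i = - i"
    and ex: "\<And>x. \<exists>a b. x = of_real a + of_real b * i \<and> kcnj x = of_real a - of_real b * i"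
    by blast
  have ii: "smul i (smul i x) = - x" for x using scale_scale[of i i x] i(1) by simp
  define \<C> where "\<C> = {S. (\<forall>x\<in>S. B x \<in> S) \<and> (\<forall>x\<in>S. \<forall>y\<in>S. kcnj (ip x y) = ip x y)}"
  have "\<exists>M\<in>\<C>. \<forall>X\<in>\<C>. M \<subseteq> X \<longrightarrow> X = M"
  proof (rule subset_Zorn')
    fix C assume C: "subset.chain \<C> C"
    have mem: "X \<in> \<C>" if "X \<in> C" for X using C that unfolding subset.chain_def by blast
    have "kcnj (ip x y) = ip x y" if X: "X \<in> C" "x \<in> X" and Y: "Y \<in> C" "y \<in> Y" for X Y x y
    proof -
      have "X \<subseteq> Y \<or> Y \<subseteq> X" using C X(1) Y(1) unfolding subset.chain_def by blast
      then obtain Z where "Z \<in> C" "x \<in> Z" "y \<in> Z" using X Y by blast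
      then show ?thesis using mem[of Z] by (simp add: \<C>_def)
    qed
    moreover have "B x \<in> X" if "X \<in> C" "x \<in> X" for X x
      using mem[OF that(1)] that(2) by (simp add: \<C>_def)
    ultimately show "\<Union>C \<in> \<C>"
      unfolding \<C>_def by (intro CollectI conjI ballI; elim UnionE; blast)
  qed
  then obtain S where S: "S \<in> \<C>" and max: "\<And>X. X \<in> \<C> \<Longrightarrow> S \<subseteq> X \<Longrightarrow> X = S" by blast
  have SB: "B x \<in> S" if "x \<in> S" for x using S that by (auto simp: \<C>_def)
  have Sip: "kcnj (ip x y) = ip x y" if "x \<in> S" "y \<in> S" for x y using S that by (auto simp: \<C>_def)
  have SBn: "(B ^^ n) x \<in> S" if "x \<in> S" for x n using that by (induction n) (auto simp: SB)
  have symn: "ip ((B ^^ n) x) y = ip x ((B ^^ n) y)" for n x y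
  proof (induction n arbitrary: y)
    case (Suc n)
    then show ?case by (simp add: sym) (simp add: funpow_swap1)
  qed simp
  have real_if_sym: "kcnj (ip x y) = ip x y \<longleftrightarrow> ip x y = ip y x" for x y
    by (metis ip_commute)
  have absorb: "x \<in> S" if x: "\<And>s. s \<in> S \<Longrightarrow> kcnj (ip x s) = ip x s" for x
  proof -
    \<comment> \<open>The whole orbit of x under B is adjoined, so that the larger set is again
      invariant. Symmetry of B makes the inner products within the orbit real, and moves its powers
      onto the elements of S.\<close>
    define T where "T = S \<union> range (\<lambda>n. (B ^^ n) x)"
    have 1: "ip ((B ^^ n) x) s = ip s ((B ^^ n) x)" if "s \<in> S" for n s
    proof -
      have "ip x ((B ^^ n) s) = ip ((B ^^ n) s) x" using x[OF SBn[OF that, of n]] real_if_sym by blast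
      then show ?thesis by (simp add: symn)
    qed
    have 2: "ip ((B ^^ n) x) ((B ^^ m) x) = ip ((B ^^ m) x) ((B ^^ n) x)" for n m
      by (metis symn funpow_add add.commute comp_apply)
    have "T \<in> \<C>"
      unfolding \<C>_def
    proof (intro CollectI conjI ballI)
      fix y assume "y \<in> T"
      moreover have "B ((B ^^ n) x) \<in> range (\<lambda>n. (B ^^ n) x)" for n
        by (rule range_eqI[of _ _ "Suc n"]) simp
      ultimately show "B y \<in> T" using SB by (auto simp: T_def)
    next
      fix y z assume "y \<in> T" "z \<in> T"
      then show "kcnj (ip y z) = ip y z"
        unfolding real_if_sym T_def using 1 2 Sip real_if_sym by auto
    qed
    then have "T = S" by (rule max) (simp add: T_def)
    moreover have "x \<in> T" using range_eqI[of x "\<lambda>n. (B ^^ n) x" 0] by (simp add: T_def)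
    ultimately show ?thesis by simp
  qed
  \<comment> \<open>Maximality describes S by conditions that are closed and real linear, so S turns
    out to be a closed real subspace.\<close>
  have S_eq: "S = (\<Inter>s\<in>S. {x. kcnj (ip x s) = ip x s})" using absorb Sip by blast
  have clS: "closed S"
    by (subst S_eq, intro closed_INT ballI closed_Collect_eq linear_continuous_on
        bounded_linear_compose[OF bounded_linear_kcnj] bounded_linear_ip)
  have S0: "0 \<in> S" by (rule absorb) simp
  have Sadd: "x + y \<in> S" if "x \<in> S" "y \<in> S" for x y
    by (rule absorb) (use that Sip in \<open>auto simp: ip_add_left kcnj_add\<close>)
  have Sscale: "r *\<^sub>R x \<in> S" if "x \<in> S" for x r
    by (rule absorb) (use that Sip in \<open>auto simp: ip_scaleR_left kcnj_mult\<close>)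
  have Sdiff: "x - y \<in> S" if "x \<in> S" "y \<in> S" for x y
    using Sadd[OF that(1) Sscale[OF that(2), of "-1"]] by simp
  have subS: "real_vector.subspace S"
    by (rule real_vector.subspaceI) (use S0 Sadd Sscale in auto)
  \<comment> \<open>First x and then -i times the remainder w are projected onto S. What is left
    after removing both parts is orthogonal to S in its real and in its imaginary part, so
    \<open>absorb\<close> puts it into S, where it is orthogonal to itself.\<close>
  have decomp: "\<exists>a\<in>S. \<exists>b\<in>S. x = a + smul i b" for x
  proof -
    obtain w where w: "x - w \<in> S" and ow: "\<And>s. s \<in> S \<Longrightarrow> rip s w = 0"
      using projection[OF subS] clS by (metis closure_closed)
    obtain v where v: "smul (- i) w - v \<in> S" and ov: "\<And>s. s \<in> S \<Longrightarrow> rip s v = 0"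
      using projection[OF subS] clS by (metis closure_closed)
    define b where "b = smul (- i) w - v"
    define u where "u = w - smul i b"
    have iu: "smul (- i) u = v"
      by (simp add: u_def b_def scale_right_diff_distrib scale_minus_left i(1))
    have us: "ip u s = 0" if s: "s \<in> S" for s
    proof -
      have "ip s b = ip b s" using Sip[OF s v] real_if_sym by (simp add: b_def)
      then have "ip s (smul i b) + ip (smul i b) s = 0"
        by (simp add: ip_scale_right ip_scale_left i(2))
      moreover have "ip s w + ip w s = 0" using of_real_rip[of s w] ow[OF s] by simp
      moreover have "ip s u + ip u s = (ip s w + ip w s) - (ip s (smul i b) + ip (smul i b) s)"
        by (simp add: u_def ip_diff_left ip_diff_right)
      ultimately have 1: "ip s u + ip u s = 0" by simp
      have "ip s (smul (- i) u) + ip (smul (- i) u) s = 0"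
        unfolding iu using of_real_rip[of s v] ov[OF s] by simp
      then have "i * (ip s u - ip u s) = 0"
        by (simp add: ip_scale_right ip_scale_left i(2) algebra_simps)
      then have "ip s u = ip u s" using i(1) by auto
      then have "2 * ip u s = 0" using 1 by simp
      then show ?thesis by simp
    qed
    have "u \<in> S" by (rule absorb) (simp add: us)
    then have "rip u u = 0" using us rip_of_real[of u u 0] by simp
    then have "u = 0" by (simp add: rip_self)
    then have "x = (x - w) + smul i b" by (simp add: u_def)
    then show ?thesis using w v by (metis b_def)
  qed
  \<comment> \<open>A relation is used since the decomposition is not yet known to be unique.
    Uniqueness comes out of \<open>Pip\<close>: the difference of two images of x is related to zero
    and hence has norm zero.\<close>
  define P where "P x x' \<longleftrightarrow> (\<exists>a\<in>S. \<exists>b\<in>S. x = a + smul i b \<and> x' = a - smul i b)" for x x'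
  have Pex: "\<exists>x'. P x x'" for x using decomp[of x] by (auto simp: P_def)
  have Padd: "P (x + y) (x' + y')" if Px: "P x x'" and Py: "P y y'" for x y x' y'
  proof -
    obtain a b where ab: "a \<in> S" "b \<in> S" "x = a + smul i b" "x' = a - smul i b"
      using Px by (auto simp: P_def)
    obtain c d where "c \<in> S" "d \<in> S" "y = c + smul i d" "y' = c - smul i d"
      using Py by (auto simp: P_def)
    with ab show ?thesis unfolding P_def
      by (intro bexI[of _ "a + c"] bexI[of _ "b + d"]) (auto simp: Sadd scale_right_distrib)
  qed
  have Pscale: "P (smul c x) (smul (kcnj c) x')" if P: "P x x'" for c x x'
  proof -
    obtain a b where ab: "a \<in> S" "b \<in> S" "x = a + smul i b" "x' = a - smul i b"
      using P by (auto simp: P_def)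
    obtain r t where c: "c = of_real r + of_real t * i" "kcnj c = of_real r - of_real t * i"
      using ex by blast
    have si: "smul (of_real t * i) y = t *\<^sub>R smul i y" for y
      by (metis scale_scale scale_of_real)
    have c': "smul c y = r *\<^sub>R y + t *\<^sub>R smul i y" for y
      unfolding c(1) by (simp only: scale_left_distrib scale_of_real si)
    have c'': "smul (kcnj c) y = r *\<^sub>R y - t *\<^sub>R smul i y" for y
      unfolding c(2) by (simp only: scale_left_diff_distrib scale_of_real si)
    show ?thesis unfolding P_def
    proof (rule bexI[of _ "r *\<^sub>R a - t *\<^sub>R b"], rule bexI[of _ "t *\<^sub>R a + r *\<^sub>R b"], intro conjI)
      show "r *\<^sub>R a - t *\<^sub>R b \<in> S" "t *\<^sub>R a + r *\<^sub>R b \<in> S"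
        using ab by (auto intro: Sadd Sdiff Sscale)
    qed (simp_all only: ab(3,4) c' c'', simp_all add: scale_right_distrib
          scale_right_diff_distrib ii smul_scaleR scaleR_add_right scaleR_diff_right algebra_simps del: scale_scale)
  qed
  have Pswap: "P x' x" if Px: "P x x'" for x x'
  proof -
    obtain a b where ab: "a \<in> S" "b \<in> S" "x = a + smul i b" "x' = a - smul i b"
      using Px by (auto simp: P_def)
    then show ?thesis unfolding P_def
      using Sscale[OF ab(2), of "-1"] by (intro bexI[of _ a] bexI[of _ "- b"]) auto
  qed
  have PB: "P (B x) (B x')" if Px: "P x x'" for x x'
  proof -
    obtain a b where ab: "a \<in> S" "b \<in> S" "x = a + smul i b" "x' = a - smul i b"
      using Px by (auto simp: P_def)
    have Bd: "B (a - y) = B a - B y" for y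
      using Badd[of "a - y" y] by simp
    show ?thesis unfolding P_def
      by (intro bexI[of _ "B a"] bexI[of _ "B b"]) (simp_all add: ab SB Badd Bd Bscale)
  qed
  have Pip: "ip x' y' = ip y x" if Px: "P x x'" and Py: "P y y'" for x x' y y'
  proof -
    obtain a b where ab: "a \<in> S" "b \<in> S" "x = a + smul i b" "x' = a - smul i b"
      using Px by (auto simp: P_def)
    obtain c d where cd: "c \<in> S" "d \<in> S" "y = c + smul i d" "y' = c - smul i d"
      using Py by (auto simp: P_def)
    have sw: "ip c a = ip a c" "ip c b = ip b c" "ip d a = ip a d" "ip d b = ip b d"
      using Sip ab cd real_if_sym by metis+
    show ?thesis
      unfolding ab cd by (simp add: ip_add_left ip_add_right ip_diff_left ip_diff_right
          ip_scale_left ip_scale_right i(2) sw algebra_simps)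
  qed
  have Puniq: "x' = x''" if "P x x'" "P x x''" for x x' x''
  proof -
    have "P (smul (-1) x) (smul (kcnj (-1)) x'')" by (rule Pscale) fact
    from Padd[OF that(1) this] have "P 0 (x' - x'')" by simp
    from Pip[OF this this] have "rip (x' - x'') (x' - x'') = 0" using rip_of_real[of _ _ 0] by simp
    then show ?thesis by (simp add: rip_self)
  qed
  define J where "J x = (SOME x'. P x x')" for x
  have PJ: "P x (J x)" for x unfolding J_def using Pex by (rule someI_ex)
  show thesis
  proof (rule that)
    show "J (x + y) = J x + J y" for x y by (rule Puniq[OF PJ Padd[OF PJ PJ]])
    show "J (smul c x) = smul (kcnj c) (J x)" for c x by (rule Puniq[OF PJ Pscale[OF PJ]])
    show "J (J x) = x" for x by (rule Puniq[OF PJ Pswap[OF PJ]])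
    show "ip (J x) (J y) = ip y x" for x y by (rule Pip[OF PJ PJ])
    show "J (B x) = B (J x)" for x by (rule Puniq[OF PJ PB[OF PJ]])
  qed
qed

end


section \<open>Transport of linear topologies\<close>

lemma coarser_antisym: "coarser S T \<Longrightarrow> coarser T S \<Longrightarrow> S = T"
  unfolding coarser_def by (metis topology_eq)

text \<open>By antisymmetry at most one topology is extremal, so the description is evaluated by
  exhibiting one. Both limits of the theorem are treated with explicit candidates, not with a
  general existence result.\<close>

lemma coarsest_linear_topology_eqI:
  assumes "linear_topology V T" "P T"
    and "\<And>T'. linear_topology V T' \<Longrightarrow> P T' \<Longrightarrow> coarser T T'"
  shows "coarsest_linear_topology V P = T"
  unfolding coarsest_linear_topology_def
  by (rule the_equality) (use assms coarser_antisym in blast)+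

lemma finest_linear_topology_eqI:
  assumes "linear_topology V T" "P T"
    and "\<And>T'. linear_topology V T' \<Longrightarrow> P T' \<Longrightarrow> coarser T' T"
  shows "finest_linear_topology V P = T"
  unfolding finest_linear_topology_def
  by (rule the_equality) (use assms coarser_antisym in blast)+

lemma openin_norm_topology:
  assumes "Metric_space (car N) (ndist N)"
  shows "openin (norm_topology N) U \<longleftrightarrow>
    U \<subseteq> car N \<and> (\<forall>x\<in>U. \<exists>r>0. \<forall>y\<in>car N. ndist N x y < r \<longrightarrow> y \<in> U)"
proof -
  interpret Metric_space "car N" "ndist N" by fact
  have "mball x r \<subseteq> U \<longleftrightarrow> (\<forall>y\<in>car N. ndist N x y < r \<longrightarrow> y \<in> U)"
    if "U \<subseteq> car N" "x \<in> U" for x r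
    using that by (auto simp: mball_def)
  then have "U \<subseteq> car N \<Longrightarrow> (\<forall>x\<in>U. \<exists>r>0. mball x r \<subseteq> U) \<longleftrightarrow>
      (\<forall>x\<in>U. \<exists>r>0. \<forall>y\<in>car N. ndist N x y < r \<longrightarrow> y \<in> U)"
    by (intro ball_cong refl) simp
  then show ?thesis
    unfolding norm_topology_def openin_mtopology Ball_def[of U] by blast
qed

lemma topspace_norm_topology:
  assumes "Metric_space (car N) (ndist N)"
  shows "topspace (norm_topology N) = car N"
  unfolding norm_topology_def using assms by (simp add: Metric_space.topspace_mtopology)

lemma vector_space_onD:
  assumes "vector_space_on V"
  shows "vzero V \<in> car V"
    and "x \<in> car V \<Longrightarrow> y \<in> car V \<Longrightarrow> vadd V x y \<in> car V"
    and "x \<in> car V \<Longrightarrow> vsmul V c x \<in> car V"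
    and "x \<in> car V \<Longrightarrow> y \<in> car V \<Longrightarrow> z \<in> car V \<Longrightarrow>
      vadd V (vadd V x y) z = vadd V x (vadd V y z)"
    and "x \<in> car V \<Longrightarrow> y \<in> car V \<Longrightarrow> vadd V x y = vadd V y x"
    and "x \<in> car V \<Longrightarrow> vadd V (vzero V) x = x"
    and "x \<in> car V \<Longrightarrow> \<exists>y\<in>car V. vadd V x y = vzero V"
    and "x \<in> car V \<Longrightarrow> y \<in> car V \<Longrightarrow>
      vsmul V c (vadd V x y) = vadd V (vsmul V c x) (vsmul V c y)"
    and "x \<in> car V \<Longrightarrow> vsmul V (b + c) x = vadd V (vsmul V b x) (vsmul V c x)"
    and "x \<in> car V \<Longrightarrow> vsmul V (b * c) x = vsmul V b (vsmul V c x)"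
    and "x \<in> car V \<Longrightarrow> vsmul V 1 x = x"
proof -
  note a = assms[unfolded vector_space_on_def]
  show "vzero V \<in> car V"
    using a[THEN conjunct1] by blast
  show "x \<in> car V \<Longrightarrow> y \<in> car V \<Longrightarrow> vadd V x y \<in> car V"
    using a[THEN conjunct2, THEN conjunct1] by blast
  show "x \<in> car V \<Longrightarrow> vsmul V c x \<in> car V"
    using a[THEN conjunct2, THEN conjunct2, THEN conjunct1] by blast
  show "x \<in> car V \<Longrightarrow> y \<in> car V \<Longrightarrow> z \<in> car V \<Longrightarrow>
      vadd V (vadd V x y) z = vadd V x (vadd V y z)"
    using a[THEN conjunct2, THEN conjunct2, THEN conjunct2, THEN conjunct1] by blast
  show "x \<in> car V \<Longrightarrow> y \<in> car V \<Longrightarrow> vadd V x y = vadd V y x"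
    using a[THEN conjunct2, THEN conjunct2, THEN conjunct2, THEN conjunct2, THEN conjunct1] by blast
  show "x \<in> car V \<Longrightarrow> vadd V (vzero V) x = x"
    using a[THEN conjunct2, THEN conjunct2, THEN conjunct2, THEN conjunct2, THEN conjunct2, THEN conjunct1] by blast
  show "x \<in> car V \<Longrightarrow> \<exists>y\<in>car V. vadd V x y = vzero V"
    using a[THEN conjunct2, THEN conjunct2, THEN conjunct2, THEN conjunct2, THEN conjunct2, THEN conjunct2, THEN conjunct1] by blast
  show "x \<in> car V \<Longrightarrow> y \<in> car V \<Longrightarrow>
      vsmul V c (vadd V x y) = vadd V (vsmul V c x) (vsmul V c y)"
    using a[THEN conjunct2, THEN conjunct2, THEN conjunct2, THEN conjunct2, THEN conjunct2, THEN conjunct2, THEN conjunct2, THEN conjunct1] by blast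
  show "x \<in> car V \<Longrightarrow> vsmul V (b + c) x = vadd V (vsmul V b x) (vsmul V c x)"
    using a[THEN conjunct2, THEN conjunct2, THEN conjunct2, THEN conjunct2, THEN conjunct2, THEN conjunct2, THEN conjunct2, THEN conjunct2, THEN conjunct1] by blast
  show "x \<in> car V \<Longrightarrow> vsmul V (b * c) x = vsmul V b (vsmul V c x)"
    using a[THEN conjunct2, THEN conjunct2, THEN conjunct2, THEN conjunct2, THEN conjunct2, THEN conjunct2, THEN conjunct2, THEN conjunct2, THEN conjunct2, THEN conjunct1] by blast
  show "x \<in> car V \<Longrightarrow> vsmul V 1 x = x"
    using a[THEN conjunct2, THEN conjunct2, THEN conjunct2, THEN conjunct2, THEN conjunct2, THEN conjunct2, THEN conjunct2, THEN conjunct2, THEN conjunct2, THEN conjunct2] by blast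
qed

text \<open>The axioms are pulled back along a surjection, which spares checking them for the direct
  limit with its operations defined as unions over representatives. That zero goes to zero is a
  premise because linearity yields it only once W is known to be a vector space.\<close>

lemma vector_space_on_transfer:
  assumes V: "vector_space_on V" and f: "linear_on V W f" and im: "f ` car V = car W"
    and z: "f (vzero V) = vzero W"
  shows "vector_space_on W"
proof -
  have ball: "(\<forall>y\<in>car W. P y) \<longleftrightarrow> (\<forall>x\<in>car V. P (f x))" for P
    unfolding im[symmetric] by blast
  have bex: "(\<exists>y\<in>car W. P y) \<longleftrightarrow> (\<exists>x\<in>car V. P (f x))" for P
    unfolding im[symmetric] by blast
  have 1: "vadd W (f x) (f y) = f (vadd V x y)" if "x \<in> car V" "y \<in> car V" for x y
    using f that by (simp add: linear_on_def)
  have 2: "vsmul W c (f x) = f (vsmul V c x)" if "x \<in> car V" for x c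
    using f that by (simp add: linear_on_def)
  have 3: "f x \<in> car W" if "x \<in> car V" for x using im that by blast
  note V' = vector_space_onD[OF V]
  note cl = V'(1,2,3,6) 1 2 3 z[symmetric]
  show ?thesis
    unfolding vector_space_on_def ball bex
  proof (intro conjI ballI allI)
    fix x y assume "x \<in> car V" "y \<in> car V"
    moreover from this have "vadd V x y = vadd V y x" by (rule V'(5))
    ultimately show "vadd W (f x) (f y) = vadd W (f y) (f x)" by (simp add: 1)
  next
    fix x assume x: "x \<in> car V"
    then obtain y where "y \<in> car V" "vadd V x y = vzero V" using V'(7) by blast
    then show "\<exists>y\<in>car V. vadd W (f x) (f y) = vzero W" using x 1[of x y] z by auto
    have "vsmul V 1 x = x" using x by (rule V'(11))
    then show "vsmul W 1 (f x) = f x" using x by (simp add: cl)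
  next
    fix x y w assume "x \<in> car V" "y \<in> car V" "w \<in> car V"
    moreover from this have "vadd V (vadd V x y) w = vadd V x (vadd V y w)" by (rule V'(4))
    ultimately show "vadd W (vadd W (f x) (f y)) (f w) = vadd W (f x) (vadd W (f y) (f w))"
      by (simp add: cl)
  next
    fix c x y assume "x \<in> car V" "y \<in> car V"
    moreover from this have "vsmul V c (vadd V x y) = vadd V (vsmul V c x) (vsmul V c y)" by (rule V'(8))
    ultimately show "vsmul W c (vadd W (f x) (f y)) = vadd W (vsmul W c (f x)) (vsmul W c (f y))"
      by (simp add: cl)
  next
    fix b c x assume x: "x \<in> car V"
    then have "vsmul V (b + c) x = vadd V (vsmul V b x) (vsmul V c x)"
      "vsmul V (b * c) x = vsmul V b (vsmul V c x)" by (rule V'(9), rule V'(10))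
    then show "vsmul W (b + c) (f x) = vadd W (vsmul W b (f x)) (vsmul W c (f x))"
      "vsmul W (b * c) (f x) = vsmul W b (vsmul W c (f x))"
      using x by (simp_all add: cl)
  qed (simp_all add: cl)
qed

lemma linear_topology_transfer:
  assumes V: "vector_space_on V" and T: "linear_topology V T" and f: "linear_on V W f"
    and h: "homeomorphic_map T S f" and im: "f ` car V = car W"
  shows "linear_topology W S"
proof -
  obtain g where "homeomorphic_maps T S f g" using h homeomorphic_map_maps by blast
  then have cf: "continuous_map T S f" and cg: "continuous_map S T g"
    and fg: "\<And>y. y \<in> topspace S \<Longrightarrow> f (g y) = y"
    by (auto simp: homeomorphic_maps_def)
  have tT: "topspace T = car V" using T by (simp add: linear_topology_def)
  have tS: "topspace S = car W" using homeomorphic_imp_surjective_map[OF h] tT im by simp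
  have gV: "g y \<in> car V" if "y \<in> car W" for y
    using continuous_map_image_subset_topspace[OF cg] that tS tT by auto
  have add: "continuous_map (prod_topology T T) T (\<lambda>(x, y). vadd V x y)"
    and sc: "continuous_map (prod_topology euclidean T) T (\<lambda>(c, x). vsmul V c x)"
    using T by (auto simp: linear_topology_def)
  have "continuous_map (prod_topology S S) S (f \<circ> (\<lambda>(x, y). vadd V x y) \<circ> (\<lambda>(x, y). (g x, g y)))"
    by (intro continuous_map_compose[OF _ continuous_map_compose[OF add cf]])
       (simp add: continuous_map_prod_top cg)
  then have "continuous_map (prod_topology S S) S (\<lambda>(x, y). vadd W x y)"
    by (rule continuous_map_eq) (use f gV fg tS in \<open>auto simp: linear_on_def\<close>)
  moreover have "continuous_map (prod_topology euclidean S) S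
      (f \<circ> (\<lambda>(c, x). vsmul V c x) \<circ> (\<lambda>(c, x). (c, g x)))"
    by (intro continuous_map_compose[OF _ continuous_map_compose[OF sc cf]])
       (simp add: continuous_map_prod_top cg)
  then have "continuous_map (prod_topology euclidean S) S (\<lambda>(c, x). vsmul W c x)"
    by (rule continuous_map_eq) (use f gV fg tS in \<open>auto simp: linear_on_def\<close>)
  ultimately show ?thesis using tS by (simp add: linear_topology_def)
qed

lemma homeomorphic_map_pullback_topology:
  assumes "bij_betw f A (topspace T)"
  shows "homeomorphic_map (pullback_topology A f T) T f"
  unfolding homeomorphic_map_def
proof (intro conjI)
  have ts: "topspace (pullback_topology A f T) = A"
    using assms by (auto simp: topspace_pullback_topology bij_betw_def)
  show "inj_on f (topspace (pullback_topology A f T))"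
    using assms by (simp add: ts bij_betw_def)
  show "quotient_map (pullback_topology A f T) T f"
    unfolding quotient_map_def ts
  proof (intro conjI allI impI)
    show "f ` A = topspace T" using assms by (simp add: bij_betw_def)
    fix U assume U: "U \<subseteq> topspace T"
    show "openin (pullback_topology A f T) {x \<in> A. f x \<in> U} = openin T U"
    proof
      assume "openin (pullback_topology A f T) {x \<in> A. f x \<in> U}"
      then obtain W where W: "openin T W" "{x \<in> A. f x \<in> U} = f -` W \<inter> A"
        by (auto simp: openin_pullback_topology)
      have "U = W"
      proof (intro equalityI subsetI)
        fix y assume "y \<in> U"
        then obtain x where "x \<in> A" "y = f x" using U assms by (auto simp: bij_betw_def)
        then show "y \<in> W" using W(2) \<open>y \<in> U\<close> by blast
      next
        fix y assume y: "y \<in> W"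
        then have "y \<in> topspace T" using openin_subset[OF W(1)] by blast
        then obtain x where "x \<in> A" "y = f x" using assms by (auto simp: bij_betw_def)
        then show "y \<in> U" using W(2) y by blast
      qed
      then show "openin T U" using W by simp
    qed (auto simp: openin_pullback_topology)
  qed
qed

lemma linear_on_inv_into:
  assumes V: "vector_space_on V" and f: "linear_on V W f" and bij: "bij_betw f (car V) (car W)"
  shows "linear_on W V (inv_into (car V) f)"
proof -
  let ?g = "inv_into (car V) f"
  have g: "?g y \<in> car V" "f (?g y) = y" if "y \<in> car W" for y
    using bij that by (auto simp: bij_betw_def inv_into_into f_inv_into_f)
  have gf: "?g (f x) = x" if "x \<in> car V" for x using bij that by (simp add: bij_betw_def)
  note V' = vector_space_onD(2,3)[OF V]
  show ?thesis
    unfolding linear_on_def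
  proof (intro conjI ballI allI)
    fix x y assume "x \<in> car W" "y \<in> car W"
    then show "?g (vadd W x y) = vadd V (?g x) (?g y)"
      using f g[of x] g[of y] gf[OF V'(1)[of "?g x" "?g y"]] by (simp add: linear_on_def)
  next
    fix c x assume "x \<in> car W"
    then show "?g (vsmul W c x) = vsmul V c (?g x)"
      using f g[of x] gf[OF V'(2)[of "?g x" c]] by (simp add: linear_on_def)
  qed (use g in auto)
qed

text \<open>A finest topology is given by a universal property, which a linear bijection transports:
  a competitor on W is pulled back to V, where \<open>finest\<close> applies. In the application V
  is the strong dual, \<open>h k\<close> is \<open>\<Theta> k\<close> and f is
  \<open>\<Psi>\<close>.\<close>

lemma homeomorphic_map_finest_linear_topology:
  assumes V: "vector_space_on V" and W: "vector_space_on W" and T: "linear_topology V T"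
    and f: "linear_on V W f" and bij: "bij_betw f (car V) (car W)"
    and P: "\<And>S. P S \<longleftrightarrow> (\<forall>k\<in>I. continuous_map (X k) S (\<lambda>x. f (h k x)))"
    and h: "\<And>k. k \<in> I \<Longrightarrow> continuous_map (X k) T (h k)"
    and finest: "\<And>T'. linear_topology V T' \<Longrightarrow> (\<And>k. k \<in> I \<Longrightarrow> continuous_map (X k) T' (h k))
      \<Longrightarrow> coarser T' T"
  shows "homeomorphic_map T (finest_linear_topology W P) f"
    and "linear_topology W (finest_linear_topology W P)"
proof -
  let ?g = "inv_into (car V) f"
  have tT: "topspace T = car V" using T by (simp add: linear_topology_def)
  have gbij: "bij_betw ?g (car W) (car V)" using bij by (rule bij_betw_inv_into)
  define S where "S = pullback_topology (car W) ?g T"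
  have hg: "homeomorphic_map S T ?g"
    unfolding S_def by (rule homeomorphic_map_pullback_topology) (simp add: tT gbij)
  have tS: "topspace S = car W"
    unfolding S_def topspace_pullback_topology tT using gbij by (auto simp: bij_betw_def)
  have maps: "homeomorphic_maps S T ?g f"
  proof -
    obtain k where k: "homeomorphic_maps S T ?g k" using hg homeomorphic_map_maps by blast
    have "k x = f x" if "x \<in> topspace T" for x
    proof -
      have "f x \<in> car W" "?g (f x) = x" using that bij tT by (auto simp: bij_betw_def)
      then show ?thesis using k tS unfolding homeomorphic_maps_def by metis
    qed
    then show ?thesis using k homeomorphic_maps_eq by blast
  qed
  then have hf: "homeomorphic_map T S f"
    using homeomorphic_map_maps homeomorphic_maps_sym by blast
  have im: "f ` car V = car W" using bij by (simp add: bij_betw_def)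
  have LS: "linear_topology W S" by (rule linear_topology_transfer[OF V T f hf im])
  have PS: "P S" unfolding P
    using h continuous_map_compose[OF _ homeomorphic_imp_continuous_map[OF hf]]
    by (fastforce simp: comp_def)
  have "finest_linear_topology W P = S"
  proof (rule finest_linear_topology_eqI[where P=P, OF LS PS])
    fix S' assume LS': "linear_topology W S'" and PS': "P S'"
    have tS': "topspace S' = car W" using LS' by (simp add: linear_topology_def)
    define T' where "T' = pullback_topology (car V) f S'"
    have hT': "homeomorphic_map T' S' f"
      unfolding T'_def by (rule homeomorphic_map_pullback_topology) (simp add: tS' bij)
    have tT': "topspace T' = car V"
      unfolding T'_def topspace_pullback_topology tS' using bij by (auto simp: bij_betw_def)
    obtain k where k: "homeomorphic_maps T' S' f k" using hT' homeomorphic_map_maps by blast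
    have kg: "k y = ?g y" if "y \<in> topspace S'" for y
    proof -
      have "?g y \<in> car V" "f (?g y) = y"
        using that bij tS' by (auto simp: bij_betw_def inv_into_into f_inv_into_f)
      then show ?thesis using k tT' unfolding homeomorphic_maps_def by metis
    qed
    have k': "homeomorphic_maps T' S' f ?g" using k kg homeomorphic_maps_eq by blast
    then have hg': "homeomorphic_map S' T' ?g"
      using homeomorphic_map_maps homeomorphic_maps_sym by blast
    have LT': "linear_topology V T'"
      by (rule linear_topology_transfer[OF W LS' linear_on_inv_into[OF V f bij] hg'])
         (use gbij in \<open>simp add: bij_betw_def\<close>)
    have "continuous_map (X k) T' (h k)" if "k \<in> I" for k
    proof -
      have "continuous_map (X k) T' (?g \<circ> (\<lambda>x. f (h k x)))"
        using PS' that homeomorphic_imp_continuous_map[OF hg'] unfolding P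
        by (intro continuous_map_compose) auto
      then show ?thesis
      proof (rule continuous_map_eq)
        fix x assume "x \<in> topspace (X k)"
        then have "h k x \<in> car V"
          using continuous_map_image_subset_topspace[OF h[OF that]] tT by blast
        then show "(?g \<circ> (\<lambda>x. f (h k x))) x = h k x" using bij by (simp add: bij_betw_def)
      qed
    qed
    then have co: "coarser T' T" by (rule finest[OF LT'])
    show "coarser S' S"
      unfolding coarser_def
    proof (intro allI impI)
      fix U assume U: "openin S' U"
      have Us: "U \<subseteq> car W" using openin_subset[OF U] tS' by simp
      have "openin T' {x \<in> topspace T'. f x \<in> U}"
        using openin_continuous_map_preimage[OF homeomorphic_imp_continuous_map[OF hT'] U] .
      then have "openin T {x \<in> car V. f x \<in> U}" using co tT' by (simp add: coarser_def)
      then have "openin S (f ` {x \<in> car V. f x \<in> U})"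
        using homeomorphic_map_openness_eq[OF hf] homeomorphic_imp_open_map[OF hf]
        by (auto simp: open_map_def)
      moreover have "f ` {x \<in> car V. f x \<in> U} = U" using Us unfolding im[symmetric] by blast
      ultimately show "openin S U" by simp
    qed
  qed
  then show "homeomorphic_map T (finest_linear_topology W P) f"
    "linear_topology W (finest_linear_topology W P)" using hf LS by auto
qed

lemma complete_tvs_transfer:
  assumes E: "tvs E" and F: "tvs F" and f: "linear_on E F f"
    and h: "homeomorphic_map (topo E) (topo F) f" and z: "f (vzero E) = vzero F"
    and compl: "complete_tvs E"
  shows "complete_tvs F"
  unfolding complete_tvs_def
proof (intro allI impI)
  fix G assume G: "cauchy_filter F G"
  obtain g where maps: "homeomorphic_maps (topo E) (topo F) f g" using h homeomorphic_map_maps by blast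
  have tE: "topspace (topo E) = car E" and tF: "topspace (topo F) = car F"
    using E F by (auto simp: tvs_def linear_topology_def)
  have fg: "f (g y) = y" "g y \<in> car E" if "y \<in> car F" for y
    using maps that continuous_map_image_subset_topspace[of "topo F" "topo E" g]
    unfolding homeomorphic_maps_def tE tF by auto
  have vs: "vector_space_on E" using E by (simp add: tvs_def)
  have vd: "vdiff E x y \<in> car E" if "x \<in> car E" "y \<in> car E" for x y
    using that by (simp add: vdiff_def vector_space_onD[OF vs])
  have fvd: "f (vdiff E x y) = vdiff F (f x) (f y)" if "x \<in> car E" "y \<in> car E" for x y
    using that f by (simp add: vdiff_def linear_on_def vector_space_onD(3)[OF vs])
  have inj: "inj_on f (car E)" using h tE by (metis homeomorphic_imp_injective_map)
  have evF: "eventually (\<lambda>x. x \<in> car F) G" using G by (simp add: cauchy_filter_def)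
  have "cauchy_filter E (filtermap g G)"
    unfolding cauchy_filter_def
  proof (intro conjI allI impI)
    show "filtermap g G \<noteq> bot" using G by (simp add: cauchy_filter_def filtermap_bot_iff)
    show "eventually (\<lambda>x. x \<in> car E) (filtermap g G)"
      using evF by (auto simp: eventually_filtermap fg elim: eventually_mono)
    fix U assume U: "openin (topo E) U \<and> vzero E \<in> U"
    then have "openin (topo F) (f ` U)" "vzero F \<in> f ` U"
      using homeomorphic_imp_open_map[OF h] unfolding open_map_def z[symmetric] by blast+
    then obtain S where S: "eventually (\<lambda>x. x \<in> S) G" "\<forall>x\<in>S. \<forall>y\<in>S. vdiff F x y \<in> f ` U"
      using G unfolding cauchy_filter_def by blast
    have UE: "U \<subseteq> car E" using U openin_subset tE by blast
    show "\<exists>S. eventually (\<lambda>x. x \<in> S) (filtermap g G) \<and> (\<forall>x\<in>S. \<forall>y\<in>S. vdiff E x y \<in> U)"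
    proof (intro exI conjI ballI)
      show "eventually (\<lambda>x. x \<in> g ` (S \<inter> car F)) (filtermap g G)"
        using eventually_conj[OF S(1) evF] by (auto simp: eventually_filtermap elim: eventually_mono)
      fix x y assume "x \<in> g ` (S \<inter> car F)" "y \<in> g ` (S \<inter> car F)"
      then obtain a b where ab: "a \<in> S" "a \<in> car F" "x = g a" "b \<in> S" "b \<in> car F" "y = g b" by blast
      then have "f (vdiff E x y) \<in> f ` U" using S(2) fvd[of x y] fg by auto
      then show "vdiff E x y \<in> U"
        using inj_onD[OF inj] vd[of x y] UE ab fg by (metis imageE subsetD)
    qed
  qed
  then obtain l where "limitin (topo E) (\<lambda>x. x) l (filtermap g G)"
    using compl by (auto simp: complete_tvs_def)
  then have "limitin (topo E) g l G"
    by (auto simp: limitin_def eventually_filtermap)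
  then have "limitin (topo F) (f \<circ> g) (f l) G"
    by (rule continuous_map_limit[OF homeomorphic_imp_continuous_map[OF h]])
  moreover have "eventually (\<lambda>x. (f \<circ> g) x = x) G"
    using evF by eventually_elim (simp add: fg)
  ultimately have "limitin (topo F) (\<lambda>x. x) (f l) G"
    by (rule limitin_transform_eventually[rotated])
  then show "\<exists>l. limitin (topo F) (\<lambda>x. x) l G" by blast
qed


section \<open>The strong dual\<close>

lemma continuous_map_nbhdI:
  assumes "\<And>x. x \<in> topspace X \<Longrightarrow> f x \<in> topspace Y"
    and "\<And>x V. x \<in> topspace X \<Longrightarrow> openin Y V \<Longrightarrow> f x \<in> V \<Longrightarrow>
      \<exists>U. openin X U \<and> x \<in> U \<and> (\<forall>y\<in>U. f y \<in> V)"
  shows "continuous_map X Y f"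
  unfolding continuous_map_eq_topcontinuous_at topcontinuous_at_def using assms by blast

lemma openin_topo_strong_dual: "openin (topo (strong_dual E)) = strong_open E"
  by (simp add: strong_dual_def topology_inverse' istopology_strong_open)

lemma strong_dual_simps [simp]:
  "car (strong_dual E) = dual_carrier E"
  "vadd (strong_dual E) = (\<lambda>f g. \<lambda>x\<in>car E. f x + g x)"
  "vzero (strong_dual E) = (\<lambda>x\<in>car E. 0)"
  "vsmul (strong_dual E) = (\<lambda>c f. \<lambda>x\<in>car E. c * f x)"
  by (simp_all add: strong_dual_def)

lemma tvs_bounded_empty: "tvs_bounded E {}"
  by (auto simp: tvs_bounded_def intro: exI[of _ 1])

lemma topspace_strong_dual: "topspace (topo (strong_dual E)) = dual_carrier E"
proof -
  have "strong_open E (dual_carrier E)"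
    unfolding strong_open_def by (auto intro!: exI[of _ "{}"] exI[of _ 1] tvs_bounded_empty)
  moreover have "W \<subseteq> dual_carrier E" if "strong_open E W" for W
    using that by (simp add: strong_open_def)
  ultimately show ?thesis unfolding topspace_def openin_topo_strong_dual by blast
qed

text \<open>Strict inequalities at all points of an infinite B leave no uniform margin, so the set
  they define need not be open. W therefore asks for a bound d < e that is uniform on B, and half of
  the gap e - d is the radius around its elements.\<close>

lemma strong_open_nbhd:
  assumes B: "tvs_bounded E B" and e: "e > 0" and f: "f \<in> dual_carrier E"
  obtains W where "strong_open E W" "f \<in> W"
    "\<And>g. g \<in> W \<Longrightarrow> g \<in> dual_carrier E \<and> (\<forall>x\<in>B. norm (g x - f x) < e)"
proof
  let ?W = "{g \<in> dual_carrier E. \<exists>d<e. \<forall>x\<in>B. norm (g x - f x) \<le> d}"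
  show "strong_open E ?W"
    unfolding strong_open_def
  proof (intro conjI ballI)
    fix g assume "g \<in> ?W"
    then obtain d where g: "g \<in> dual_carrier E" and d: "d < e" "\<And>x. x \<in> B \<Longrightarrow> norm (g x - f x) \<le> d"
      by blast
    have "{h \<in> dual_carrier E. \<forall>x\<in>B. norm (h x - g x) < (e - d) / 2} \<subseteq> ?W"
    proof safe
      fix h assume h: "\<forall>x\<in>B. norm (h x - g x) < (e - d) / 2"
      have "norm (h x - f x) \<le> (e + d) / 2" if "x \<in> B" for x
      proof -
        have "norm (h x - f x) \<le> norm (h x - g x) + norm (g x - f x)"
          using norm_triangle_ineq[of "h x - g x" "g x - f x"] by simp
        also have "\<dots> \<le> (e - d) / 2 + d" using h d(2) that by (intro add_mono) (auto simp: less_imp_le)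
        finally show ?thesis by (simp add: field_simps)
      qed
      then show "\<exists>d<e. \<forall>x\<in>B. norm (h x - f x) \<le> d" using d(1) by (intro exI[of _ "(e + d) / 2"]) auto
    qed
    then show "\<exists>B e. tvs_bounded E B \<and> e > 0 \<and>
        {h \<in> dual_carrier E. \<forall>x\<in>B. norm (h x - g x) < e} \<subseteq> ?W"
      using B d(1) by (intro exI[of _ B] exI[of _ "(e - d) / 2"]) auto
  qed auto
  show "f \<in> ?W" using f e by auto
  show "g \<in> dual_carrier E \<and> (\<forall>x\<in>B. norm (g x - f x) < e)" if "g \<in> ?W" for g
    using that by force
qed

lemma dual_carrierD:
  assumes "f \<in> dual_carrier E"
  shows "f \<in> extensional (car E)"
    and "x \<in> car E \<Longrightarrow> y \<in> car E \<Longrightarrow> f (vadd E x y) = f x + f y"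
    and "x \<in> car E \<Longrightarrow> f (vsmul E c x) = c * f x"
    and "continuous_map (topo E) euclidean f"
  using assms by (auto simp: dual_carrier_def)

context
  fixes E :: "('k::real_normed_field, 'v) tvspace"
  assumes tvs: "tvs E"
begin

lemma vs_E: "vector_space_on E" and top_E: "topspace (topo E) = car E"
  using tvs by (auto simp: tvs_def linear_topology_def)

lemmas vsE = vector_space_onD[OF vs_E]

lemma dual_zero:
  assumes "f \<in> dual_carrier E" shows "f (vzero E) = 0"
  using dual_carrierD(2)[OF assms vsE(1,1)] vsE(1,6) by simp

text \<open>The bound is the factor with which the preimage of the unit ball absorbs B. It enters
  the continuity of scalar multiplication on the strong dual.\<close>

lemma dual_bounded:
  assumes f: "f \<in> dual_carrier E" and B: "tvs_bounded E B"
  obtains M where "M \<ge> 0" "\<And>x. x \<in> B \<Longrightarrow> norm (f x) \<le> M"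
proof -
  define U where "U = {x \<in> topspace (topo E). f x \<in> ball 0 1}"
  have "openin (topo E) U" unfolding U_def
    by (rule openin_continuous_map_preimage[OF dual_carrierD(4)[OF f]]) simp
  moreover have "vzero E \<in> U" using vsE(1) dual_zero[OF f] by (simp add: U_def top_E)
  ultimately obtain r where r: "r > 0" "\<And>c. norm c \<ge> r \<Longrightarrow> B \<subseteq> vsmul E c ` U"
    using B unfolding tvs_bounded_def by blast
  have "norm (f x) \<le> r" if x: "x \<in> B" for x
  proof -
    have "B \<subseteq> vsmul E (of_real r) ` U" using r by simp
    then obtain y where "y \<in> U" "x = vsmul E (of_real r) y" using x by blast
    then show ?thesis using dual_carrierD(3)[OF f, of y "of_real r"] r(1)
      by (simp add: U_def top_E norm_mult mult_left_le)
  qed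
  then show thesis using that[of r] r(1) by simp
qed

text \<open>Continuity of scalar multiplication at (0, x) puts all small multiples of x into a given
  neighbourhood of zero. The consequence needed later is that the strong topology controls point
  evaluations.\<close>

lemma tvs_bounded_singleton:
  assumes x: "x \<in> car E" shows "tvs_bounded E {x}"
  unfolding tvs_bounded_def
proof (intro conjI allI impI)
  fix U assume U: "openin (topo E) U \<and> vzero E \<in> U"
  have z: "vsmul E 0 x = vzero E"
  proof -
    have s: "vsmul E 0 x \<in> car E" using x by (rule vsE(3))
    obtain y where y: "y \<in> car E" "vadd E (vsmul E 0 x) y = vzero E" using vsE(7)[OF s] by blast
    have "vadd E (vsmul E 0 x) (vsmul E 0 x) = vsmul E 0 x" using vsE(9)[OF x, of 0 0] by simp
    then have "vzero E = vadd E (vadd E (vsmul E 0 x) (vsmul E 0 x)) y" using y by simp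
    also have "\<dots> = vadd E (vsmul E 0 x) (vzero E)" using vsE(4)[OF s s y(1)] y(2) by simp
    also have "\<dots> = vsmul E 0 x" using vsE(5)[OF s vsE(1)] vsE(6)[OF s] by simp
    finally show ?thesis by simp
  qed
  have "continuous_map (prod_topology euclidean (topo E)) (topo E) (\<lambda>(c, x). vsmul E c x)"
    using tvs by (simp add: tvs_def linear_topology_def)
  then have "continuous_map euclidean (topo E) ((\<lambda>(c, x). vsmul E c x) \<circ> (\<lambda>c. (c, x)))"
    by (rule continuous_map_compose[rotated]) (simp add: continuous_map_pairedI x top_E)
  then have "openin euclidean {c \<in> topspace euclidean. ((\<lambda>(c, x). vsmul E c x) \<circ> (\<lambda>c. (c, x))) c \<in> U}"
    by (rule openin_continuous_map_preimage) (use U in blast)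
  then have "open {c. vsmul E c x \<in> U}" by simp
  moreover have "0 \<in> {c. vsmul E c x \<in> U}" using z U by simp
  ultimately obtain d where d: "d > 0" "ball 0 d \<subseteq> {c. vsmul E c x \<in> U}"
    by (meson openE)
  have "{x} \<subseteq> vsmul E c ` U" if c: "norm c \<ge> 2 / d" for c
  proof -
    have pos: "norm c > 0" using c d(1) by (smt (verit) divide_pos_pos)
    have "inverse (norm c) \<le> d / 2" using c d(1) pos by (simp add: field_simps)
    then have "norm (inverse c) \<le> d / 2" by (simp only: norm_inverse)
    then have "inverse c \<in> ball 0 d" using d(1) by simp
    then have "vsmul E (inverse c) x \<in> U" using d(2) by blast
    moreover have "vsmul E c (vsmul E (inverse c) x) = x"
      using vsE(10)[OF x, of c "inverse c"] vsE(11)[OF x] pos by simp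
    ultimately show ?thesis by (metis empty_subsetI imageI insert_subset)
  qed
  then show "\<exists>r>0. \<forall>c. r \<le> norm c \<longrightarrow> {x} \<subseteq> vsmul E c ` U" using d(1) by (intro exI[of _ "2 / d"]) auto
qed (use x in simp)

lemma vector_space_on_strong_dual: "vector_space_on (strong_dual E)"
proof -
  have add: "(\<lambda>x\<in>car E. f x + g x) \<in> dual_carrier E"
    if "f \<in> dual_carrier E" "g \<in> dual_carrier E" for f g
  proof -
    note D = dual_carrierD[OF that(1)] dual_carrierD[OF that(2)]
    have "continuous_map (topo E) euclidean (\<lambda>x\<in>car E. f x + g x)"
      by (rule continuous_map_eq[OF continuous_map_add[OF D(4,8)]]) (simp add: top_E)
    then show ?thesis by (simp add: dual_carrier_def vsE(2,3) D algebra_simps)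
  qed
  have sc: "(\<lambda>x\<in>car E. c * f x) \<in> dual_carrier E" if "f \<in> dual_carrier E" for f c
  proof -
    note D = dual_carrierD[OF that]
    have "continuous_map (topo E) euclidean ((*) c \<circ> f)"
      by (rule continuous_map_compose[OF D(4)]) (simp add: continuous_intros)
    then have "continuous_map (topo E) euclidean (\<lambda>x\<in>car E. c * f x)"
      by (rule continuous_map_eq) (simp add: top_E)
    then show ?thesis by (simp add: dual_carrier_def vsE(2,3) D algebra_simps)
  qed
  have z: "(\<lambda>x\<in>car E. 0) \<in> dual_carrier E"
  proof -
    have "continuous_map (topo E) euclidean (\<lambda>x\<in>car E. 0 :: 'k)"
      by (rule continuous_map_eq[of _ _ "\<lambda>_. 0"]) (simp_all add: top_E)
    then show ?thesis by (simp add: dual_carrier_def vsE(2,3))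
  qed
  have ext: "(\<lambda>x\<in>car E. f x) = f" if "f \<in> dual_carrier E" for f
    using dual_carrierD(1)[OF that] by (simp add: extensional_restrict)
  have neg: "\<exists>g\<in>dual_carrier E. (\<lambda>x\<in>car E. f x + g x) = (\<lambda>x\<in>car E. 0)" if "f \<in> dual_carrier E" for f
    by (rule bexI[OF _ sc[OF that, of "-1"]]) (auto simp: restrict_def)
  show ?thesis
    unfolding vector_space_on_def strong_dual_simps
    using add sc z neg ext
    by (intro conjI ballI allI) (auto simp: algebra_simps cong: restrict_cong)
qed

lemma tvs_strong_dual: "tvs (strong_dual E)"
  unfolding tvs_def linear_topology_def
proof (intro conjI vector_space_on_strong_dual)
  note vsD = vector_space_onD[OF vector_space_on_strong_dual]
  show "topspace (topo (strong_dual E)) = car (strong_dual E)" by (simp add: topspace_strong_dual)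
  show "continuous_map (prod_topology (topo (strong_dual E)) (topo (strong_dual E))) (topo (strong_dual E))
          (\<lambda>(x, y). vadd (strong_dual E) x y)"
  proof (rule continuous_map_nbhdI)
    fix p :: "('v \<Rightarrow> 'k) \<times> ('v \<Rightarrow> 'k)"
    assume "p \<in> topspace (prod_topology (topo (strong_dual E)) (topo (strong_dual E)))"
    then obtain f g where p: "p = (f, g)" and f: "f \<in> dual_carrier E" and g: "g \<in> dual_carrier E"
      by (auto simp: topspace_strong_dual)
    have fg: "vadd (strong_dual E) f g \<in> dual_carrier E" using vsD(2)[of f g] f g by simp
    then show "(case p of (x, y) \<Rightarrow> vadd (strong_dual E) x y) \<in> topspace (topo (strong_dual E))"
      by (simp add: p topspace_strong_dual)
    fix V assume "openin (topo (strong_dual E)) V" "(case p of (x, y) \<Rightarrow> vadd (strong_dual E) x y) \<in> V"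
    then obtain B e where B: "tvs_bounded E B" and e: "e > 0"
      and sub: "{h \<in> dual_carrier E. \<forall>x\<in>B. norm (h x - vadd (strong_dual E) f g x) < e} \<subseteq> V"
      unfolding p openin_topo_strong_dual strong_open_def by auto
    have BE: "B \<subseteq> car E" using B by (simp add: tvs_bounded_def)
    have e2: "e / 2 > 0" using e by simp
    obtain U where U: "strong_open E U" "f \<in> U"
      "\<And>h. h \<in> U \<Longrightarrow> h \<in> dual_carrier E \<and> (\<forall>x\<in>B. norm (h x - f x) < e / 2)"
      by (rule strong_open_nbhd[OF B e2 f]) (rule that)
    obtain W where W: "strong_open E W" "g \<in> W"
      "\<And>h. h \<in> W \<Longrightarrow> h \<in> dual_carrier E \<and> (\<forall>x\<in>B. norm (h x - g x) < e / 2)"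
      by (rule strong_open_nbhd[OF B e2 g]) (rule that)
    have "vadd (strong_dual E) h k \<in> V" if "h \<in> U" "k \<in> W" for h k
    proof (rule subsetD[OF sub], intro CollectI conjI ballI)
      show "vadd (strong_dual E) h k \<in> dual_carrier E" using vsD(2)[of h k] U(3) W(3) that by simp
      fix x assume x: "x \<in> B"
      have "norm ((h x - f x) + (k x - g x)) < e / 2 + e / 2"
        by (rule norm_add_less) (use U(3) W(3) that x in auto)
      moreover have "(h x - f x) + (k x - g x) = (h x + k x) - (f x + g x)" by simp
      ultimately show "norm (vadd (strong_dual E) h k x - vadd (strong_dual E) f g x) < e"
        using x BE by (auto simp: subset_iff)
    qed
    then show "\<exists>Z. openin (prod_topology (topo (strong_dual E)) (topo (strong_dual E))) Z \<and> p \<in> Z \<and>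
        (\<forall>y\<in>Z. (case y of (x, y) \<Rightarrow> vadd (strong_dual E) x y) \<in> V)"
      using U(1,2) W(1,2) by (intro exI[of _ "U \<times> W"]) (auto simp: openin_prod_Times_iff openin_topo_strong_dual p)
  qed
  show "continuous_map (prod_topology euclidean (topo (strong_dual E))) (topo (strong_dual E))
          (\<lambda>(c, x). vsmul (strong_dual E) c x)"
  proof (rule continuous_map_nbhdI)
    fix p :: "'k \<times> ('v \<Rightarrow> 'k)"
    assume "p \<in> topspace (prod_topology euclidean (topo (strong_dual E)))"
    then obtain c f where p: "p = (c, f)" and f: "f \<in> dual_carrier E"
      by (auto simp: topspace_strong_dual)
    have "vsmul (strong_dual E) c f \<in> dual_carrier E" using vsD(3)[of f c] f by simp
    then show "(case p of (c, x) \<Rightarrow> vsmul (strong_dual E) c x) \<in> topspace (topo (strong_dual E))"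
      by (simp add: p topspace_strong_dual)
    fix V assume "openin (topo (strong_dual E)) V" "(case p of (c, x) \<Rightarrow> vsmul (strong_dual E) c x) \<in> V"
    then obtain B e where B: "tvs_bounded E B" and e: "e > 0"
      and sub: "{h \<in> dual_carrier E. \<forall>x\<in>B. norm (h x - vsmul (strong_dual E) c f x) < e} \<subseteq> V"
      unfolding p openin_topo_strong_dual strong_open_def by auto
    have BE: "B \<subseteq> car E" using B by (simp add: tvs_bounded_def)
    obtain M where M: "M \<ge> 0" "\<And>x. x \<in> B \<Longrightarrow> norm (f x) \<le> M" by (rule dual_bounded[OF f B]) (rule that)
    \<comment> \<open>With a h - c f = a (h - f) + (a - c) f, the numbers \<open>e'\<close> and
      \<open>d\<close> keep both parts within e/2; \<open>d\<close> is at most 1 so that the norm of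
      a is at most that of c plus 1. The summands 1 in the denominators keep them positive.\<close>
    define d where "d = min 1 (e / (2 * (M + 1)))"
    define e' where "e' = e / (2 * (norm c + 1))"
    have c1: "norm c + 1 > 0" by (smt (verit) norm_ge_zero)
    have d: "d > 0" using e M(1) by (simp add: d_def)
    have e': "e' > 0" using e c1 by (simp add: e'_def)
    obtain W where W: "strong_open E W" "f \<in> W"
      "\<And>h. h \<in> W \<Longrightarrow> h \<in> dual_carrier E \<and> (\<forall>x\<in>B. norm (h x - f x) < e')"
      by (rule strong_open_nbhd[OF B e' f]) (rule that)
    have "vsmul (strong_dual E) a h \<in> V" if "a \<in> ball c d" "h \<in> W" for a h
    proof (rule subsetD[OF sub], intro CollectI conjI ballI)
      show "vsmul (strong_dual E) a h \<in> dual_carrier E" using vsD(3)[of h a] W(3) that by simp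
      fix x assume x: "x \<in> B"
      have ac: "norm (a - c) < d" using that(1) by (simp add: dist_norm norm_minus_commute)
      have na: "norm a \<le> norm c + 1"
        using norm_triangle_ineq[of "a - c" c] ac by (simp add: d_def)
      have "norm (a * (h x - f x)) \<le> (norm c + 1) * norm (h x - f x)"
        unfolding norm_mult using na by (rule mult_right_mono) simp
      also have "\<dots> < (norm c + 1) * e'" using W(3) that x c1 by (intro mult_strict_left_mono) auto
      also have "\<dots> = (norm c + 1) / (norm c + 1) * (e / 2)" unfolding e'_def times_divide_times_eq by (simp only: mult_ac times_divide_eq_right)
      also have "\<dots> = e / 2" using c1 by (subst divide_self) simp_all
      finally have 1: "norm (a * (h x - f x)) < e / 2" .
      have "norm ((a - c) * f x) \<le> d * M"
        unfolding norm_mult using ac M x d by (intro mult_mono) auto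
      also have "\<dots> \<le> e / (2 * (M + 1)) * (M + 1)" using M(1) e d by (intro mult_mono) (auto simp: d_def)
      also have "\<dots> = e / 2" using M(1) by (simp add: field_simps)
      finally have 2: "norm ((a - c) * f x) \<le> e / 2" .
      have "a * h x - c * f x = a * (h x - f x) + (a - c) * f x" by (simp add: algebra_simps)
      then have "norm (a * h x - c * f x) < e"
        using norm_triangle_ineq[of "a * (h x - f x)" "(a - c) * f x"] 1 2 by simp
      then show "norm (vsmul (strong_dual E) a h x - vsmul (strong_dual E) c f x) < e"
        using x BE by (auto simp: subset_iff)
    qed
    then show "\<exists>Z. openin (prod_topology euclidean (topo (strong_dual E))) Z \<and> p \<in> Z \<and>
        (\<forall>y\<in>Z. (case y of (c, x) \<Rightarrow> vsmul (strong_dual E) c x) \<in> V)"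
      using W(1,2) d by (intro exI[of _ "ball c d \<times> W"]) (auto simp: openin_prod_Times_iff openin_topo_strong_dual p)
  qed
qed

end

text \<open>A Cauchy filter converges, pointwise and uniformly on bounded sets, to a linear
  functional that is bounded on bounded sets. Only its continuity is in question, and this is what
  \<open>bornological\<close> supplies.\<close>

lemma complete_strong_dual:
  fixes E :: "('k::rc_field, 'v) tvspace"
  assumes tvs: "tvs E"
    and bornological: "\<And>f. f \<in> extensional (car E) \<Longrightarrow>
      (\<And>x y. x \<in> car E \<Longrightarrow> y \<in> car E \<Longrightarrow> f (vadd E x y) = f x + f y) \<Longrightarrow>
      (\<And>c x. x \<in> car E \<Longrightarrow> f (vsmul E c x) = c * f x) \<Longrightarrow>
      (\<And>B. tvs_bounded E B \<Longrightarrow> \<exists>M. \<forall>x\<in>B. norm (f x) \<le> M) \<Longrightarrow>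
      continuous_map (topo E) euclidean f"
  shows "complete_tvs (strong_dual E)"
  unfolding complete_tvs_def
proof (intro allI impI)
  fix F assume F: "Defs.cauchy_filter (strong_dual E) F"
  then have Fbot: "F \<noteq> bot" and evD: "eventually (\<lambda>f. f \<in> dual_carrier E) F"
    by (auto simp: Defs.cauchy_filter_def)
  note vsE = vector_space_onD[OF vs_E[OF tvs]]
  have zD: "(\<lambda>x\<in>car E. 0) \<in> dual_carrier E"
    using vector_space_onD(1)[OF vector_space_on_strong_dual[OF tvs]] by simp
  have unif: "\<exists>S. eventually (\<lambda>f. f \<in> S) F \<and> S \<subseteq> dual_carrier E \<and>
      (\<forall>f\<in>S. \<forall>g\<in>S. \<forall>x\<in>B. norm (f x - g x) < e)"
    if B: "tvs_bounded E B" and e: "e > 0" for B and e :: real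
  proof -
    have BE: "x \<in> car E" if "x \<in> B" for x using B that by (auto simp: tvs_bounded_def)
    obtain W where W: "strong_open E W" "(\<lambda>x\<in>car E. 0) \<in> W"
      "\<And>g. g \<in> W \<Longrightarrow> g \<in> dual_carrier E \<and> (\<forall>x\<in>B. norm (g x - (\<lambda>x\<in>car E. 0) x) < e)"
      by (rule strong_open_nbhd[OF B e zD]) (rule that)
    then obtain S where S: "eventually (\<lambda>f. f \<in> S) F" "\<forall>f\<in>S. \<forall>g\<in>S. vdiff (strong_dual E) f g \<in> W"
      using F unfolding Defs.cauchy_filter_def openin_topo_strong_dual by fastforce
    have "norm (f x - g x) < e" if "f \<in> S" "g \<in> S" "x \<in> B" for f g x
    proof -
      have "norm (vdiff (strong_dual E) f g x - (\<lambda>x\<in>car E. 0) x) < e"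
        using S(2) W(3) that by blast
      then show ?thesis using BE[OF that(3)] by (simp add: vdiff_def)
    qed
    then show ?thesis using eventually_conj[OF S(1) evD]
      by (intro exI[of _ "S \<inter> dual_carrier E"]) auto
  qed
  have "\<exists>l. ((\<lambda>f. f x) \<longlongrightarrow> l) F" if x: "x \<in> car E" for x
  proof -
    have "Topological_Spaces.cauchy_filter (filtermap (\<lambda>f. f x) F)"
      unfolding cauchy_filter_metric_filtermap
    proof (intro allI impI)
      fix e :: real assume "e > 0"
      then obtain S where "eventually (\<lambda>f. f \<in> S) F" "\<forall>f\<in>S. \<forall>g\<in>S. norm (f x - g x) < e"
        using unif[OF tvs_bounded_singleton[OF tvs x]] by blast
      then show "\<exists>P. eventually P F \<and> (\<forall>f g. P f \<and> P g \<longrightarrow> dist (f x) (g x) < e)"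
        by (intro exI[of _ "\<lambda>f. f \<in> S"]) (auto simp: dist_norm)
    qed
    then have "\<exists>l. filtermap (\<lambda>f. f x) F \<le> nhds l"
      by (rule cauchy_filter_complete_converges[OF _ complete_rc_field])
         (use Fbot in \<open>auto simp: filtermap_bot_iff\<close>)
    then show ?thesis by (simp add: filterlim_def)
  qed
  then obtain l0 where l0: "\<And>x. x \<in> car E \<Longrightarrow> ((\<lambda>f. f x) \<longlongrightarrow> l0 x) F" by metis
  define l where "l = restrict l0 (car E)"
  have l: "((\<lambda>f. f x) \<longlongrightarrow> l x) F" if "x \<in> car E" for x using l0[OF that] that by (simp add: l_def)
  \<comment> \<open>Passing to the limit weakens the strict bound, which is why the Cauchy condition
    is used with e/2 in the proof of convergence.\<close>
  have close: "norm (g x - l x) \<le> e"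
    if "eventually (\<lambda>f. f \<in> S) F" "\<forall>f\<in>S. norm (g x - f x) < e" "x \<in> car E" for S g x and e :: real
  proof (rule tendsto_upperbound[OF _ _ Fbot])
    show "((\<lambda>f. norm (g x - f x)) \<longlongrightarrow> norm (g x - l x)) F" by (intro tendsto_intros l that)
    show "eventually (\<lambda>f. norm (g x - f x) \<le> e) F"
      using that(1) by eventually_elim (use that(2) in \<open>auto simp: less_imp_le\<close>)
  qed
  have ladd: "l (vadd E x y) = l x + l y" if "x \<in> car E" "y \<in> car E" for x y
  proof (rule tendsto_unique[OF Fbot l[OF vsE(2)[OF that]]])
    have "eventually (\<lambda>f. f x + f y = f (vadd E x y)) F"
      using evD by eventually_elim (simp add: dual_carrierD that)
    then show "((\<lambda>f. f (vadd E x y)) \<longlongrightarrow> l x + l y) F"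
      by (rule Lim_transform_eventually[OF tendsto_add[OF l[OF that(1)] l[OF that(2)]]])
  qed
  have lsc: "l (vsmul E c x) = c * l x" if "x \<in> car E" for x c
  proof (rule tendsto_unique[OF Fbot l[OF vsE(3)[OF that]]])
    have "eventually (\<lambda>f. c * f x = f (vsmul E c x)) F"
      using evD by eventually_elim (simp add: dual_carrierD that)
    then show "((\<lambda>f. f (vsmul E c x)) \<longlongrightarrow> c * l x) F"
      by (rule Lim_transform_eventually[OF tendsto_mult_left[OF l[OF that]]])
  qed
  have "continuous_map (topo E) euclidean l"
  proof (rule bornological)
    fix B assume B: "tvs_bounded E B"
    have BE: "x \<in> car E" if "x \<in> B" for x using B that by (auto simp: tvs_bounded_def)
    obtain S where S: "eventually (\<lambda>f. f \<in> S) F" "S \<subseteq> dual_carrier E"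
      "\<forall>f\<in>S. \<forall>g\<in>S. \<forall>x\<in>B. norm (f x - g x) < 1" using unif[OF B, of 1] by auto
    obtain g where g: "g \<in> S" using eventually_happens'[OF Fbot S(1)] by blast
    obtain M where M: "\<And>x. x \<in> B \<Longrightarrow> norm (g x) \<le> M" using dual_bounded[OF tvs _ B, of g] g S(2) by blast
    have "norm (l x) \<le> M + 1" if "x \<in> B" for x
    proof -
      have "norm (g x - l x) \<le> 1" by (rule close[OF S(1)]) (use S(3) g that BE in auto)
      then show ?thesis using M[OF that] norm_triangle_sub[of "l x" "g x"]
        by (simp add: norm_minus_commute)
    qed
    then show "\<exists>M. \<forall>x\<in>B. norm (l x) \<le> M" by blast
  qed (use ladd lsc in \<open>auto simp: l_def\<close>)
  then have lD: "l \<in> dual_carrier E" using ladd lsc by (simp add: dual_carrier_def) (simp add: l_def)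
  have "limitin (topo (strong_dual E)) (\<lambda>x. x) l F"
    unfolding limitin_def topspace_strong_dual openin_topo_strong_dual
  proof (intro conjI allI impI lD)
    fix W assume "strong_open E W \<and> l \<in> W"
    then obtain B e where B: "tvs_bounded E B" and e: "e > 0"
      and sub: "{g \<in> dual_carrier E. \<forall>x\<in>B. norm (g x - l x) < e} \<subseteq> W"
      unfolding strong_open_def by blast
    have BE: "x \<in> car E" if "x \<in> B" for x using B that by (auto simp: tvs_bounded_def)
    obtain S where S: "eventually (\<lambda>f. f \<in> S) F" "S \<subseteq> dual_carrier E"
      "\<forall>f\<in>S. \<forall>g\<in>S. \<forall>x\<in>B. norm (f x - g x) < e / 2" using unif[OF B, of "e / 2"] e by auto
    have "g \<in> W" if g: "g \<in> S" for g
    proof (rule subsetD[OF sub], intro CollectI conjI ballI)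
      fix x assume x: "x \<in> B"
      have "norm (g x - l x) \<le> e / 2" by (rule close[OF S(1)]) (use S(3) g x BE in auto)
      then show "norm (g x - l x) < e" using e by simp
    qed (use S(2) g in blast)
    then show "eventually (\<lambda>x. x \<in> W) F" using S(1) by (auto elim: eventually_mono)
  qed
  then show "\<exists>l. limitin (topo (strong_dual E)) (\<lambda>x. x) l F" by blast
qed


text \<open>Sequences in X have to form a type of class \<open>real_vector\<close> before
  \<open>near_projection\<close> can be applied to the finitely supported ones in
  \<open>polar_decomposition\<close>.\<close>

instantiation "fun" :: (type, real_vector) real_vector
begin
definition scaleR_fun :: "real \<Rightarrow> ('a \<Rightarrow> 'b) \<Rightarrow> 'a \<Rightarrow> 'b" where "scaleR_fun r f = (\<lambda>x. r *\<^sub>R f x)"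
instance by standard (simp_all add: scaleR_fun_def fun_eq_iff algebra_simps)
end


section \<open>The scale of an invertible self-adjoint operator\<close>

locale invertible_self_adjoint = hilbert_space smul ip
  for smul :: "'k::rc_field \<Rightarrow> 'a::banach \<Rightarrow> 'a" and ip :: "'a \<Rightarrow> 'a \<Rightarrow> 'k" +
  fixes D :: "'a set" and A :: "'a \<Rightarrow> 'a"
  assumes linear_A: "linear_operator smul D A"
    and dense_D: "densely_defined D"
    and self_adjoint_A: "self_adjoint ip D A"
    and bij_A: "bij_betw A D UNIV"
    and bounded_inverse: "bounded_operator smul (inv_into D A)"
begin

section \<open>Powers of the bounded inverse\<close>

abbreviation B :: "'a \<Rightarrow> 'a" where "B \<equiv> inv_into D A"

lemma B_in_D: "B x \<in> D" and A_B: "A (B x) = x"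
  using bij_A by (auto simp: bij_betw_def inv_into_into f_inv_into_f)

lemma B_A: "x \<in> D \<Longrightarrow> B (A x) = x"
  using bij_A by (simp add: bij_betw_def)

lemma B_add: "B (x + y) = B x + B y" and B_smul: "B (smul c x) = smul c (B x)"
proof -
  have "Vector_Spaces.linear smul smul B" using bounded_inverse by (simp add: bounded_operator_def)
  then interpret Bl: Vector_Spaces.linear smul smul B .
  show "B (x + y) = B x + B y" "B (smul c x) = smul c (B x)" by (rule Bl.add, rule Bl.scale)
qed

lemma B_scaleR: "B (r *\<^sub>R x) = r *\<^sub>R B x"
  using B_smul[of "of_real r" x] by (simp add: scale_of_real)

text \<open>The bound for B is taken at least 1, so that its powers increase and the single factor
  \<open>\<beta> ^ k\<close> serves all exponents up to k.\<close>

definition \<beta> :: real where "\<beta> = (SOME K. K \<ge> 1 \<and> (\<forall>x. norm (B x) \<le> K * norm x))"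

lemma \<beta>: "\<beta> \<ge> 1" "norm (B x) \<le> \<beta> * norm x"
proof -
  obtain K where K: "\<And>x. norm (B x) \<le> K * norm x"
    using bounded_inverse by (auto simp: bounded_operator_def)
  have "norm (B x) \<le> max K 1 * norm x" for x
    using K[of x] mult_right_mono[of K "max K 1" "norm x"] by simp
  then have "\<exists>K. K \<ge> 1 \<and> (\<forall>x. norm (B x) \<le> K * norm x)" by (intro exI[of _ "max K 1"]) simp
  then have "\<beta> \<ge> 1 \<and> (\<forall>x. norm (B x) \<le> \<beta> * norm x)" unfolding \<beta>_def by (rule someI_ex)
  then show "\<beta> \<ge> 1" "norm (B x) \<le> \<beta> * norm x" by auto
qed

lemma Bn_add: "(B ^^ n) (x + y) = (B ^^ n) x + (B ^^ n) y"
  by (induction n) (simp_all add: B_add)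

lemma Bn_smul: "(B ^^ n) (smul c x) = smul c ((B ^^ n) x)"
  by (induction n) (simp_all add: B_smul)

lemma Bn_scaleR: "(B ^^ n) (r *\<^sub>R x) = r *\<^sub>R (B ^^ n) x"
  by (induction n) (simp_all add: B_scaleR)

lemma Bn_0 [simp]: "(B ^^ n) 0 = 0"
  using Bn_smul[of n 0 0] by simp

lemma Bn_diff: "(B ^^ n) (x - y) = (B ^^ n) x - (B ^^ n) y"
  using Bn_add[of n "x - y" y] by simp

lemma \<beta>_power_ge_1: "\<beta> ^ n \<ge> 1"
  using \<beta>(1) by (rule one_le_power)

lemma norm_Bn: "norm ((B ^^ n) x) \<le> \<beta> ^ n * norm x"
proof (induction n)
  case (Suc n)
  have "norm (B ((B ^^ n) x)) \<le> \<beta> * (\<beta> ^ n * norm x)"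
    by (rule order_trans[OF \<beta>(2) mult_left_mono[OF Suc]]) (use \<beta>(1) in simp)
  then show ?case by (simp add: mult.assoc)
qed simp

lemma bounded_linear_Bn: "bounded_linear (B ^^ n)"
  by (rule bounded_linear_intro[where K="\<beta> ^ n"])
     (use norm_Bn in \<open>auto simp: Bn_add Bn_scaleR mult.commute\<close>)

lemma An_Bn [simp]: "(A ^^ n) ((B ^^ n) x) = x"
proof (induction n)
  case (Suc n)
  have "(A ^^ Suc n) ((B ^^ Suc n) x) = (A ^^ n) (A (B ((B ^^ n) x)))" by (simp add: funpow_swap1)
  then show ?case using Suc by (simp add: A_B)
qed simp

lemma An_Bm: "n \<le> m \<Longrightarrow> (A ^^ n) ((B ^^ m) x) = (B ^^ (m - n)) x"
  by (auto simp: le_iff_add funpow_add)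

lemma inj_Bn: "(B ^^ n) x = (B ^^ n) y \<Longrightarrow> x = y"
  by (drule arg_cong[of _ _ "A ^^ n"]) simp

text \<open>Bijectivity of A turns the iterated domains into ranges of bounded operators that are
  defined everywhere. Domain conditions are handled in this form from here on.\<close>

lemma power_domain_eq: "power_domain D A n = range (B ^^ n)"
proof (induction n)
  case (Suc n)
  show ?case
  proof (intro equalityI subsetI)
    fix x assume "x \<in> power_domain D A (Suc n)"
    then obtain u where u: "x = (B ^^ n) u" "(A ^^ n) x \<in> D" using Suc by auto
    then have "u \<in> D" by simp
    then have "x = (B ^^ n) (B (A u))" using u by (simp add: B_A)
    then show "x \<in> range (B ^^ Suc n)" by (auto simp: funpow_swap1)
  next
    fix x assume "x \<in> range (B ^^ Suc n)"
    then obtain u where "x = (B ^^ n) (B u)" by (auto simp: funpow_swap1)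
    then show "x \<in> power_domain D A (Suc n)" using Suc B_in_D by auto
  qed
qed simp

lemma Bn_An: "x \<in> power_domain D A n \<Longrightarrow> (B ^^ n) ((A ^^ n) x) = x"
  by (auto simp: power_domain_eq)

lemma power_domain_add: "x \<in> power_domain D A n \<Longrightarrow> y \<in> power_domain D A n \<Longrightarrow>
    x + y \<in> power_domain D A n \<and> (A ^^ n) (x + y) = (A ^^ n) x + (A ^^ n) y"
  by (auto simp: power_domain_eq simp flip: Bn_add)

lemma power_domain_smul: "x \<in> power_domain D A n \<Longrightarrow>
    smul c x \<in> power_domain D A n \<and> (A ^^ n) (smul c x) = smul c ((A ^^ n) x)"
  by (auto simp: power_domain_eq simp flip: Bn_smul)

lemma power_domain_diff: "x \<in> power_domain D A n \<Longrightarrow> y \<in> power_domain D A n \<Longrightarrow>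
    x - y \<in> power_domain D A n \<and> (A ^^ n) (x - y) = (A ^^ n) x - (A ^^ n) y"
  by (auto simp: power_domain_eq simp flip: Bn_diff)

lemma zero_in_power_domain: "0 \<in> power_domain D A n"
  unfolding power_domain_eq by (metis Bn_0 rangeI)

text \<open>The adjoint is given by a description. Density of \<open>D\<close> makes the described
  vector unique, so it can be compared with any vector that satisfies the defining equation.\<close>

lemma A_symmetric: "x \<in> D \<Longrightarrow> y \<in> D \<Longrightarrow> ip (A x) y = ip x (A y)"
proof -
  assume xy: "x \<in> D" "y \<in> D"
  let ?P = "\<lambda>z. \<forall>x\<in>D. ip (A x) y = ip x z"
  have "y \<in> adjoint_domain ip D A" using self_adjoint_A xy by (simp add: self_adjoint_def)
  then obtain z where z: "?P z" by (auto simp: adjoint_domain_def)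
  have "z' = z" if "?P z'" for z'
  proof -
    have "z' - z = 0"
      by (rule eq_0_if_ip_dense[of D])
         (use dense_D that z in \<open>auto simp: densely_defined_def ip_diff_right\<close>)
    then show ?thesis by simp
  qed
  then have "adjoint_operator ip D A y = z"
    unfolding adjoint_operator_def using z by (intro the_equality) blast+
  then show ?thesis using self_adjoint_A xy z by (simp add: self_adjoint_def)
qed

lemma B_symmetric: "ip (B x) y = ip x (B y)"
  using A_symmetric[OF B_in_D B_in_D, of x y] by (simp add: A_B)

lemma Bn_symmetric: "ip ((B ^^ n) x) y = ip x ((B ^^ n) y)"
proof (induction n arbitrary: y)
  case (Suc n)
  then show ?case by (simp add: B_symmetric) (simp add: funpow_swap1)
qed simp

section \<open>The conjugation and the bilinear pairing\<close>

definition J :: "'a \<Rightarrow> 'a"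
  where "J = (SOME J. (\<forall>x y. J (x + y) = J x + J y) \<and> (\<forall>c x. J (smul c x) = smul (kcnj c) (J x)) \<and>
    (\<forall>x. J (J x) = x) \<and> (\<forall>x y. ip (J x) (J y) = ip y x) \<and> (\<forall>x. J (B x) = B (J x)))"

lemma J_add: "J (x + y) = J x + J y" and J_smul: "J (smul c x) = smul (kcnj c) (J x)"
  and J_J [simp]: "J (J x) = x" and ip_J_J: "ip (J x) (J y) = ip y x" and J_B: "J (B x) = B (J x)"
proof -
  have "\<exists>J. (\<forall>x y. J (x + y) = J x + J y) \<and> (\<forall>c x. J (smul c x) = smul (kcnj c) (J x)) \<and>
    (\<forall>x. J (J x) = x) \<and> (\<forall>x y. ip (J x) (J y) = ip y x) \<and> (\<forall>x. J (B x) = B (J x))"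
    by (rule conjugation_commuting[OF B_add B_smul B_symmetric]) blast
  then have *: "(\<forall>x y. J (x + y) = J x + J y) \<and> (\<forall>c x. J (smul c x) = smul (kcnj c) (J x)) \<and>
    (\<forall>x. J (J x) = x) \<and> (\<forall>x y. ip (J x) (J y) = ip y x) \<and> (\<forall>x. J (B x) = B (J x))"
    unfolding J_def by (rule someI_ex)
  show "J (x + y) = J x + J y" "J (smul c x) = smul (kcnj c) (J x)"
    "J (J x) = x" "ip (J x) (J y) = ip y x" "J (B x) = B (J x)" using * by blast+
qed

lemma J_0 [simp]: "J 0 = 0"
  using J_smul[of 0 0] by simp

lemma J_diff: "J (x - y) = J x - J y"
  using J_add[of "x - y" y] by simp

lemma norm_J: "norm (J x) = norm x"
proof -
  have "(of_real ((norm (J x))\<^sup>2) :: 'k) = of_real ((norm x)\<^sup>2)"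
    by (simp only: ip_self[symmetric] ip_J_J)
  then have "(norm (J x))\<^sup>2 = (norm x)\<^sup>2" by (simp only: of_real_eq_iff)
  then show ?thesis by simp
qed

lemma J_Bn: "J ((B ^^ n) x) = (B ^^ n) (J x)"
  by (induction n) (simp_all add: J_B)

text \<open>J cancels the conjugation in the second argument, so the pairing is bilinear. B remains
  symmetric for it because J commutes with B.\<close>

definition bf :: "'a \<Rightarrow> 'a \<Rightarrow> 'k" where "bf x y = ip x (J y)"

lemma bf_add_left: "bf (x + y) z = bf x z + bf y z"
  and bf_smul_left: "bf (smul c x) y = c * bf x y"
  and bf_add_right: "bf z (x + y) = bf z x + bf z y"
  and bf_smul_right: "bf x (smul c y) = c * bf x y"
  by (simp_all add: bf_def ip_add_left ip_scale_left ip_add_right ip_scale_right J_add J_smul kcnj_kcnj)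

lemma bf_diff_right: "bf z (x - y) = bf z x - bf z y"
  by (simp add: bf_def ip_diff_right J_diff)

lemma bf_0_right [simp]: "bf x 0 = 0"
  by (simp add: bf_def)

lemma norm_bf: "norm (bf x y) \<le> norm x * norm y"
  unfolding bf_def using ip_le[of x "J y"] by (simp add: norm_J)

lemma bf_Bn: "bf ((B ^^ n) x) y = bf x ((B ^^ n) y)"
  by (simp add: bf_def Bn_symmetric J_Bn)


subsection \<open>The projective limit\<close>

definition E :: "'a set" where "E = (\<Inter>n\<in>{1..}. power_domain D A n)"

lemma E_eq: "E = (\<Inter>n. range (B ^^ n))"
proof -
  have "x \<in> power_domain D A n" if "\<forall>n\<in>{1..}. x \<in> power_domain D A n" for x n
    using that bspec[OF that, of n] by (cases "n = 0") simp_all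
  then have "(\<Inter>n\<in>{1..}. power_domain D A n) = (\<Inter>n. power_domain D A n)" by blast
  then show ?thesis by (simp add: E_def power_domain_eq)
qed

lemma E_power_domain: "x \<in> E \<Longrightarrow> x \<in> power_domain D A n"
  by (simp add: E_eq power_domain_eq)

lemma E_add: "x \<in> E \<Longrightarrow> y \<in> E \<Longrightarrow> x + y \<in> E"
  and E_smul: "x \<in> E \<Longrightarrow> smul c x \<in> E"
  and E_diff: "x \<in> E \<Longrightarrow> y \<in> E \<Longrightarrow> x - y \<in> E"
  and E_0: "0 \<in> E"
  unfolding E_def
  by (simp_all add: power_domain_add power_domain_smul power_domain_diff zero_in_power_domain)

lemma An_add: "x \<in> E \<Longrightarrow> y \<in> E \<Longrightarrow> (A ^^ n) (x + y) = (A ^^ n) x + (A ^^ n) y"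
  and An_smul: "x \<in> E \<Longrightarrow> (A ^^ n) (smul c x) = smul c ((A ^^ n) x)"
  and An_diff: "x \<in> E \<Longrightarrow> y \<in> E \<Longrightarrow> (A ^^ n) (x - y) = (A ^^ n) x - (A ^^ n) y"
  and E_Bn_An: "x \<in> E \<Longrightarrow> (B ^^ n) ((A ^^ n) x) = x"
  by (simp_all add: power_domain_add power_domain_smul power_domain_diff Bn_An E_power_domain)

lemma An_0 [simp]: "(A ^^ n) 0 = 0"
  using An_Bn[of n 0] by simp

lemma E_scaleR: "x \<in> E \<Longrightarrow> r *\<^sub>R x \<in> E" and An_scaleR: "x \<in> E \<Longrightarrow> (A ^^ n) (r *\<^sub>R x) = r *\<^sub>R (A ^^ n) x"
  using E_smul[of x "of_real r"] An_smul[of x n "of_real r"] by (simp_all add: scale_of_real)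

lemma E_Bn: "x \<in> E \<Longrightarrow> (B ^^ n) x \<in> E"
  unfolding E_eq
proof
  fix m assume "x \<in> (\<Inter>n. range (B ^^ n))"
  then obtain u where "x = (B ^^ m) u" by blast
  then have "(B ^^ n) x = (B ^^ m) ((B ^^ n) u)"
    using funpow_add[of n m B] funpow_add[of m n B] by (simp add: add.commute fun_eq_iff)
  then show "(B ^^ n) x \<in> range (B ^^ m)" by blast
qed

lemma E_An: "x \<in> E \<Longrightarrow> (A ^^ n) x \<in> E"
  unfolding E_eq
proof
  fix m assume "x \<in> (\<Inter>n. range (B ^^ n))"
  then obtain u where "x = (B ^^ (n + m)) u" by blast
  then have "(A ^^ n) x = (B ^^ m) u" by (simp add: An_Bm)
  then show "(A ^^ n) x \<in> range (B ^^ m)" by blast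
qed

lemma E_J: "x \<in> E \<Longrightarrow> J x \<in> E" and An_J: "x \<in> E \<Longrightarrow> (A ^^ n) (J x) = J ((A ^^ n) x)"
proof -
  have "J ((B ^^ m) u) \<in> range (B ^^ m)" for m u by (simp add: J_Bn)
  then show "x \<in> E \<Longrightarrow> J x \<in> E" by (fastforce simp: E_eq)
  assume "x \<in> E"
  then have "(A ^^ n) (J x) = (A ^^ n) (J ((B ^^ n) ((A ^^ n) x)))" by (simp add: E_Bn_An)
  then show "(A ^^ n) (J x) = J ((A ^^ n) x)" by (simp add: J_Bn)
qed

text \<open>On E the vector \<open>(A ^^ j) x\<close> is the image of \<open>(A ^^ k) x\<close>
  under a power of B. Hence one seminorm dominates all lower ones, and finite families of seminorms
  can be replaced by a single one.\<close>

lemma norm_An_le: "x \<in> E \<Longrightarrow> j \<le> k \<Longrightarrow> norm ((A ^^ j) x) \<le> \<beta> ^ k * norm ((A ^^ k) x)"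
proof -
  assume x: "x \<in> E" and jk: "j \<le> k"
  have "norm ((A ^^ j) x) = norm ((B ^^ (k - j)) ((A ^^ k) x))"
    using An_Bm[OF jk, of "(A ^^ k) x"] E_Bn_An[OF x] by simp
  also have "\<dots> \<le> \<beta> ^ (k - j) * norm ((A ^^ k) x)" by (rule norm_Bn)
  also have "\<dots> \<le> \<beta> ^ k * norm ((A ^^ k) x)"
    using \<beta>(1) by (intro mult_right_mono power_increasing) auto
  finally show ?thesis .
qed

text \<open>A Mittag-Leffler argument: the ranges of all \<open>B\<^sup>n\<close> are dense, hence so is their intersection.\<close>

lemma dense_E: "closure E = UNIV"
proof -
  have "x \<in> closure E" for x
    unfolding closure_approachable
  proof (intro allI impI)
    fix e0 :: real assume "e0 > 0"
    define e where "e = e0 / 2"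
    have e: "e > 0" using \<open>e0 > 0\<close> by (simp add: e_def)
    have app: "\<exists>u. norm (v - B u) \<le> d" if "d > 0" for v d
    proof -
      have "v \<in> closure D" using dense_D by (simp add: densely_defined_def)
      then obtain w where "w \<in> D" "dist w v < d" using \<open>d > 0\<close> closure_approachable by blast
      then show ?thesis by (intro exI[of _ "A w"]) (simp add: B_A dist_norm norm_minus_commute)
    qed
    \<comment> \<open>The error made at stage n is later enlarged by \<open>B ^^ n\<close>, that is
      by a factor of at most \<open>\<beta> ^ n\<close>. The denominator compensates for this and
      leaves a series with sum e.\<close>
    have pos: "e * (1 / 2) ^ Suc n / \<beta> ^ n > 0" for n
      using e \<beta>(1) by simp
    obtain y where y0: "y 0 = x" and ySuc: "\<And>n. norm (y n - B (y (Suc n))) \<le> e * (1 / 2) ^ Suc n / \<beta> ^ n"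
      using dependent_nat_choice[of "\<lambda>n v. n = 0 \<longrightarrow> v = x"
          "\<lambda>n v u. norm (v - B u) \<le> e * (1 / 2) ^ Suc n / \<beta> ^ n"] app[OF pos] by auto
    \<comment> \<open>The limit \<open>z k\<close> of \<open>s k\<close> is to become the k-th
      preimage of the approximating vector: from \<open>B (z (Suc k)) = z k\<close> it follows that
      \<open>z 0\<close> lies in the range of every power of B.\<close>
    define s where "s k n = (B ^^ n) (y (k + n))" for k n
    have inc: "norm (s k (Suc n) - s k n) \<le> e * (1 / 2) ^ Suc n" for k n
    proof -
      have "s k (Suc n) - s k n = (B ^^ n) (B (y (Suc (k + n))) - y (k + n))"
        by (simp add: s_def Bn_diff funpow_swap1)
      also have "norm \<dots> \<le> \<beta> ^ n * norm (B (y (Suc (k + n))) - y (k + n))" by (rule norm_Bn)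
      also have "\<dots> \<le> \<beta> ^ n * (e * (1 / 2) ^ Suc (k + n) / \<beta> ^ (k + n))"
        using ySuc[of "k + n"] \<beta>(1) by (intro mult_left_mono) (auto simp: norm_minus_commute)
      also have "\<dots> = e * (1 / 2) ^ Suc n * ((1 / 2) ^ k / \<beta> ^ k)"
        using \<beta>(1) by (simp add: power_add)
      also have "\<dots> \<le> e * (1 / 2) ^ Suc n * 1"
      proof (intro mult_left_mono)
        have "(1 / 2 :: real) ^ k \<le> 1" by (rule power_le_one) auto
        then show "(1 / 2) ^ k / \<beta> ^ k \<le> 1" using \<beta>_power_ge_1[of k] by (simp add: divide_le_eq)
      qed (use e in auto)
      finally show ?thesis by simp
    qed
    have sumg: "(\<lambda>n. e * (1 / 2) ^ Suc n) sums e"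
      using sums_mult[OF power_half_series, of e] by simp
    have sabs: "summable (\<lambda>n. norm (s k (Suc n) - s k n))" for k
      by (rule summable_comparison_test'[OF sums_summable[OF sumg], of 0]) (use inc in simp)
    define z where "z k = s k 0 + (\<Sum>n. s k (Suc n) - s k n)" for k
    have lim: "s k \<longlonglongrightarrow> z k" for k
    proof -
      have "(\<lambda>n. s k 0 + (\<Sum>i<n. s k (Suc i) - s k i)) \<longlonglongrightarrow> z k"
        unfolding z_def by (intro tendsto_add tendsto_const summable_LIMSEQ summable_norm_cancel[OF sabs])
      then show ?thesis by (simp add: sum_lessThan_telescope)
    qed
    have step: "B (z (Suc k)) = z k" for k
    proof (rule LIMSEQ_unique)
      have "(\<lambda>n. (B ^^ 1) (s (Suc k) n)) \<longlonglongrightarrow> (B ^^ 1) (z (Suc k))"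
        by (rule bounded_linear.tendsto[OF bounded_linear_Bn lim])
      then show "(\<lambda>n. s k (Suc n)) \<longlonglongrightarrow> B (z (Suc k))" by (simp add: s_def)
      show "(\<lambda>n. s k (Suc n)) \<longlonglongrightarrow> z k" by (rule LIMSEQ_Suc[OF lim])
    qed
    have "z 0 = (B ^^ k) (z k)" for k
      by (induction k) (simp_all add: funpow_swap1 step)
    then have "z 0 \<in> E" by (auto simp: E_eq)
    moreover have "norm (z 0 - x) \<le> e"
    proof -
      have "norm (\<Sum>n. s 0 (Suc n) - s 0 n) \<le> (\<Sum>n. e * (1 / 2) ^ Suc n)"
        by (rule order_trans[OF summable_norm[OF sabs] suminf_le[OF inc sabs sums_summable[OF sumg]]])
      then show ?thesis using sums_unique[OF sumg] by (simp add: z_def s_def y0)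
    qed
    ultimately show "\<exists>w\<in>E. dist w x < e0" using \<open>e0 > 0\<close>
      by (intro bexI[of _ "z 0"]) (auto simp: dist_norm e_def)
  qed
  then show ?thesis by blast
qed

section \<open>Seminorm description of the projective limit\<close>

abbreviation pE :: "('k, 'a) tvspace" where "pE \<equiv> proj_interpolation smul D A"

lemma pE_simps [simp]: "car pE = E" "vadd pE = (+)" "vzero pE = 0" "vsmul pE = smul"
  by (simp_all add: proj_interpolation_def proj_limit_def proj_limit_vs_def whole_space_def
      interpolation_space_def E_def Let_def)

abbreviation interp :: "nat \<Rightarrow> ('k, 'a) nspace" where "interp \<equiv> interpolation_space smul D A"

lemma interp_simps [simp]: "car (interp n) = power_domain D A n"
  "vadd (interp n) = (+)" "vzero (interp n) = 0" "vsmul (interp n) = smul"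
  "nnorm (interp n) x = norm x + norm ((A ^^ n) x)"
  by (simp_all add: interpolation_space_def)

lemma smul_minus_1: "smul (-1) x = - x"
  using scale_minus_left[of 1 x] by simp

lemma ndist_interp:
  assumes "x \<in> power_domain D A n" "y \<in> power_domain D A n"
  shows "ndist (interp n) x y = norm (x - y) + norm ((A ^^ n) (x - y))"
  using assms by (simp add: ndist_def vdiff_def smul_minus_1)

lemma Metric_space_interp: "Metric_space (car (interp n)) (ndist (interp n))"
proof
  fix x y z
  show "0 \<le> ndist (interp n) x y" by (simp add: ndist_def)
  show "ndist (interp n) x y = ndist (interp n) y x"
  proof (cases "x \<in> power_domain D A n \<and> y \<in> power_domain D A n")
    case True
    then show ?thesis by (simp add: ndist_interp power_domain_diff norm_minus_commute)
  next
    case False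
    then show ?thesis by (auto simp: ndist_def)
  qed
  assume x: "x \<in> car (interp n)" and y: "y \<in> car (interp n)"
  show "(ndist (interp n) x y = 0) = (x = y)"
    using x y by (auto simp: ndist_interp add_nonneg_eq_0_iff)
  assume z: "z \<in> car (interp n)"
  show "ndist (interp n) x z \<le> ndist (interp n) x y + ndist (interp n) y z"
    using x y z norm_triangle_ineq[of "x - y" "y - z"]
      norm_triangle_ineq[of "(A ^^ n) x - (A ^^ n) y" "(A ^^ n) y - (A ^^ n) z"]
    by (simp add: ndist_interp power_domain_diff)
qed

text \<open>These are the open sets for the seminorms given by the norms of
  \<open>(A ^^ j) x\<close>, the explicit candidate for the coarsest topology. Requiring the bound
  for all j up to k makes the condition stronger as k grows, so two of them have a common
  refinement.\<close>

definition E_open :: "'a set \<Rightarrow> bool"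
  where "E_open U \<longleftrightarrow> U \<subseteq> E \<and> (\<forall>x\<in>U. \<exists>k. \<exists>e>0. \<forall>z\<in>E. (\<forall>j\<le>k. norm ((A ^^ j) (z - x)) < e) \<longrightarrow> z \<in> U)"

lemma istopology_E_open: "istopology E_open"
  unfolding istopology_def
proof (intro conjI allI impI)
  fix S T assume S: "E_open S" and T: "E_open T"
  show "E_open (S \<inter> T)"
    unfolding E_open_def
  proof (intro conjI ballI)
    show "S \<inter> T \<subseteq> E" using S by (auto simp: E_open_def)
    fix x assume "x \<in> S \<inter> T"
    then obtain k e l d where "e > 0" "\<And>z. z \<in> E \<Longrightarrow> (\<forall>j\<le>k. norm ((A ^^ j) (z - x)) < e) \<Longrightarrow> z \<in> S"
      "d > 0" "\<And>z. z \<in> E \<Longrightarrow> (\<forall>j\<le>l. norm ((A ^^ j) (z - x)) < d) \<Longrightarrow> z \<in> T"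
      using S T unfolding E_open_def by (metis IntD1 IntD2)
    then show "\<exists>k. \<exists>e>0. \<forall>z\<in>E. (\<forall>j\<le>k. norm ((A ^^ j) (z - x)) < e) \<longrightarrow> z \<in> S \<inter> T"
      by (intro exI[of _ "max k l"] exI[of _ "min e d"]) auto
  qed
next
  fix K assume "\<forall>S\<in>K. E_open S"
  then show "E_open (\<Union>K)" unfolding E_open_def by (meson Sup_le_iff UnionE UnionI)
qed

definition E_top :: "'a topology" where "E_top = topology E_open"

lemma openin_E_top: "openin E_top U \<longleftrightarrow> E_open U"
  by (simp add: E_top_def topology_inverse' istopology_E_open)

lemma topspace_E_top: "topspace E_top = E"
proof -
  have "E_open E" by (auto simp: E_open_def intro: exI[of _ 1])
  moreover have "U \<subseteq> E" if "E_open U" for U using that by (simp add: E_open_def)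
  ultimately show ?thesis unfolding topspace_def openin_E_top by blast
qed

lemma E_top_nbhd:
  assumes x: "x \<in> E" and e: "e > 0"
  obtains U where "openin E_top U" "x \<in> U" "\<And>z j. z \<in> U \<Longrightarrow> j \<le> k \<Longrightarrow> norm ((A ^^ j) (z - x)) < e"
proof
  let ?U = "{z \<in> E. \<exists>d<e. \<forall>j\<le>k. norm ((A ^^ j) (z - x)) \<le> d}"
  show "openin E_top ?U"
    unfolding openin_E_top E_open_def
  proof (intro conjI ballI)
    fix z assume "z \<in> ?U"
    then obtain d where z: "z \<in> E" and d: "d < e" "\<And>j. j \<le> k \<Longrightarrow> norm ((A ^^ j) (z - x)) \<le> d" by blast
    have "w \<in> ?U" if w: "w \<in> E" "\<forall>j\<le>k. norm ((A ^^ j) (w - z)) < (e - d) / 2" for w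
    proof -
      have "norm ((A ^^ j) (w - x)) \<le> (e + d) / 2" if "j \<le> k" for j
      proof -
        have "norm ((A ^^ j) (w - x)) \<le> norm ((A ^^ j) (w - z)) + norm ((A ^^ j) (z - x))"
          using norm_triangle_ineq[of "(A ^^ j) (w - z)" "(A ^^ j) (z - x)"] w z x
          by (simp add: An_diff)
        also have "\<dots> \<le> (e - d) / 2 + d" using w(2) d(2) that by (intro add_mono) (auto simp: less_imp_le)
        finally show ?thesis by (simp add: field_simps)
      qed
      then show ?thesis using w(1) d(1) by (auto intro!: exI[of _ "(e + d) / 2"])
    qed
    then show "\<exists>k. \<exists>e>0. \<forall>w\<in>E. (\<forall>j\<le>k. norm ((A ^^ j) (w - z)) < e) \<longrightarrow> w \<in> ?U"
      using d(1) by (intro exI[of _ k] exI[of _ "(e - d) / 2"]) auto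
  qed auto
  show "x \<in> ?U" using x e by auto
  show "norm ((A ^^ j) (z - x)) < e" if "z \<in> ?U" "j \<le> k" for z j
    using that by force
qed

lemma linear_topology_E_top: "linear_topology pE E_top"
  unfolding linear_topology_def
proof (intro conjI)
  show "topspace E_top = car pE" by (simp add: topspace_E_top)
  show "continuous_map (prod_topology E_top E_top) E_top (\<lambda>(x, y). vadd pE x y)"
  proof (rule continuous_map_nbhdI)
    fix p assume "p \<in> topspace (prod_topology E_top E_top)"
    then obtain x y where p: "p = (x, y)" and x: "x \<in> E" and y: "y \<in> E"
      by (auto simp: topspace_E_top)
    then show "(case p of (x, y) \<Rightarrow> vadd pE x y) \<in> topspace E_top" by (simp add: topspace_E_top E_add)
    fix V assume "openin E_top V" "(case p of (x, y) \<Rightarrow> vadd pE x y) \<in> V"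
    then have "E_open V" "x + y \<in> V" by (simp_all add: p openin_E_top)
    then obtain k e where e: "e > 0"
      and V: "\<And>z. z \<in> E \<Longrightarrow> (\<forall>j\<le>k. norm ((A ^^ j) (z - (x + y))) < e) \<Longrightarrow> z \<in> V"
      unfolding E_open_def by metis
    have e2: "e / 2 > 0" using e by simp
    obtain U where U: "openin E_top U" "x \<in> U" "\<And>z j. z \<in> U \<Longrightarrow> j \<le> k \<Longrightarrow> norm ((A ^^ j) (z - x)) < e / 2"
      by (rule E_top_nbhd[OF x e2]) (rule that)
    obtain W where W: "openin E_top W" "y \<in> W" "\<And>z j. z \<in> W \<Longrightarrow> j \<le> k \<Longrightarrow> norm ((A ^^ j) (z - y)) < e / 2"
      by (rule E_top_nbhd[OF y e2]) (rule that)
    have UW: "U \<subseteq> E" "W \<subseteq> E" using openin_subset U(1) W(1) topspace_E_top by blast+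
    have "u + w \<in> V" if u: "u \<in> U" and w: "w \<in> W" for u w
    proof (rule V)
      show "u + w \<in> E" using UW u w E_add by blast
      have E: "u \<in> E" "w \<in> E" using UW u w by blast+
      show "\<forall>j\<le>k. norm ((A ^^ j) (u + w - (x + y))) < e"
      proof (intro allI impI)
        fix j assume j: "j \<le> k"
        have eq: "u + w - (x + y) = (u - x) + (w - y)" by simp
        have "(A ^^ j) (u + w - (x + y)) = (A ^^ j) (u - x) + (A ^^ j) (w - y)"
          unfolding eq by (intro An_add E_diff E x y)
        moreover have "norm ((A ^^ j) (u - x) + (A ^^ j) (w - y)) < e / 2 + e / 2"
          by (rule norm_add_less) (use U(3) W(3) u w j in auto)
        ultimately show "norm ((A ^^ j) (u + w - (x + y))) < e" by simp
      qed
    qed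
    then show "\<exists>Z. openin (prod_topology E_top E_top) Z \<and> p \<in> Z \<and>
        (\<forall>q\<in>Z. (case q of (x, y) \<Rightarrow> vadd pE x y) \<in> V)"
      using U(1,2) W(1,2) by (intro exI[of _ "U \<times> W"]) (auto simp: openin_prod_Times_iff p)
  qed
  show "continuous_map (prod_topology euclidean E_top) E_top (\<lambda>(c, x). vsmul pE c x)"
  proof (rule continuous_map_nbhdI)
    fix p :: "'k \<times> 'a" assume "p \<in> topspace (prod_topology euclidean E_top)"
    then obtain c x where p: "p = (c, x)" and x: "x \<in> E"
      by (auto simp: topspace_E_top)
    then show "(case p of (c, x) \<Rightarrow> vsmul pE c x) \<in> topspace E_top" by (simp add: topspace_E_top E_smul)
    fix V assume "openin E_top V" "(case p of (c, x) \<Rightarrow> vsmul pE c x) \<in> V"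
    then have "E_open V" "smul c x \<in> V" by (simp_all add: p openin_E_top)
    then obtain k e where e: "e > 0"
      and V: "\<And>z. z \<in> E \<Longrightarrow> (\<forall>j\<le>k. norm ((A ^^ j) (z - smul c x)) < e) \<Longrightarrow> z \<in> V"
      unfolding E_open_def by metis
    define M where "M = (\<Sum>j\<le>k. norm ((A ^^ j) x))"
    have M: "norm ((A ^^ j) x) \<le> M" if "j \<le> k" for j
      unfolding M_def using that by (intro member_le_sum) auto
    have M0: "M \<ge> 0" unfolding M_def by (rule sum_nonneg) simp
    define d where "d = min 1 (e / (2 * (M + 1)))"
    define e' where "e' = e / (2 * (norm c + 1))"
    have c1: "norm c + 1 > 0" by (smt (verit) norm_ge_zero)
    have d: "d > 0" using e M0 by (simp add: d_def)
    have e': "e' > 0" using e c1 by (simp add: e'_def)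
    have dM: "d * M \<le> e / 2"
    proof -
      have "d * M \<le> e / (2 * (M + 1)) * (M + 1)" using M0 e d by (intro mult_mono) (auto simp: d_def)
      also have "\<dots> = e / 2" using M0 by (simp add: field_simps)
      finally show ?thesis .
    qed
    have ce': "(norm c + 1) * e' = e / 2"
    proof -
      have "(norm c + 1) * e' = (norm c + 1) / (norm c + 1) * (e / 2)"
        unfolding e'_def times_divide_times_eq by (simp only: mult_ac times_divide_eq_right)
      also have "\<dots> = e / 2" using c1 by (subst divide_self) simp_all
      finally show ?thesis .
    qed
    obtain U where U: "openin E_top U" "x \<in> U" "\<And>z j. z \<in> U \<Longrightarrow> j \<le> k \<Longrightarrow> norm ((A ^^ j) (z - x)) < e'"
      by (rule E_top_nbhd[OF x e']) (rule that)
    have UE: "U \<subseteq> E" using openin_subset U(1) topspace_E_top by blast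
    have "smul a u \<in> V" if a: "a \<in> ball c d" and u: "u \<in> U" for a u
    proof (rule V)
      have uE: "u \<in> E" using UE u by blast
      then show "smul a u \<in> E" by (rule E_smul)
      have ac: "norm (a - c) < d" using a by (simp add: dist_norm norm_minus_commute)
      have na: "norm a \<le> norm c + 1"
        using norm_triangle_ineq[of "a - c" c] ac by (simp add: d_def)
      show "\<forall>j\<le>k. norm ((A ^^ j) (smul a u - smul c x)) < e"
      proof (intro allI impI)
        fix j assume j: "j \<le> k"
        have "(A ^^ j) (smul a u - smul c x) = smul a ((A ^^ j) (u - x)) + smul (a - c) ((A ^^ j) x)"
          using uE x by (simp add: An_diff An_smul E_smul scale_right_diff_distrib scale_left_diff_distrib)
        then have "norm ((A ^^ j) (smul a u - smul c x))
            \<le> norm a * norm ((A ^^ j) (u - x)) + norm (a - c) * norm ((A ^^ j) x)"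
          using norm_triangle_ineq[of "smul a ((A ^^ j) (u - x))" "smul (a - c) ((A ^^ j) x)"]
          by (simp add: norm_smul)
        also have "norm a * norm ((A ^^ j) (u - x)) \<le> (norm c + 1) * norm ((A ^^ j) (u - x))"
          using na by (rule mult_right_mono) simp
        also have "\<dots> < (norm c + 1) * e'" using U(3)[OF u j] c1 by (rule mult_strict_left_mono)
        also have "norm (a - c) * norm ((A ^^ j) x) \<le> d * M"
          using ac M[OF j] d by (intro mult_mono) auto
        finally show "norm ((A ^^ j) (smul a u - smul c x)) < e" using dM ce' by linarith
      qed
    qed
    then show "\<exists>Z. openin (prod_topology euclidean E_top) Z \<and> p \<in> Z \<and>
        (\<forall>q\<in>Z. (case q of (c, x) \<Rightarrow> vsmul pE c x) \<in> V)"
      using U(1,2) d by (intro exI[of _ "ball c d \<times> U"]) (auto simp: openin_prod_Times_iff p)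
  qed
qed

lemma vector_space_on_pE: "vector_space_on pE"
proof -
  have "\<exists>y\<in>E. x + y = 0" if "x \<in> E" for x
    using E_diff[OF E_0 that] by (intro bexI[of _ "- x"]) auto
  then show ?thesis
    unfolding vector_space_on_def pE_simps
    by (auto simp: E_0 E_add E_smul scale_right_distrib scale_left_distrib add_ac)
qed

lemma linear_topology_proj_limit_vs:
  "linear_topology (proj_limit_vs (whole_space smul) interp) T = linear_topology pE T"
  by (simp add: linear_topology_def proj_limit_vs_def whole_space_def E_def)

lemma topo_pE: "topo pE = E_top"
proof -
  let ?P = "\<lambda>T. \<forall>k\<ge>1. continuous_map T (norm_topology (interp k)) (\<lambda>x. x)"
  have "topo pE = coarsest_linear_topology (proj_limit_vs (whole_space smul) interp) ?P"
    by (simp add: proj_interpolation_def proj_limit_def Let_def)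
  also have "\<dots> = E_top"
  proof (rule coarsest_linear_topology_eqI, unfold linear_topology_proj_limit_vs)
    show "linear_topology pE E_top" by (rule linear_topology_E_top)
    show "?P E_top"
    proof (intro allI impI continuous_map_nbhdI)
      fix k x assume "x \<in> topspace E_top"
      then have x: "x \<in> E" by (simp add: topspace_E_top)
      then show "x \<in> topspace (norm_topology (interp k))"
        by (simp add: topspace_norm_topology[OF Metric_space_interp] E_power_domain)
      fix V assume "openin (norm_topology (interp k)) V" "x \<in> V"
      then obtain r where r: "r > 0" "\<And>y. y \<in> power_domain D A k \<Longrightarrow> ndist (interp k) x y < r \<Longrightarrow> y \<in> V"
        unfolding openin_norm_topology[OF Metric_space_interp] by auto
      have r2: "r / 2 > 0" using r by simp
      obtain U where U: "openin E_top U" "x \<in> U" "\<And>z j. z \<in> U \<Longrightarrow> j \<le> k \<Longrightarrow> norm ((A ^^ j) (z - x)) < r / 2"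
        by (rule E_top_nbhd[OF x r2]) (rule that)
      have "y \<in> V" if y: "y \<in> U" for y
      proof (rule r(2))
        have yE: "y \<in> E" using openin_subset U(1) topspace_E_top y by blast
        then show "y \<in> power_domain D A k" by (rule E_power_domain)
        have "norm (x - y) < r / 2" "norm ((A ^^ k) (x - y)) < r / 2"
          using U(3)[OF y, of 0] U(3)[OF y, of k] x yE by (simp_all add: An_diff norm_minus_commute)
        then show "ndist (interp k) x y < r" using x yE by (simp add: ndist_interp E_power_domain)
      qed
      then show "\<exists>U. openin E_top U \<and> x \<in> U \<and> (\<forall>y\<in>U. y \<in> V)" using U by blast
    qed
    fix T' assume LT': "linear_topology pE T'" and P: "?P T'"
    have tT': "topspace T' = E" using LT' by (simp add: linear_topology_def)
    show "coarser E_top T'"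
      unfolding coarser_def
    proof (intro allI impI)
      fix U assume "openin E_top U"
      then have U: "E_open U" by (simp add: openin_E_top)
      show "openin T' U"
      proof (subst openin_subopen, intro ballI)
        fix x assume xU: "x \<in> U"
        then have x: "x \<in> E" using U by (auto simp: E_open_def)
        obtain k0 e where e: "e > 0"
          and V: "\<And>z. z \<in> E \<Longrightarrow> (\<forall>j\<le>k0. norm ((A ^^ j) (z - x)) < e) \<Longrightarrow> z \<in> U"
          using U xU unfolding E_open_def by metis
        \<comment> \<open>The maximum is taken because the spaces are indexed from 1. The radius
          \<open>e / \<beta> ^ k\<close> below comes from \<open>norm_An_le\<close>, through which
          the norm of the k-th space controls all lower seminorms.\<close>
        define k where "k = max k0 1"
        interpret M: Metric_space "car (interp k)" "ndist (interp k)" by (rule Metric_space_interp)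
        define W where "W = {z \<in> topspace T'. z \<in> M.mball x (e / \<beta> ^ k)}"
        have pos: "e / \<beta> ^ k > 0" using e \<beta>(1) by simp
        have "openin (norm_topology (interp k)) (M.mball x (e / \<beta> ^ k))"
          unfolding norm_topology_def by (rule M.openin_mball)
        moreover have "continuous_map T' (norm_topology (interp k)) (\<lambda>x. x)"
          using P by (simp add: k_def)
        ultimately have "openin T' W"
          unfolding W_def by (rule openin_continuous_map_preimage[rotated])
        moreover have W_eq: "W = {z \<in> E. ndist (interp k) x z < e / \<beta> ^ k}"
          unfolding W_def tT' M.in_mball using x by (auto simp: E_power_domain)
        moreover have "x \<in> W" using x pos by (simp add: W_eq ndist_interp E_power_domain)
        moreover have "W \<subseteq> U"
        proof
          fix z assume "z \<in> W"
          then have z: "z \<in> E" and nd: "ndist (interp k) x z < e / \<beta> ^ k" by (auto simp: W_eq)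
          show "z \<in> U"
          proof (rule V[OF z], intro allI impI)
            fix j assume "j \<le> k0"
            then have "norm ((A ^^ j) (z - x)) \<le> \<beta> ^ k * norm ((A ^^ k) (z - x))"
              by (intro norm_An_le E_diff z x) (simp add: k_def)
            also have "norm ((A ^^ k) (z - x)) \<le> ndist (interp k) x z"
              using x z by (simp add: ndist_interp E_power_domain An_diff norm_minus_commute)
            also have "\<beta> ^ k * \<dots> < e" using nd \<beta>(1) by (simp add: field_simps)
            finally show "norm ((A ^^ j) (z - x)) < e" using \<beta>(1) by (simp add: mult_left_mono)
          qed
        qed
        ultimately show "\<exists>T. openin T' T \<and> x \<in> T \<and> T \<subseteq> U" by blast
      qed
    qed
  qed
  finally show ?thesis .
qed

lemma tvs_pE: "tvs pE"
  by (simp add: tvs_def vector_space_on_pE topo_pE linear_topology_E_top)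

text \<open>Absorption by neighbourhoods is turned into a bound for each seminorm. By this criterion
  the polar sets in \<open>strong_dual_finest\<close> and the sequence in
  \<open>bounded_on_bounded_imp_continuous\<close> are recognised as bounded.\<close>

lemma tvs_bounded_pE:
  "tvs_bounded pE S \<longleftrightarrow> S \<subseteq> E \<and> (\<forall>j. \<exists>M. \<forall>x\<in>S. norm ((A ^^ j) x) \<le> M)"
proof (intro iffI conjI allI)
  assume S: "tvs_bounded pE S"
  then show "S \<subseteq> E" by (simp add: tvs_bounded_def)
  fix j
  have one: "(1::real) > 0" by simp
  obtain U where U: "openin E_top U" "0 \<in> U" "\<And>z i. z \<in> U \<Longrightarrow> i \<le> j \<Longrightarrow> norm ((A ^^ i) (z - 0)) < 1"
    by (rule E_top_nbhd[OF E_0 one]) (rule that)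
  have UE: "U \<subseteq> E" using openin_subset U(1) topspace_E_top by blast
  obtain r where r: "r > 0" "\<And>c. norm c \<ge> r \<Longrightarrow> S \<subseteq> smul c ` U"
    using S U unfolding tvs_bounded_def topo_pE pE_simps by blast
  have "norm ((A ^^ j) x) \<le> r" if "x \<in> S" for x
  proof -
    have "x \<in> smul (of_real r) ` U" using r that by (auto intro!: subsetD[OF r(2)])
    then obtain u where u: "u \<in> U" "x = smul (of_real r) u" by blast
    then have "norm ((A ^^ j) x) = r * norm ((A ^^ j) u)" using UE r(1) by (auto simp: An_smul norm_smul)
    also have "\<dots> \<le> r * 1" using U(3)[OF u(1), of j] r(1) by (intro mult_left_mono) auto
    finally show ?thesis by simp
  qed
  then show "\<exists>M. \<forall>x\<in>S. norm ((A ^^ j) x) \<le> M" by blast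
next
  assume S: "S \<subseteq> E \<and> (\<forall>j. \<exists>M. \<forall>x\<in>S. norm ((A ^^ j) x) \<le> M)"
  then obtain M where M: "\<And>j x. x \<in> S \<Longrightarrow> norm ((A ^^ j) x) \<le> M j" by metis
  show "tvs_bounded pE S"
    unfolding tvs_bounded_def topo_pE pE_simps
  proof (intro conjI allI impI)
    fix U assume "openin E_top U \<and> 0 \<in> U"
    then obtain k e where e: "e > 0"
      and U: "\<And>z. z \<in> E \<Longrightarrow> (\<forall>j\<le>k. norm ((A ^^ j) (z - 0)) < e) \<Longrightarrow> z \<in> U"
      unfolding openin_E_top E_open_def by metis
    define N where "N = (\<Sum>j\<le>k. \<bar>M j\<bar>)"
    have N: "\<bar>M j\<bar> \<le> N" if "j \<le> k" for j
      unfolding N_def using that by (intro member_le_sum) auto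
    have N0: "N \<ge> 0" unfolding N_def by (rule sum_nonneg) simp
    have "S \<subseteq> smul c ` U" if c: "norm c \<ge> (N + 1) / e" for c
    proof
      fix x assume x: "x \<in> S"
      have pos: "(N + 1) / e > 0" using N0 e by simp
      then have c0: "norm c > 0" using c by linarith
      have "smul (inverse c) x \<in> U"
      proof (rule U)
        show "smul (inverse c) x \<in> E" using S x E_smul by blast
        show "\<forall>j\<le>k. norm ((A ^^ j) (smul (inverse c) x - 0)) < e"
        proof (intro allI impI)
          fix j assume j: "j \<le> k"
          have "norm ((A ^^ j) x) < N + 1" using M[OF x, of j] N[OF j] by linarith
          also have "N + 1 \<le> e * norm c" using c e by (simp add: field_simps)
          finally have "norm ((A ^^ j) x) / norm c < e" using c0 by (simp add: divide_less_eq)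
          then have "inverse (norm c) * norm ((A ^^ j) x) < e" by (simp add: divide_inverse mult.commute)
          moreover have "x \<in> E" using S x by blast
          ultimately show "norm ((A ^^ j) (smul (inverse c) x - 0)) < e"
            by (simp only: diff_zero An_smul norm_smul norm_inverse)
        qed
      qed
      moreover have "x = smul c (smul (inverse c) x)" using c0 by simp
      ultimately show "x \<in> smul c ` U" by blast
    qed
    then show "\<exists>r>0. \<forall>c. r \<le> norm c \<longrightarrow> S \<subseteq> smul c ` U"
      using N0 e by (intro exI[of _ "(N + 1) / e"]) auto
  qed (use S in blast)
qed


subsection \<open>The dual of the projective limit\<close>

lemma E_openE:
  assumes "E_open U" "x \<in> U"
  obtains k e where "e > 0" "\<And>z. z \<in> E \<Longrightarrow> (\<forall>j\<le>k. norm ((A ^^ j) (z - x)) < e) \<Longrightarrow> z \<in> U"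
proof -
  have "\<exists>k. \<exists>e>0. \<forall>z\<in>E. (\<forall>j\<le>k. norm ((A ^^ j) (z - x)) < e) \<longrightarrow> z \<in> U"
    using assms unfolding E_open_def by blast
  then show thesis using that by blast
qed

lemma continuous_E_top:
  assumes add: "\<And>x y. x \<in> E \<Longrightarrow> y \<in> E \<Longrightarrow> f (x + y) = f x + f y"
    and le: "\<And>x. x \<in> E \<Longrightarrow> norm (f x) \<le> C * norm ((A ^^ n) x)"
  shows "continuous_map E_top euclidean (f :: 'a \<Rightarrow> 'k)"
proof (rule continuous_map_nbhdI)
  fix x V assume "x \<in> topspace E_top" and V: "openin euclidean V" "f x \<in> V"
  then have x: "x \<in> E" by (simp add: topspace_E_top)
  obtain r where r: "r > 0" "ball (f x) r \<subseteq> V" using V by (auto simp: open_contains_ball)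
  have rC: "r / (\<bar>C\<bar> + 1) > 0" using r by simp
  obtain U where U: "openin E_top U" "x \<in> U" "\<And>z j. z \<in> U \<Longrightarrow> j \<le> n \<Longrightarrow> norm ((A ^^ j) (z - x)) < r / (\<bar>C\<bar> + 1)"
    by (rule E_top_nbhd[OF x rC]) (rule that)
  have "f z \<in> V" if z: "z \<in> U" for z
  proof (rule subsetD[OF r(2)])
    have zE: "z \<in> E" using openin_subset U(1) topspace_E_top z by blast
    have "f z = f (z - x) + f x" using add[of "z - x" x] zE x by (simp add: E_diff)
    then have "norm (f z - f x) \<le> C * norm ((A ^^ n) (z - x))" using le[of "z - x"] zE x by (simp add: E_diff)
    also have "\<dots> \<le> (\<bar>C\<bar> + 1) * norm ((A ^^ n) (z - x))" by (rule mult_right_mono) auto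
    also have "\<dots> < (\<bar>C\<bar> + 1) * (r / (\<bar>C\<bar> + 1))"
      using U(3)[OF z, of n] by (intro mult_strict_left_mono) auto
    also have "\<dots> = r" by simp
    finally show "f z \<in> ball (f x) r" by (simp add: dist_norm norm_minus_commute)
  qed
  then show "\<exists>U. openin E_top U \<and> x \<in> U \<and> (\<forall>y\<in>U. f y \<in> V)" using U by blast
qed simp

text \<open>Continuity at zero involves finitely many seminorms, \<open>norm_An_le\<close> merges
  them into one, and scaling does the rest. The exponent is made at least 1 so that it is an index
  of the scale.\<close>

lemma dual_bound:
  assumes f: "f \<in> dual_carrier pE"
  obtains n C where "n \<ge> 1" "\<And>x. x \<in> E \<Longrightarrow> norm (f x) \<le> C * norm ((A ^^ n) x)"
proof -
  have scR: "f (r *\<^sub>R x) = of_real r * f x" if "x \<in> E" for r x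
    using dual_carrierD(3)[OF f, of x "of_real r"] that by (simp add: scale_of_real)
  have f0: "f 0 = 0" using dual_zero[OF tvs_pE f] by simp
  have "openin E_top {x \<in> topspace E_top. f x \<in> ball 0 1}"
    using dual_carrierD(4)[OF f] by (intro openin_continuous_map_preimage) (auto simp: topo_pE)
  then have "E_open {x \<in> E. norm (f x) < 1}" by (simp add: openin_E_top topspace_E_top)
  moreover have "0 \<in> {x \<in> E. norm (f x) < 1}" by (simp add: f0 E_0)
  ultimately obtain k e where e: "e > 0"
    and U: "\<And>z. z \<in> E \<Longrightarrow> (\<forall>j\<le>k. norm ((A ^^ j) (z - 0)) < e) \<Longrightarrow> z \<in> {x \<in> E. norm (f x) < 1}"
    by (rule E_openE) (rule that)
  define n where "n = max k 1"
  show thesis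
  proof (rule that)
    show "n \<ge> 1" by (simp add: n_def)
    fix x assume x: "x \<in> E"
    show "norm (f x) \<le> (2 * \<beta> ^ n / e) * norm ((A ^^ n) x)"
    proof (cases "(A ^^ n) x = 0")
      case True
      then have "x = 0" using E_Bn_An[OF x, of n] by simp
      then show ?thesis by (simp add: f0)
    next
      case False
      define t where "t = e / (2 * \<beta> ^ n * norm ((A ^^ n) x))"
      have b: "\<beta> ^ n > 0" using \<beta>(1) by simp
      have t: "t > 0" using e False b by (simp add: t_def)
      have "norm ((A ^^ j) (t *\<^sub>R x - 0)) < e" if "j \<le> k" for j
      proof -
        have "norm ((A ^^ j) (t *\<^sub>R x)) \<le> \<beta> ^ n * norm ((A ^^ n) (t *\<^sub>R x))"
          by (rule norm_An_le) (use x that in \<open>auto simp: E_scaleR n_def\<close>)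
        also have "\<dots> = \<beta> ^ n * (t * norm ((A ^^ n) x))" using t x by (simp add: An_scaleR)
        also have "\<dots> = e / 2" using False \<beta>(1) by (simp add: t_def)
        finally show ?thesis using e by simp
      qed
      then have "norm (f (t *\<^sub>R x)) < 1" using U[of "t *\<^sub>R x"] x E_scaleR by blast
      then have "t * norm (f x) < 1" using t x by (simp add: scR norm_mult)
      then have "norm (f x) < 1 / t" using t by (simp add: field_simps)
      also have "1 / t = (2 * \<beta> ^ n / e) * norm ((A ^^ n) x)" by (simp add: t_def)
      finally show ?thesis by simp
    qed
  qed
qed

section \<open>Parametrisation of the dual by vectors of X\<close>

definition \<Theta> :: "nat \<Rightarrow> 'a \<Rightarrow> 'a \<Rightarrow> 'k" where "\<Theta> n y = (\<lambda>x\<in>E. bf ((A ^^ n) x) y)"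

lemma \<Theta>_apply: "x \<in> E \<Longrightarrow> \<Theta> n y x = bf ((A ^^ n) x) y"
  by (simp add: \<Theta>_def)

lemma \<Theta>_dual: "\<Theta> n y \<in> dual_carrier pE"
proof -
  have "continuous_map E_top euclidean (\<Theta> n y)"
  proof (rule continuous_E_top)
    show "norm (\<Theta> n y x) \<le> norm y * norm ((A ^^ n) x)" if "x \<in> E" for x
      using norm_bf[of "(A ^^ n) x" y] that by (simp add: \<Theta>_apply mult.commute)
  qed (simp add: \<Theta>_apply E_add An_add bf_add_left)
  then show ?thesis
    by (simp add: dual_carrier_def topo_pE \<Theta>_apply E_add An_add bf_add_left E_smul An_smul bf_smul_left)
       (simp add: \<Theta>_def)
qed

text \<open>Composed with \<open>B ^^ n\<close>, the functional is bounded on E for the norm of X,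
  so \<open>riesz\<close> applies on E; substituting \<open>(A ^^ n) x\<close> recovers f. The
  vector is \<open>J y\<close> rather than \<open>y\<close> since \<open>bf\<close> applies J once
  more.\<close>

lemma dual_\<Theta>:
  assumes f: "f \<in> dual_carrier pE" obtains n y where "n \<ge> 1" "f = \<Theta> n y"
proof -
  obtain n C where n: "n \<ge> 1" and C: "\<And>x. x \<in> E \<Longrightarrow> norm (f x) \<le> C * norm ((A ^^ n) x)"
    by (rule dual_bound[OF f]) (rule that)
  define g where "g x = f ((B ^^ n) x)" for x
  obtain y where y: "\<And>x. x \<in> E \<Longrightarrow> g x = ip x y"
  proof (rule riesz[of E g C])
    show "subspace E" by (rule subspaceI) (auto simp: E_0 E_add E_smul)
    show "norm (g x) \<le> C * norm x" if "x \<in> E" for x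
      using C[OF E_Bn[OF that, of n]] by (simp add: g_def)
  qed (use dual_carrierD[OF f] in \<open>auto simp: g_def Bn_add Bn_smul E_Bn\<close>)
  have "f = \<Theta> n (J y)"
  proof (rule extensionalityI)
    show "f \<in> extensional E" using dual_carrierD(1)[OF f] by simp
    fix x assume x: "x \<in> E"
    have "f x = g ((A ^^ n) x)" using x by (simp add: g_def E_Bn_An)
    then show "f x = \<Theta> n (J y) x" using x by (simp add: y E_An \<Theta>_apply bf_def)
  qed (simp add: \<Theta>_def)
  then show thesis using that n by blast
qed

lemma \<Theta>_shift: "\<Theta> (n + k) ((B ^^ k) y) = \<Theta> n y"
proof (rule extensionalityI)
  fix x assume x: "x \<in> E"
  have "bf ((A ^^ (n + k)) x) ((B ^^ k) y) = bf ((B ^^ k) ((A ^^ k) ((A ^^ n) x))) y"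
    by (simp add: bf_Bn funpow_add add.commute[of n k])
  then show "\<Theta> (n + k) ((B ^^ k) y) x = \<Theta> n y x" using x by (simp add: \<Theta>_apply E_Bn_An E_An)
qed (simp_all add: \<Theta>_def)

text \<open>At the test vectors \<open>(B ^^ n) x\<close> the functional takes the value
  \<open>bf x y\<close>, and x ranges over the dense set E.\<close>

lemma \<Theta>_inj: "\<Theta> n y = \<Theta> n z \<Longrightarrow> y = z"
proof -
  assume eq: "\<Theta> n y = \<Theta> n z"
  have "J (y - z) = 0"
  proof (rule eq_0_if_ip_dense[OF dense_E])
    fix x assume x: "x \<in> E"
    have "\<Theta> n y ((B ^^ n) x) = \<Theta> n z ((B ^^ n) x)" using eq by simp
    then have "bf x y = bf x z" using x by (simp add: \<Theta>_apply E_Bn)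
    then show "ip x (J (y - z)) = 0" by (simp add: bf_def J_diff ip_diff_right)
  qed
  then have "norm (y - z) = 0" using norm_J[of "y - z"] by simp
  then show "y = z" by simp
qed

text \<open>Both functionals are lifted to the common level m + n, where \<open>\<Theta>\<close> is
  injective. The resulting equation is the one by which the direct limit identifies
  elements.\<close>

lemma \<Theta>_eq_iff: "\<Theta> m z = \<Theta> n y \<longleftrightarrow> (B ^^ n) z = (B ^^ m) y"
proof -
  have "\<Theta> m z = \<Theta> n y \<longleftrightarrow> \<Theta> (m + n) ((B ^^ n) z) = \<Theta> (n + m) ((B ^^ m) y)"
    by (simp only: \<Theta>_shift)
  also have "\<dots> \<longleftrightarrow> (B ^^ n) z = (B ^^ m) y"
    using \<Theta>_inj[of "m + n"] by (auto simp: add.commute)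
  finally show ?thesis .
qed

lemma \<Theta>_add_same: "vadd (strong_dual pE) (\<Theta> n x) (\<Theta> n y) = \<Theta> n (x + y)"
  by (rule extensionalityI[of _ E]) (auto simp: \<Theta>_def bf_add_right)

lemma \<Theta>_add: "vadd (strong_dual pE) (\<Theta> m x) (\<Theta> n y) = \<Theta> (m + n) ((B ^^ n) x + (B ^^ m) y)"
proof -
  have "vadd (strong_dual pE) (\<Theta> (m + n) ((B ^^ n) x)) (\<Theta> (m + n) ((B ^^ m) y))
      = \<Theta> (m + n) ((B ^^ n) x + (B ^^ m) y)" by (rule \<Theta>_add_same)
  moreover have "\<Theta> (m + n) ((B ^^ n) x) = \<Theta> m x" by (rule \<Theta>_shift)
  moreover have "\<Theta> (m + n) ((B ^^ m) y) = \<Theta> n y" using \<Theta>_shift[of n m y] by (simp add: add.commute)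
  ultimately show ?thesis by simp
qed

lemma \<Theta>_smul: "vsmul (strong_dual pE) c (\<Theta> n y) = \<Theta> n (smul c y)"
  by (rule extensionalityI[of _ E]) (auto simp: \<Theta>_def bf_smul_right)

lemma \<Theta>_0: "\<Theta> n 0 = vzero (strong_dual pE)"
  by (rule extensionalityI[of _ E]) (auto simp: \<Theta>_def)

lemma continuous_\<Theta>: "continuous_map euclidean (topo (strong_dual pE)) (\<Theta> n)"
proof (rule continuous_map_nbhdI)
  fix y show "\<Theta> n y \<in> topspace (topo (strong_dual pE))" by (simp add: topspace_strong_dual \<Theta>_dual)
  fix V assume "openin (topo (strong_dual pE)) V" "\<Theta> n y \<in> V"
  then obtain S e where S: "tvs_bounded pE S" and e: "e > 0"
    and sub: "{g \<in> dual_carrier pE. \<forall>x\<in>S. norm (g x - \<Theta> n y x) < e} \<subseteq> V"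
    unfolding openin_topo_strong_dual strong_open_def by blast
  obtain M where M: "\<And>x. x \<in> S \<Longrightarrow> norm ((A ^^ n) x) \<le> M" and SE: "S \<subseteq> E"
    using S unfolding tvs_bounded_pE by metis
  have "\<Theta> n z \<in> V" if z: "z \<in> ball y (e / (\<bar>M\<bar> + 1))" for z
  proof (rule subsetD[OF sub], intro CollectI conjI ballI \<Theta>_dual)
    fix x assume x: "x \<in> S"
    have "norm (\<Theta> n z x - \<Theta> n y x) = norm (bf ((A ^^ n) x) (z - y))"
      using x SE by (auto simp: \<Theta>_apply bf_diff_right)
    also have "\<dots> \<le> norm ((A ^^ n) x) * norm (z - y)" by (rule norm_bf)
    also have "\<dots> \<le> (\<bar>M\<bar> + 1) * norm (z - y)" using M[OF x] by (intro mult_right_mono) auto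
    also have "\<dots> < (\<bar>M\<bar> + 1) * (e / (\<bar>M\<bar> + 1))"
      using z by (intro mult_strict_left_mono) (auto simp: dist_norm norm_minus_commute)
    also have "\<dots> = e" by simp
    finally show "norm (\<Theta> n z x - \<Theta> n y x) < e" .
  qed
  then show "\<exists>U. openin euclidean U \<and> y \<in> U \<and> (\<forall>z\<in>U. \<Theta> n z \<in> V)"
    using e by (intro exI[of _ "ball y (e / (\<bar>M\<bar> + 1))"]) auto
qed

text \<open>If no seminorm dominated f, there would be vectors x_n at which f exceeds n while the
  seminorms of index up to n are at most 1. They form a bounded set on which f is unbounded.\<close>

lemma bounded_on_bounded_imp_continuous:
  assumes add: "\<And>x y. x \<in> E \<Longrightarrow> y \<in> E \<Longrightarrow> f (x + y) = f x + f y"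
    and scale: "\<And>c x. x \<in> E \<Longrightarrow> f (smul c x) = c * f x"
    and bdd: "\<And>S. tvs_bounded pE S \<Longrightarrow> \<exists>M. \<forall>x\<in>S. norm (f x) \<le> M"
  shows "continuous_map (topo pE) euclidean (f :: 'a \<Rightarrow> 'k)"
proof -
  have scR: "norm (f (r *\<^sub>R x)) = \<bar>r\<bar> * norm (f x)" if "x \<in> E" for r x
    using scale[OF that, of "of_real r"] by (simp add: scale_of_real norm_mult)
  have "\<exists>n C. \<forall>x\<in>E. norm (f x) \<le> C * norm ((A ^^ n) x)"
  proof (rule ccontr)
    assume neg: "\<not> ?thesis"
    have "\<exists>x\<in>E. norm (f x) > real n \<and> (\<forall>j\<le>n. norm ((A ^^ j) x) \<le> 1)" for n
    proof -
      obtain x where x: "x \<in> E" "norm (f x) > (real n * \<beta> ^ n) * norm ((A ^^ n) x)"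
        using neg by (meson not_le)
      have "(A ^^ n) x \<noteq> 0"
      proof
        assume "(A ^^ n) x = 0"
        then have "x = 0" using E_Bn_An[OF x(1), of n] by simp
        then have "f x = 0" using scale[OF E_0, of 0] by simp
        then show False using x(2) \<open>x = 0\<close> by simp
      qed
      define t where "t = 1 / (\<beta> ^ n * norm ((A ^^ n) x))"
      have b: "\<beta> ^ n > 0" using \<beta>(1) by simp
      have t: "t > 0" using \<open>(A ^^ n) x \<noteq> 0\<close> b by (simp add: t_def)
      have "norm ((A ^^ j) (t *\<^sub>R x)) \<le> 1" if "j \<le> n" for j
      proof -
        have "norm ((A ^^ j) (t *\<^sub>R x)) \<le> \<beta> ^ n * norm ((A ^^ n) (t *\<^sub>R x))"
          by (rule norm_An_le) (use x that in \<open>auto simp: E_scaleR\<close>)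
        also have "\<dots> = \<beta> ^ n * (t * norm ((A ^^ n) x))" using t x by (simp add: An_scaleR)
        also have "\<dots> = 1" using \<open>(A ^^ n) x \<noteq> 0\<close> \<beta>(1) by (simp add: t_def)
        finally show ?thesis .
      qed
      moreover have "norm (f (t *\<^sub>R x)) > real n"
      proof -
        have "real n = t * ((real n * \<beta> ^ n) * norm ((A ^^ n) x))"
          using \<open>(A ^^ n) x \<noteq> 0\<close> \<beta>(1) by (auto simp: t_def)
        also have "\<dots> < t * norm (f x)" using x(2) t by (rule mult_strict_left_mono)
        finally show ?thesis using t x by (simp add: scR)
      qed
      ultimately show ?thesis using x(1) E_scaleR by blast
    qed
    then obtain x where x: "\<And>n. x n \<in> E" "\<And>n. norm (f (x n)) > real n"
      "\<And>n j. j \<le> n \<Longrightarrow> norm ((A ^^ j) (x n)) \<le> 1" by metis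
    have "tvs_bounded pE (range x)"
      unfolding tvs_bounded_pE
    proof (intro conjI allI)
      fix j
      \<comment> \<open>Only the finitely many indices n < j escape the bound 1 for the j-th
        seminorm; their values are summed up.\<close>
      have "norm ((A ^^ j) (x n)) \<le> 1 + (\<Sum>i<j. norm ((A ^^ j) (x i)))" for n
      proof (cases "j \<le> n")
        case True
        then show ?thesis using x(3)[OF True] sum_nonneg[of "{..<j}" "\<lambda>i. norm ((A ^^ j) (x i))"]
          by simp
      next
        case False
        then have "norm ((A ^^ j) (x n)) \<le> (\<Sum>i<j. norm ((A ^^ j) (x i)))"
          by (intro member_le_sum) auto
        then show ?thesis by simp
      qed
      then show "\<exists>M. \<forall>y\<in>range x. norm ((A ^^ j) y) \<le> M" by blast
    qed (use x(1) in blast)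
    then obtain M where "\<And>n. norm (f (x n)) \<le> M" using bdd by blast
    moreover obtain n where "M < real n" using reals_Archimedean2 by blast
    ultimately show False using x(2)[of n] by (smt (verit))
  qed
  then obtain n C where "\<And>x. x \<in> E \<Longrightarrow> norm (f x) \<le> C * norm ((A ^^ n) x)" by blast
  then show ?thesis unfolding topo_pE using add by (intro continuous_E_top)
qed

section \<open>Comparison of the strong topology with the finest linear topology\<close>

lemma rip_B: "rip (B x) y = rip x (B y)"
  by (rule rip_eqI) (metis B_symmetric)

text \<open>
  The decisive step. Minimise \<open>\<Sum>n. \<parallel>y\<^sub>n\<parallel>\<^sup>2 / \<epsilon>\<^sub>n\<^sup>2\<close> over the finitely supported representations
  \<open>f = \<Sum>n. \<Theta> (n + 1) y\<^sub>n\<close>. The limit \<open>z\<close> of a minimising sequence need not have finite support, but it is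
  orthogonal to all representations of zero, in particular to those supported on \<open>{n, n + 1}\<close>. Hence
  \<open>z\<^sub>n / \<epsilon>\<^sub>n\<^sup>2 = A\<^sup>n\<^sup>+\<^sup>1 x\<close> for some \<open>x \<in> E\<close>, and if the minimum were at least 1, then a multiple of \<open>J x\<close>
  would contradict the bound on \<open>f\<close>.
\<close>

lemma polar_decomposition:
  fixes \<epsilon> :: "nat \<Rightarrow> real"
  assumes \<epsilon>: "\<And>n. \<epsilon> n > 0" and f: "f \<in> dual_carrier pE"
    and bound: "\<And>x. x \<in> E \<Longrightarrow> (\<And>n. norm ((A ^^ Suc n) x) \<le> 1 / \<epsilon> n) \<Longrightarrow> norm (f x) < 1"
  obtains y N where "\<And>n. norm (y n) < \<epsilon> n"
    "\<And>x. x \<in> E \<Longrightarrow> f x = (\<Sum>n<N. bf ((A ^^ Suc n) x) (y n))"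
proof -
  obtain N1 y0 where N1: "N1 \<ge> 1" and fN1: "f = \<Theta> N1 y0" by (rule dual_\<Theta>[OF f]) (rule that)
  \<comment> \<open>Summands are counted from 0 and exponents from 1: index n belongs to
    \<open>A ^^ Suc n\<close>.\<close>
  define N0 where "N0 = N1 - 1"
  have fy0: "f x = bf ((A ^^ Suc N0) x) y0" if "x \<in> E" for x
    using N1 that by (simp add: N0_def fN1 \<Theta>_apply del: funpow.simps)
  define S :: "(nat \<Rightarrow> 'a) set" where "S = {w. finite {n. w n \<noteq> 0}}"
  define G where "G v w = (\<Sum>n. rip (v n) (w n) / (\<epsilon> n)\<^sup>2)" for v w :: "nat \<Rightarrow> 'a"
  define F where "F w x = (\<Sum>n. bf ((A ^^ Suc n) x) (w n))" for w x
  define K where "K = {w \<in> S. \<forall>x\<in>E. F w x = 0}"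
  have rip0: "rip 0 v = 0" for v by (simp add: rip_def)
  have S_add: "v + w \<in> S" if "v \<in> S" "w \<in> S" for v w
    using that unfolding S_def by (auto intro: finite_subset[of _ "{n. v n \<noteq> 0} \<union> {n. w n \<noteq> 0}"])
  have S_scale: "r *\<^sub>R v \<in> S" if "v \<in> S" for v r
    using that unfolding S_def by (auto simp: scaleR_fun_def intro: finite_subset[of _ "{n. v n \<noteq> 0}"])
  have S_0: "0 \<in> S" by (simp add: S_def)
  have Ssub: "real_vector.subspace S"
    by (rule real_vector.subspaceI) (use S_add S_scale S_0 in auto)
  have G_summable: "summable (\<lambda>n. rip (v n) (w n) / (\<epsilon> n)\<^sup>2)" if "v \<in> S" for v w
    by (rule summable_finite[of "{n. v n \<noteq> 0}"]) (use that in \<open>auto simp: S_def rip0\<close>)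
  have F_summable: "summable (\<lambda>n. bf ((A ^^ Suc n) x) (w n))" if "w \<in> S" for w x
    by (rule summable_finite[of "{n. w n \<noteq> 0}"]) (use that in \<open>auto simp: S_def\<close>)
  have F_add: "F (v + w) x = F v x + F w x" if "v \<in> S" "w \<in> S" for v w x
    unfolding F_def using F_summable that by (subst suminf_add) (auto simp: bf_add_right)
  have F_scale: "F (r *\<^sub>R w) x = of_real r * F w x" if "w \<in> S" for w x r
  proof -
    have "bf v (r *\<^sub>R u) = of_real r * bf v u" for v u
      using bf_smul_right[of v "of_real r" u] by (simp add: scale_of_real)
    then show ?thesis unfolding F_def using suminf_mult[OF F_summable[OF that]] by (simp add: scaleR_fun_def)
  qed
  have F_0: "F 0 x = 0" for x by (simp add: F_def)
  have Ksub: "real_vector.subspace K"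
    by (rule real_vector.subspaceI) (auto simp: K_def S_0 F_0 S_add F_add S_scale F_scale)
  \<comment> \<open>The weighted sum controls every coordinate, so the minimising sequence converges
    coordinatewise although \<open>S\<close> is not complete.\<close>
  have single: "(norm (w n))\<^sup>2 / (\<epsilon> n)\<^sup>2 \<le> G w w" if "w \<in> S" for w n
  proof -
    have "(\<Sum>i\<in>{n}. rip (w i) (w i) / (\<epsilon> i)\<^sup>2) \<le> G w w"
      unfolding G_def by (rule sum_le_suminf) (use G_summable[OF that, of w] in \<open>auto simp: rip_self\<close>)
    then show ?thesis by (simp add: rip_self)
  qed
  \<comment> \<open>This representation of f has one entry; adding \<open>K\<close> yields all
    finitely supported ones. Because of the single entry the limit of \<open>G y (u j)\<close> is an
    inner product at index \<open>N0\<close>, which computes \<open>d\<close>.\<close>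
  define y where "y = (\<lambda>n. if n = N0 then y0 else 0)"
  have yS: "y \<in> S" by (simp add: S_def y_def)
  have Fy: "F y x = f x" if "x \<in> E" for x
    unfolding F_def by (subst suminf_finite[of "{N0}"]) (use that in \<open>auto simp: y_def fy0 simp del: funpow.simps\<close>)
  have Gy: "G y v = rip y0 (v N0) / (\<epsilon> N0)\<^sup>2" for v
    unfolding G_def by (subst suminf_finite[of "{N0}"]) (auto simp: y_def rip0)
  obtain u d where u: "\<And>j::nat. y - u j \<in> K" and d0: "d \<ge> 0"
    and cau: "\<And>i j. G (u i - u j) (u i - u j) \<le> 2 / real (Suc i) + 2 / real (Suc j)"
    and orth: "\<And>w. w \<in> K \<Longrightarrow> (\<lambda>j. G w (u j)) \<longlonglongrightarrow> 0"
    and limG: "(\<lambda>j. G (u j) (u j)) \<longlonglongrightarrow> d"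
    and limy: "(\<lambda>j. G y (u j)) \<longlonglongrightarrow> d"
  proof (rule near_projection[of S K y G])
    fix v w :: "nat \<Rightarrow> 'a" and r :: real assume vw: "v \<in> S" "w \<in> S"
    show "G v w = G w v" by (simp add: G_def rip_commute)
    show "G (r *\<^sub>R v) w = r * G v w"
      unfolding G_def using suminf_mult[OF G_summable[OF vw(1)], of r w] by (simp add: scaleR_fun_def rip_scaleR_left)
    fix v' assume "v' \<in> S"
    then show "G (v + v') w = G v w + G v' w"
      unfolding G_def using G_summable vw by (subst suminf_add) (auto simp: rip_add_left add_divide_distrib)
  next
    fix v assume "v \<in> S"
    then show "G v v \<ge> 0" unfolding G_def by (intro suminf_nonneg G_summable) (auto simp: rip_self)
  qed (use Ssub Ksub yS in \<open>auto simp: K_def\<close>)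
  have uS: "u j \<in> S" for j
  proof -
    have "y - u j \<in> S" using u by (simp add: K_def)
    then have "y + (-1) *\<^sub>R (y - u j) \<in> S" using yS by (intro S_add S_scale)
    then show ?thesis by simp
  qed
  have duS: "u i - u j \<in> S" for i j
    using S_add[OF uS[of i] S_scale[OF uS[of j], of "-1"]] by simp
  have "Cauchy (\<lambda>j. u j n)" for n
  proof (rule Cauchy_if_square_bound)
    show "(norm (u i n - u j n))\<^sup>2 \<le> (\<epsilon> n)\<^sup>2 * (2 / real (Suc i) + 2 / real (Suc j))" for i j
    proof -
      have "(norm (u i n - u j n))\<^sup>2 / (\<epsilon> n)\<^sup>2 \<le> 2 / real (Suc i) + 2 / real (Suc j)"
        using order_trans[OF single[OF duS[of i j], of n] cau[of i j]] by simp
      then show ?thesis using \<epsilon>[of n] by (simp add: pos_divide_le_eq mult.commute del: of_nat_Suc)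
    qed
  qed simp
  then have "\<forall>n. \<exists>l. (\<lambda>j. u j n) \<longlonglongrightarrow> l" by (simp add: Cauchy_convergent_iff convergent_def)
  from choice[OF this] obtain z where z: "\<And>n. (\<lambda>j. u j n) \<longlonglongrightarrow> z n" by blast
  define t where "t n = (1 / (\<epsilon> n)\<^sup>2) *\<^sub>R z n" for n
  have lim_rip: "(\<lambda>j. rip v (u j n) / (\<epsilon> n)\<^sup>2) \<longlonglongrightarrow> rip v (t n)" for v n
  proof -
    have "(\<lambda>j. rip v (u j n) / (\<epsilon> n)\<^sup>2) \<longlonglongrightarrow> rip v (z n) / (\<epsilon> n)\<^sup>2"
      by (intro tendsto_divide bounded_linear.tendsto[OF bounded_linear_rip_right z] tendsto_const)
         (use \<epsilon>[of n] in simp)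
    then show ?thesis by (simp add: t_def rip_scaleR_right)
  qed
  have t_step: "t n = B (t (Suc n))" for n
  proof -
    have "t n - B (t (Suc n)) = 0"
    proof (rule eq_0_if_rip_dense[of UNIV])
      fix v
      \<comment> \<open>Since \<open>\<Theta> (Suc n) v\<close> equals
        \<open>\<Theta> (Suc (Suc n)) (B v)\<close>, this sequence represents zero. Orthogonality to
        it, for all v, says that \<open>t n = B (t (Suc n))\<close>.\<close>
      define w where "w = (\<lambda>i. if i = n then v else if i = Suc n then - B v else 0)"
      have wS: "w \<in> S" unfolding S_def by (auto simp: w_def intro: finite_subset[of _ "{n, Suc n}"])
      have bfm: "bf x (- y) = - bf x y" for x y using bf_diff_right[of x 0 y] by simp
      have "F w x = 0" if x: "x \<in> E" for x
      proof -
        have "F w x = bf ((A ^^ Suc n) x) v - bf ((A ^^ Suc (Suc n)) x) (B v)"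
          unfolding F_def
          by (subst suminf_finite[of "{n, Suc n}"]) (auto simp: w_def bfm simp del: funpow.simps)
        also have "bf ((A ^^ Suc (Suc n)) x) (B v) = bf ((B ^^ 1) ((A ^^ 1) ((A ^^ Suc n) x))) v"
          by (simp only: bf_Bn) simp
        also have "\<dots> = bf ((A ^^ Suc n) x) v" by (simp only: E_Bn_An[OF E_An[OF x]])
        finally show ?thesis by simp
      qed
      then have "w \<in> K" using wS by (simp add: K_def)
      have "G w (u j) = rip v (u j n) / (\<epsilon> n)\<^sup>2 - rip (B v) (u j (Suc n)) / (\<epsilon> (Suc n))\<^sup>2" for j
        unfolding G_def using rip_scaleR_left[of "-1" "B v"]
        by (subst suminf_finite[of "{n, Suc n}"]) (auto simp: w_def rip0)
      then have "(\<lambda>j. G w (u j)) \<longlonglongrightarrow> rip v (t n) - rip (B v) (t (Suc n))"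
        using tendsto_diff[OF lim_rip[of v n] lim_rip[of "B v" "Suc n"]] by simp
      then have "rip v (t n) = rip (B v) (t (Suc n))"
        using LIMSEQ_unique[OF orth[OF \<open>w \<in> K\<close>]] by fastforce
      then show "rip v (t n - B (t (Suc n))) = 0"
        using rip_add_right[of v "t n" "- B (t (Suc n))"] rip_scaleR_right[of v "-1" "B (t (Suc n))"]
        by (simp add: rip_B)
    qed simp
    then show ?thesis by simp
  qed
  define x where "x = B (t 0)"
  have xt: "x = (B ^^ Suc n) (t n)" for n
  proof (induction n)
    case (Suc n)
    then show ?case using t_step[of n] by (simp add: funpow_swap1)
  qed (simp add: x_def)
  have xE: "x \<in> E"
    unfolding E_eq
  proof
    fix m show "x \<in> range (B ^^ m)"
    proof (cases m)
      case (Suc k) then show ?thesis using xt[of k] by blast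
    qed simp
  qed
  have Ax: "(A ^^ Suc n) x = t n" for n using xt[of n] by (simp only: An_Bn)
  have d_eq: "d = rip y0 (t N0)"
    using LIMSEQ_unique[OF limy] lim_rip[of y0 N0] by (simp add: Gy)
  \<comment> \<open>Evaluating at \<open>J x\<close> undoes the conjugation hidden in
    \<open>bf\<close>: the value is \<open>ip y0 (t N0)\<close>, whose real part is d.\<close>
  have d_le: "d \<le> norm (f (J x))"
  proof -
    have "f (J x) = bf (J (t N0)) y0" using xE Ax[of N0] by (simp only: fy0 E_J An_J)
    also have "\<dots> = ip y0 (t N0)" by (simp add: bf_def ip_J_J)
    finally show ?thesis using rip_le_norm_ip[of y0 "t N0"] d_eq by simp
  qed
  have t_le: "norm (t n) \<le> sqrt d / \<epsilon> n" for n
  proof -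
    have "(\<lambda>j. (norm (u j n))\<^sup>2 / (\<epsilon> n)\<^sup>2) \<longlonglongrightarrow> (norm (z n))\<^sup>2 / (\<epsilon> n)\<^sup>2"
      by (intro tendsto_intros z) (use \<epsilon>[of n] in simp)
    then have "(norm (z n))\<^sup>2 / (\<epsilon> n)\<^sup>2 \<le> d"
      by (rule LIMSEQ_le[OF _ limG]) (use single[OF uS] in blast)
    then have "norm (z n) / \<epsilon> n \<le> sqrt d"
      by (intro real_le_rsqrt) (simp add: power_divide)
    then have "norm (z n) / \<epsilon> n / \<epsilon> n \<le> sqrt d / \<epsilon> n" using \<epsilon>[of n] by (intro divide_right_mono) auto
    then show ?thesis by (simp add: t_def power2_eq_square)
  qed
  \<comment> \<open>If d were at least 1, then \<open>J x\<close> divided by \<open>sqrt d\<close>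
    would satisfy the premises of \<open>bound\<close> by \<open>t_le\<close>. This would give d
    \<le> \<open>norm (f (J x))\<close> < \<open>sqrt d\<close>, which is impossible.\<close>
  have "d < 1"
  proof (rule ccontr)
    assume "\<not> d < 1"
    then have d1: "d \<ge> 1" by simp
    then have s1: "sqrt d \<ge> 1" by simp
    define x' where "x' = (1 / sqrt d) *\<^sub>R J x"
    have x'E: "x' \<in> E" using xE by (simp add: x'_def E_scaleR E_J)
    have "norm (f x') < 1"
    proof (rule bound[OF x'E])
      fix n
      have "norm ((A ^^ Suc n) x') = norm (t n) / sqrt d"
        unfolding x'_def using xE Ax[of n] d0 by (simp only: An_scaleR E_J An_J norm_scaleR norm_J) simp
      also have "\<dots> \<le> sqrt d / \<epsilon> n / sqrt d" using t_le s1 by (intro divide_right_mono) auto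
      also have "\<dots> = 1 / \<epsilon> n" using s1 by simp
      finally show "norm ((A ^^ Suc n) x') \<le> 1 / \<epsilon> n" .
    qed
    moreover have "norm (f x') = norm (f (J x)) / sqrt d"
    proof -
      have "f x' = of_real (1 / sqrt d) * f (J x)"
        unfolding x'_def scale_of_real[symmetric]
        using dual_carrierD(3)[OF f, of "J x" "of_real (1 / sqrt d)"] xE E_J by simp
      then show ?thesis using d0 by (simp add: norm_mult norm_divide)
    qed
    ultimately have "d < sqrt d" using d_le s1 by (simp add: divide_less_eq)
    moreover have "sqrt d * 1 \<le> sqrt d * sqrt d" using s1 by (intro mult_left_mono) auto
    ultimately show False using d0 by simp
  qed
  \<comment> \<open>The infimum need not be attained, but a late member of the minimising sequence
    has square below 1 and finite support, and each of its coordinates is then below its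
    radius.\<close>
  then obtain j where j: "G (u j) (u j) < 1"
    using eventually_happens'[OF sequentially_bot order_tendstoD(2)[OF limG]] by blast
  have "finite {n. u j n \<noteq> 0}" using uS[of j] by (simp add: S_def)
  then obtain N where N: "\<And>n. u j n \<noteq> 0 \<Longrightarrow> n < N"
    unfolding finite_nat_set_iff_bounded by blast
  show thesis
  proof (rule that)
    fix n
    have "(norm (u j n))\<^sup>2 / (\<epsilon> n)\<^sup>2 < 1" using single[OF uS, of j n] j by simp
    then have "(norm (u j n))\<^sup>2 < (\<epsilon> n)\<^sup>2" using \<epsilon>[of n] by (simp add: divide_less_eq)
    then show "norm (u j n) < \<epsilon> n" using \<epsilon>[of n] by (simp add: power2_less_imp_less)
  next
    fix x assume x: "x \<in> E"
    have "F y x = F (y - u j) x + F (u j) x"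
      using F_add[of "y - u j" "u j" x] u[of j] uS by (simp add: K_def)
    then have "f x = F (u j) x" using u[of j] x by (simp add: K_def Fy)
    also have "\<dots> = (\<Sum>n<N. bf ((A ^^ Suc n) x) (u j n))"
      unfolding F_def
    proof (rule suminf_finite)
      show "bf ((A ^^ Suc n) x) (u j n) = 0" if "n \<notin> {..<N}" for n
        using N[of n] that by (cases "u j n = 0") auto
    qed simp
    finally show "f x = (\<Sum>n<N. bf ((A ^^ Suc n) x) (u j n))" .
  qed
qed

text \<open>After translation to zero, repeated halving of the neighbourhood gives sets W n, and the
  radius \<epsilon>_n is chosen so that \<open>\<Theta> (Suc n)\<close> maps the ball into W (n+1).
  Sums of such images then stay in W 0, and \<open>polar_decomposition\<close> writes every
  functional smaller than 1 on a suitable bounded set as such a sum.\<close>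

lemma strong_dual_finest:
  assumes LT: "linear_topology (strong_dual pE) T"
    and cont: "\<And>n. n \<ge> 1 \<Longrightarrow> continuous_map euclidean T (\<Theta> n)"
  shows "coarser T (topo (strong_dual pE))"
  unfolding coarser_def
proof (intro allI impI)
  let ?V = "strong_dual pE"
  note vsV = vector_space_onD[OF vector_space_on_strong_dual[OF tvs_pE]]
  have tT: "topspace T = dual_carrier pE" using LT by (simp add: linear_topology_def)
  have add: "continuous_map (prod_topology T T) T (\<lambda>(x, y). vadd ?V x y)"
    using LT by (simp add: linear_topology_def)
  have z: "vzero ?V \<in> dual_carrier pE" using vsV(1) by simp
  fix U assume U: "openin T U"
  have U_dual: "U \<subseteq> dual_carrier pE" using openin_subset[OF U] tT by simp
  have "\<exists>S e. tvs_bounded pE S \<and> e > 0 \<and> {g \<in> dual_carrier pE. \<forall>x\<in>S. norm (g x - f x) < e} \<subseteq> U"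
    if fU: "f \<in> U" for f
  proof -
    have f: "f \<in> dual_carrier pE" using U_dual fU by blast
    define W0 where "W0 = {g \<in> topspace T. ((\<lambda>(x, y). vadd ?V x y) \<circ> (\<lambda>g. (f, g))) g \<in> U}"
    have "continuous_map T T ((\<lambda>(x, y). vadd ?V x y) \<circ> (\<lambda>g. (f, g)))"
      by (rule continuous_map_compose[OF _ add]) (simp add: continuous_map_pairedI tT f)
    then have W0: "openin T W0" unfolding W0_def by (rule openin_continuous_map_preimage[OF _ U])
    have zW0: "vzero ?V \<in> W0"
      using vsV(5)[of f "vzero ?V"] vsV(6)[of f] f z fU unfolding W0_def tT by simp
    have halve: "\<exists>W'. (openin T W' \<and> vzero ?V \<in> W') \<and> (\<forall>g\<in>W'. \<forall>h\<in>W'. vadd ?V g h \<in> W)"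
      if "openin T W \<and> vzero ?V \<in> W" for W
    proof -
      define R where "R = {p \<in> topspace (prod_topology T T). (\<lambda>(x, y). vadd ?V x y) p \<in> W}"
      have "openin (prod_topology T T) R"
        unfolding R_def by (rule openin_continuous_map_preimage[OF add]) (use that in blast)
      moreover have "(vzero ?V, vzero ?V) \<in> R"
        using that vsV(6)[OF vsV(1)] z tT by (simp add: R_def del: strong_dual_simps)
      ultimately obtain P Q where PQ: "openin T P" "openin T Q" "vzero ?V \<in> P" "vzero ?V \<in> Q" "P \<times> Q \<subseteq> R"
        unfolding openin_prod_topology_alt by (elim allE[of _ "vzero ?V"] impE exE conjE)
      have "vadd ?V g h \<in> W" if "g \<in> P" "h \<in> Q" for g h
        using subsetD[OF PQ(5), of "(g, h)"] that by (simp add: R_def del: strong_dual_simps)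
      then show ?thesis using PQ(1-4) by (intro exI[of _ "P \<inter> Q"]) (simp add: openin_Int del: strong_dual_simps)
    qed
    obtain W where W: "\<And>n. openin T (W n) \<and> vzero ?V \<in> W n" and W00: "W 0 = W0"
      and Wadd: "\<And>n. \<forall>g\<in>W (Suc n). \<forall>h\<in>W (Suc n). vadd ?V g h \<in> W n"
    proof -
      have "\<exists>W. \<forall>n. ((openin T (W n) \<and> vzero ?V \<in> W n) \<and> (n = 0 \<longrightarrow> W n = W0)) \<and>
          (\<forall>g\<in>W (Suc n). \<forall>h\<in>W (Suc n). vadd ?V g h \<in> W n)"
      proof (rule dependent_nat_choice)
        show "\<exists>W. (openin T W \<and> vzero ?V \<in> W) \<and> (0 = (0::nat) \<longrightarrow> W = W0)" using W0 zW0 by blast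
        fix W :: "('a \<Rightarrow> 'k) set" and n :: nat
        assume "(openin T W \<and> vzero ?V \<in> W) \<and> (n = 0 \<longrightarrow> W = W0)"
        then obtain W' where "openin T W' \<and> vzero ?V \<in> W'" "\<forall>g\<in>W'. \<forall>h\<in>W'. vadd ?V g h \<in> W"
          using halve[of W] by blast
        then show "\<exists>W'. ((openin T W' \<and> vzero ?V \<in> W') \<and> (Suc n = 0 \<longrightarrow> W' = W0)) \<and>
            (\<forall>g\<in>W'. \<forall>h\<in>W'. vadd ?V g h \<in> W)"
          by (intro exI[of _ W']) blast
      qed
      then show thesis using that by blast
    qed
    have "\<exists>e>0. \<forall>y. norm y < e \<longrightarrow> \<Theta> (Suc n) y \<in> W (Suc n)" for n
    proof -
      have "openin euclidean {y \<in> topspace euclidean. \<Theta> (Suc n) y \<in> W (Suc n)}"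
        using openin_continuous_map_preimage[OF cont[of "Suc n"]] W by simp
      then have "open {y. \<Theta> (Suc n) y \<in> W (Suc n)}" by simp
      moreover have "0 \<in> {y. \<Theta> (Suc n) y \<in> W (Suc n)}" using W[of "Suc n"] by (simp only: \<Theta>_0 mem_Collect_eq)
      ultimately obtain e where "e > 0" "ball 0 e \<subseteq> {y. \<Theta> (Suc n) y \<in> W (Suc n)}" by (meson openE)
      then show ?thesis by (intro exI[of _ e]) (auto simp: subset_iff)
    qed
    then obtain \<epsilon> where \<epsilon>: "\<And>n. \<epsilon> n > (0::real)"
      and \<Theta>W: "\<And>n y. norm y < \<epsilon> n \<Longrightarrow> \<Theta> (Suc n) y \<in> W (Suc n)" by metis
    define S where "S = {x \<in> E. \<forall>n. norm ((A ^^ Suc n) x) \<le> 1 / \<epsilon> n}"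
    have S: "tvs_bounded pE S"
      unfolding tvs_bounded_pE
    proof (intro conjI allI)
      \<comment> \<open>S restricts only exponents from 1 on, so the j-th seminorm is estimated
        through the exponent j + 1; this covers j = 0.\<close>
      fix j show "\<exists>M. \<forall>x\<in>S. norm ((A ^^ j) x) \<le> M"
      proof (intro exI[of _ "\<beta> ^ Suc j * (1 / \<epsilon> j)"] ballI)
        fix x assume x: "x \<in> S"
        then have "norm ((A ^^ j) x) \<le> \<beta> ^ Suc j * norm ((A ^^ Suc j) x)"
          by (intro norm_An_le) (auto simp: S_def)
        also have "\<dots> \<le> \<beta> ^ Suc j * (1 / \<epsilon> j)"
          using x \<beta>(1) by (intro mult_left_mono) (auto simp: S_def)
        finally show "norm ((A ^^ j) x) \<le> \<beta> ^ Suc j * (1 / \<epsilon> j)" .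
      qed
    qed (auto simp: S_def)
    have polar: "g \<in> W0" if g: "g \<in> dual_carrier pE" "\<And>x. x \<in> S \<Longrightarrow> norm (g x) < 1" for g
    proof -
      obtain y N where y: "\<And>n. norm (y n) < \<epsilon> n"
        and gy: "\<And>x. x \<in> E \<Longrightarrow> g x = (\<Sum>n<N. bf ((A ^^ Suc n) x) (y n))"
      proof (rule polar_decomposition[of \<epsilon> g])
        show "norm (g x) < 1" if "x \<in> E" "\<And>n. norm ((A ^^ Suc n) x) \<le> 1 / \<epsilon> n" for x
          by (rule g(2)) (use that in \<open>simp add: S_def del: funpow.simps\<close>)
      qed (use \<epsilon> g in auto)
      \<comment> \<open>This is the block of k summands starting at index m. The induction splits
        off its first summand: that one and the remaining block both lie in W (m+1), so their sum
        lies in W m. Therefore m has to vary.\<close>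
      define s where "s m k = (\<lambda>x\<in>E. \<Sum>i<k. bf ((A ^^ Suc (m + i)) x) (y (m + i)))" for m k
      have "s m k \<in> W m" for m k
      proof (induction k arbitrary: m)
        case 0
        have "s m 0 = vzero ?V" by (simp add: s_def)
        then show ?case using W by metis
      next
        case (Suc k)
        have "s m (Suc k) = vadd ?V (\<Theta> (Suc m) (y m)) (s (Suc m) k)"
          by (rule extensionalityI[of _ E])
             (auto simp: s_def \<Theta>_def sum.lessThan_Suc_shift simp del: funpow.simps sum.lessThan_Suc)
        then show ?case using Wadd[of m] \<Theta>W[OF y] Suc by metis
      qed
      moreover have "g = s 0 N"
        by (rule extensionalityI[of _ E]) (use gy dual_carrierD(1)[OF g(1)] in \<open>auto simp: s_def\<close>)
      ultimately show ?thesis using W00 by metis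
    qed
    have "h \<in> U" if h: "h \<in> dual_carrier pE" "\<forall>x\<in>S. norm (h x - f x) < 1" for h
    proof -
      define g where "g = vadd ?V h (vsmul ?V (-1) f)"
      have gx: "g x = h x - f x" if "x \<in> E" for x using that by (simp add: g_def)
      have g: "g \<in> dual_carrier pE" using vsV(2)[OF _ vsV(3)[of f "-1"], of h] h f by (simp add: g_def)
      have "g \<in> W0" by (rule polar[OF g]) (use gx h(2) in \<open>simp add: S_def\<close>)
      then have "vadd ?V f g \<in> U" by (simp add: W0_def)
      moreover have "vadd ?V f g = h"
        by (rule extensionalityI[of _ E]) (use dual_carrierD(1)[OF h(1)] gx in auto)
      ultimately show ?thesis by simp
    qed
    then show ?thesis using S by (intro exI[of _ S] exI[of _ 1]) auto
  qed
  then show "openin (topo ?V) U" unfolding openin_topo_strong_dual strong_open_def using U_dual by blast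
qed


subsection \<open>The extrapolation spaces and their inductive limit\<close>

abbreviation neg_space :: "nat \<Rightarrow> ('k, 'a) nspace"
  where "neg_space \<equiv> negative_norm_space smul D A"

abbreviation ext_space :: "nat \<Rightarrow> ('k, (nat \<Rightarrow> 'a) set) nspace"
  where "ext_space \<equiv> extrapolation_space smul D A"

text \<open>
  Since \<open>\<parallel>x\<parallel>\<^sub>-\<^sub>n = \<parallel>B\<^sup>n x\<parallel>\<close> and \<open>B\<^sup>n\<close> has dense range, \<open>B\<^sup>n\<close> extends to an isometry of the
  completion onto \<open>X\<close>; \<open>ext_class n y\<close> is the preimage of \<open>y\<close>.
\<close>

definition ext_class :: "nat \<Rightarrow> 'a \<Rightarrow> (nat \<Rightarrow> 'a) set"
  where "ext_class n y = {s. (\<lambda>i. (B ^^ n) (s i)) \<longlonglongrightarrow> y}"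

lemma neg_space_simps [simp]: "car (neg_space n) = UNIV" "vadd (neg_space n) = (+)"
  "vzero (neg_space n) = 0" "vsmul (neg_space n) = smul" "nnorm (neg_space n) x = norm ((B ^^ n) x)"
  by (simp_all add: negative_norm_space_def)

lemma ndist_neg_space: "ndist (neg_space n) x y = norm ((B ^^ n) x - (B ^^ n) y)"
  by (simp add: ndist_def vdiff_def smul_minus_1 Bn_diff)

lemma Metric_space_neg_space: "Metric_space (car (neg_space n)) (ndist (neg_space n))"
proof
  show "ndist (neg_space n) x z \<le> ndist (neg_space n) x y + ndist (neg_space n) y z" for x y z
    using norm_triangle_ineq[of "(B ^^ n) x - (B ^^ n) y" "(B ^^ n) y - (B ^^ n) z"]
    by (simp add: ndist_neg_space)
qed (auto simp: ndist_neg_space norm_minus_commute dest: inj_Bn)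

lemma cauchy_seqs_neg_space: "cauchy_seqs (neg_space n) = {s. Cauchy (\<lambda>i. (B ^^ n) (s i))}"
proof -
  interpret Metric_space "car (neg_space n)" "ndist (neg_space n)" by (rule Metric_space_neg_space)
  show ?thesis
    unfolding cauchy_seqs_def MCauchy_def Cauchy_def
    by (auto simp: ndist_neg_space dist_norm)
qed

lemma ext_class_unique: "s \<in> ext_class n y \<Longrightarrow> s \<in> ext_class n z \<Longrightarrow> y = z"
  unfolding ext_class_def using LIMSEQ_unique by blast

text \<open>E is dense and lies in the range of \<open>B ^^ n\<close>. This is the surjectivity of
  the extended isometry.\<close>

lemma ex_in_ext_class: "\<exists>s. s \<in> ext_class n y"
proof -
  have "y \<in> closure E" by (simp add: dense_E)
  then obtain s where s: "\<And>i. s i \<in> E" "s \<longlonglongrightarrow> y" unfolding closure_sequential by blast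
  then have "(\<lambda>i. (A ^^ n) (s i)) \<in> ext_class n y" by (simp add: ext_class_def E_Bn_An)
  then show ?thesis by blast
qed

lemma inj_ext_class: "ext_class n y = ext_class n z \<Longrightarrow> y = z"
  using ex_in_ext_class ext_class_unique by blast

text \<open>Sequences differ by a null sequence for the n-th negative norm exactly when their images
  under \<open>B ^^ n\<close> have a null difference in X, that is, when these images share the
  limit y.\<close>

lemma cauchy_class_neg_space:
  assumes s: "s \<in> ext_class n y" shows "cauchy_class (neg_space n) s = ext_class n y"
proof (intro equalityI subsetI)
  have s': "(\<lambda>i. (B ^^ n) (s i)) \<longlonglongrightarrow> y" using s by (simp add: ext_class_def)
  fix t
  {
    assume "t \<in> cauchy_class (neg_space n) s"
    then have "(\<lambda>i. (B ^^ n) (s i) - (B ^^ n) (t i)) \<longlonglongrightarrow> 0"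
      by (simp add: cauchy_class_def ndist_neg_space tendsto_norm_zero_iff)
    from tendsto_diff[OF s' this] show "t \<in> ext_class n y" by (simp add: ext_class_def)
  next
    assume "t \<in> ext_class n y"
    then have t: "(\<lambda>i. (B ^^ n) (t i)) \<longlonglongrightarrow> y" by (simp add: ext_class_def)
    from tendsto_norm_zero[OF tendsto_diff[OF s' t, simplified]] LIMSEQ_imp_Cauchy[OF t]
    show "t \<in> cauchy_class (neg_space n) s"
      by (simp add: cauchy_class_def ndist_neg_space cauchy_seqs_neg_space)
  }
qed

lemma car_ext_space [simp]: "car (ext_space n) = range (ext_class n)"
proof -
  have "car (ext_space n) = cauchy_class (neg_space n) ` cauchy_seqs (neg_space n)"
    by (simp add: extrapolation_space_def completion_def)
  also have "\<dots> = range (ext_class n)"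
  proof (intro equalityI subsetI)
    fix P assume "P \<in> cauchy_class (neg_space n) ` cauchy_seqs (neg_space n)"
    then obtain s where s: "Cauchy (\<lambda>i. (B ^^ n) (s i))" "P = cauchy_class (neg_space n) s"
      by (auto simp: cauchy_seqs_neg_space)
    then obtain y where "s \<in> ext_class n y"
      by (auto simp: ext_class_def Cauchy_convergent_iff convergent_def)
    then show "P \<in> range (ext_class n)" using s cauchy_class_neg_space by blast
  next
    fix P assume "P \<in> range (ext_class n)"
    then obtain y s where s: "P = ext_class n y" "s \<in> ext_class n y" using ex_in_ext_class by blast
    then have "s \<in> cauchy_seqs (neg_space n)"
      by (auto simp: cauchy_seqs_neg_space ext_class_def LIMSEQ_imp_Cauchy)
    then show "P \<in> cauchy_class (neg_space n) ` cauchy_seqs (neg_space n)"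
      using s cauchy_class_neg_space by blast
  qed
  finally show ?thesis .
qed

text \<open>All sets in the defining union are one and the same class by
  \<open>cauchy_class_neg_space\<close>, and the index sets are nonempty by
  \<open>ex_in_ext_class\<close>.\<close>

lemma vadd_ext_space: "vadd (ext_space n) (ext_class n y) (ext_class n z) = ext_class n (y + z)"
proof -
  have c: "cauchy_class (neg_space n) (\<lambda>i. s i + t i) = ext_class n (y + z)"
    if "s \<in> ext_class n y" "t \<in> ext_class n z" for s t
    by (rule cauchy_class_neg_space) (use that in \<open>simp add: ext_class_def Bn_add tendsto_add\<close>)
  have "vadd (ext_space n) (ext_class n y) (ext_class n z)
      = (\<Union>s\<in>ext_class n y. \<Union>t\<in>ext_class n z. cauchy_class (neg_space n) (\<lambda>i. s i + t i))"
    by (simp add: extrapolation_space_def completion_def)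
  also have "\<dots> = (\<Union>s\<in>ext_class n y. \<Union>t\<in>ext_class n z. ext_class n (y + z))"
    by (intro SUP_cong refl c)
  also have "\<dots> = ext_class n (y + z)"
    using ex_in_ext_class[of n y] ex_in_ext_class[of n z] by auto
  finally show ?thesis .
qed

lemma vsmul_ext_space: "vsmul (ext_space n) c (ext_class n y) = ext_class n (smul c y)"
proof -
  have c: "cauchy_class (neg_space n) (\<lambda>i. smul c (s i)) = ext_class n (smul c y)"
    if "s \<in> ext_class n y" for s
    by (rule cauchy_class_neg_space)
       (use that bounded_linear.tendsto[OF bounded_linear_smul] in \<open>simp add: ext_class_def Bn_smul\<close>)
  have "vsmul (ext_space n) c (ext_class n y)
      = (\<Union>s\<in>ext_class n y. cauchy_class (neg_space n) (\<lambda>i. smul c (s i)))"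
    by (simp add: extrapolation_space_def completion_def)
  also have "\<dots> = (\<Union>s\<in>ext_class n y. ext_class n (smul c y))"
    by (intro SUP_cong refl c)
  also have "\<dots> = ext_class n (smul c y)" using ex_in_ext_class[of n y] by auto
  finally show ?thesis .
qed

lemma completion_embed_neg_space: "completion_embed (neg_space n) x = ext_class n ((B ^^ n) x)"
  unfolding completion_embed_def by (rule cauchy_class_neg_space) (simp add: ext_class_def)

lemma vzero_ext_space: "vzero (ext_space n) = ext_class n 0"
  using completion_embed_neg_space[of n 0]
  by (simp add: extrapolation_space_def completion_def completion_embed_def)

lemma nnorm_ext_space: "nnorm (ext_space n) (ext_class n y) = norm y"
proof -
  have "nnorm (ext_space n) (ext_class n y)
      = (THE r. \<exists>s\<in>ext_class n y. (\<lambda>i. norm ((B ^^ n) (s i))) \<longlonglongrightarrow> r)"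
    by (simp add: extrapolation_space_def completion_def)
  also have "\<dots> = norm y"
  proof (rule the_equality)
    have lim: "(\<lambda>i. norm ((B ^^ n) (s i))) \<longlonglongrightarrow> norm y" if "s \<in> ext_class n y" for s
      using that by (simp add: ext_class_def tendsto_norm)
    then show "\<exists>s\<in>ext_class n y. (\<lambda>i. norm ((B ^^ n) (s i))) \<longlonglongrightarrow> norm y"
      using ex_in_ext_class by blast
    show "r = norm y" if "\<exists>s\<in>ext_class n y. (\<lambda>i. norm ((B ^^ n) (s i))) \<longlonglongrightarrow> r" for r
      using that lim LIMSEQ_unique by blast
  qed
  finally show ?thesis .
qed

lemma ndist_ext_space: "ndist (ext_space n) (ext_class n y) (ext_class n z) = norm (y - z)"
  by (simp add: ndist_def vdiff_def vsmul_ext_space vadd_ext_space nnorm_ext_space smul_minus_1)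

lemma Metric_space_ext_space: "Metric_space (car (ext_space n)) (ndist (ext_space n))"
proof
  fix P Q R
  have nonneg: "0 \<le> ndist (ext_space n) P Q \<and> ndist (ext_space n) P Q = ndist (ext_space n) Q P"
  proof (cases "P \<in> car (ext_space n) \<and> Q \<in> car (ext_space n)")
    case True
    then show ?thesis by (auto simp: ndist_ext_space norm_minus_commute)
  next
    case False
    then show ?thesis unfolding ndist_def by auto
  qed
  then show "0 \<le> ndist (ext_space n) P Q" "ndist (ext_space n) P Q = ndist (ext_space n) Q P" by auto
  assume "P \<in> car (ext_space n)" "Q \<in> car (ext_space n)"
  then obtain x y where P: "P = ext_class n x" and Q: "Q = ext_class n y" by auto
  show "(ndist (ext_space n) P Q = 0) = (P = Q)"
    by (auto simp: P Q ndist_ext_space dest: inj_ext_class)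
  assume "R \<in> car (ext_space n)"
  then obtain z where R: "R = ext_class n z" by auto
  show "ndist (ext_space n) P R \<le> ndist (ext_space n) P Q + ndist (ext_space n) Q R"
    using norm_triangle_ineq[of "x - y" "y - z"] by (simp add: P Q R ndist_ext_space)
qed

text \<open>As \<open>ext_class n\<close> is an isometric bijection from X, questions of continuity
  on the extrapolation space become questions on X.\<close>

lemma openin_ext_space:
  "openin (norm_topology (ext_space n)) U \<longleftrightarrow> U \<subseteq> range (ext_class n) \<and> open (ext_class n -` U)"
proof -
  have "(\<forall>x\<in>U. \<exists>r>0. \<forall>y\<in>car (ext_space n). ndist (ext_space n) x y < r \<longrightarrow> y \<in> U)
      \<longleftrightarrow> open (ext_class n -` U)" if U: "U \<subseteq> range (ext_class n)"
  proof -
    have "(\<forall>x\<in>U. Q x) \<longleftrightarrow> (\<forall>x\<in>ext_class n -` U. Q (ext_class n x))" for Q using U by blast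
    then show ?thesis
      unfolding open_dist by (simp add: ndist_ext_space dist_norm norm_minus_commute)
  qed
  then show ?thesis unfolding openin_norm_topology[OF Metric_space_ext_space] by auto
qed

lemma topspace_ext_space: "topspace (norm_topology (ext_space n)) = range (ext_class n)"
  using topspace_norm_topology[OF Metric_space_ext_space] by simp

lemma continuous_map_ext_space:
  "continuous_map (norm_topology (ext_space n)) T g \<longleftrightarrow> continuous_map euclidean T (g \<circ> ext_class n)"
proof -
  have "ext_class n -` {P \<in> range (ext_class n). g P \<in> U} = {x. g (ext_class n x) \<in> U}" for U by auto
  then show ?thesis
    unfolding continuous_map_def topspace_ext_space openin_ext_space by auto
qed

lemma continuous_map_ext_class: "continuous_map euclidean (norm_topology (ext_space n)) (ext_class n)"
  unfolding continuous_map_def topspace_ext_space openin_ext_space by (auto simp: vimage_def)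

text \<open>In the coordinates given by \<open>ext_class\<close> the vector x of X is
  \<open>(B ^^ n) x\<close> at level n, so the extension of the identity acts as B. A continuous
  competitor agrees with it at all coordinates in E, since these come from vectors of X, and E is
  dense.\<close>

lemma linking_map_ext_class: "linking_map smul D A n (ext_class n y) = ext_class (Suc n) (B y)"
proof -
  let ?X = "ext_space n" and ?Y = "ext_space (Suc n)"
  define f where "f = (\<lambda>P\<in>range (ext_class n). ext_class (Suc n) (B (inv (ext_class n) P)))"
  have inv: "inv (ext_class n) (ext_class n y) = y" for n y
    by (rule inv_f_f) (use inj_ext_class in \<open>auto intro: injI\<close>)
  have f: "f (ext_class n y) = ext_class (Suc n) (B y)" for y by (simp add: f_def inv)
  have contB: "continuous_on UNIV B"
    using linear_continuous_on[OF bounded_linear_Bn[of 1]] by simp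
  have "linking_map smul D A n = f"
    unfolding linking_map_def
  proof (rule the_equality, intro conjI allI)
    show "f \<in> extensional (car ?X)" by (simp add: f_def)
    show "linear_on ?X ?Y f"
      by (auto simp: linear_on_def f vadd_ext_space vsmul_ext_space B_add B_smul)
    have "f \<circ> ext_class n = ext_class (Suc n) \<circ> B" by (auto simp: f)
    then show "continuous_map (norm_topology ?X) (norm_topology ?Y) f"
      unfolding continuous_map_ext_space
      using contB by (auto intro!: continuous_map_compose[OF _ continuous_map_ext_class])
    show "f (completion_embed (neg_space n) x) = completion_embed (neg_space (Suc n)) x" for x
      by (simp add: completion_embed_neg_space f)
  next
    fix g assume g: "g \<in> extensional (car ?X) \<and> linear_on ?X ?Y g \<and>
      continuous_map (norm_topology ?X) (norm_topology ?Y) g \<and>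
      (\<forall>x. g (completion_embed (neg_space n) x) = completion_embed (neg_space (Suc n)) x)"
    define h where "h y = inv (ext_class (Suc n)) (g (ext_class n y))" for y
    have "continuous_map (norm_topology ?Y) euclidean (inv (ext_class (Suc n)))"
      unfolding continuous_map_ext_space by (simp add: comp_def inv)
    then have "continuous_map (norm_topology ?X) euclidean (inv (ext_class (Suc n)) \<circ> g)"
      using g continuous_map_compose by blast
    then have "continuous_on UNIV h"
      unfolding continuous_map_ext_space by (simp add: comp_def h_def)
    then have cont: "continuous_on (closure E) (\<lambda>y. h y - B y)"
      using contB by (auto simp: dense_E intro: continuous_on_diff)
    have "h y - B y = 0" for y
    proof (rule continuous_constant_on_closure[OF cont])
      fix x assume x: "x \<in> E"
      have "g (ext_class n ((B ^^ n) ((A ^^ n) x))) = ext_class (Suc n) ((B ^^ Suc n) ((A ^^ n) x))"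
        using g by (simp only: completion_embed_neg_space[symmetric])
      then have "g (ext_class n x) = ext_class (Suc n) (B x)" using x by (simp add: E_Bn_An)
      then show "h x - B x = 0" by (simp add: h_def inv)
    qed (simp add: dense_E)
    moreover have "ext_class (Suc n) (h y) = g (ext_class n y)" for y
    proof -
      have "g (ext_class n y) \<in> range (ext_class (Suc n))" using g by (auto simp: linear_on_def)
      then show ?thesis unfolding h_def by (rule f_inv_into_f)
    qed
    ultimately have "g (ext_class n y) = f (ext_class n y)" for y by (metis f eq_iff_diff_eq_0)
    then show "g = f" using g by (intro extensionalityI[of g "range (ext_class n)" f]) (auto simp: f_def)
  qed
  then show ?thesis by (simp add: f)
qed

section \<open>Classes of the inductive limit as functionals\<close>

lemma transit_ext_class:
  "transit (linking_map smul D A) m j (ext_class m y) = ext_class (m + j) ((B ^^ j) y)"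
  by (induction j) (simp_all add: linking_map_ext_class)

text \<open>An element of the direct limit is the set of all its representatives. Labelling it by
  the functional that these share makes independence of the representative automatic.\<close>

definition \<Psi> :: "('a \<Rightarrow> 'k) \<Rightarrow> (nat \<times> (nat \<Rightarrow> 'a) set) set"
  where "\<Psi> f = {(m, ext_class m z) | m z. m \<ge> 1 \<and> \<Theta> m z = f}"

text \<open>Having the same image in a later space amounts to inducing the same functional:
  \<open>\<Theta>_shift\<close> gives one direction, and for the other the stage m + n is always
  late enough.\<close>

lemma ind_class_ext_class:
  "ind_class ext_space (linking_map smul D A) n (ext_class n y) = \<Psi> (\<Theta> n y)"
proof -
  have "(\<exists>i j. m + i = n + j \<and> transit (linking_map smul D A) m i (ext_class m z)
        = transit (linking_map smul D A) n j (ext_class n y)) \<longleftrightarrow> \<Theta> m z = \<Theta> n y" (is "?L \<longleftrightarrow> ?R") for m z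
  proof
    assume ?L
    then obtain i j where ij: "m + i = n + j" "ext_class (m + i) ((B ^^ i) z) = ext_class (n + j) ((B ^^ j) y)"
      by (auto simp: transit_ext_class)
    then have "(B ^^ i) z = (B ^^ j) y" using inj_ext_class by simp
    then have "\<Theta> (m + i) ((B ^^ i) z) = \<Theta> (n + j) ((B ^^ j) y)" using ij(1) by simp
    then show ?R by (simp only: \<Theta>_shift)
  next
    assume ?R
    then have "(B ^^ n) z = (B ^^ m) y" by (simp only: \<Theta>_eq_iff)
    then show ?L by (intro exI[of _ n] exI[of _ m]) (simp add: transit_ext_class add.commute)
  qed
  note key = this
  have "(m, P) \<in> ind_class ext_space (linking_map smul D A) n (ext_class n y) \<longleftrightarrow> (m, P) \<in> \<Psi> (\<Theta> n y)" for m P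
  proof -
    have "(m, P) \<in> ind_class ext_space (linking_map smul D A) n (ext_class n y) \<longleftrightarrow>
      (\<exists>z. m \<ge> 1 \<and> P = ext_class m z \<and> (\<exists>i j. m + i = n + j \<and>
        transit (linking_map smul D A) m i (ext_class m z) = transit (linking_map smul D A) n j (ext_class n y)))"
      unfolding ind_class_def car_ext_space by blast
    then show ?thesis unfolding key \<Psi>_def by blast
  qed
  then show ?thesis by auto
qed

abbreviation IL where "IL \<equiv> ind_limit_vs ext_space (linking_map smul D A)"

lemma car_IL: "car IL = \<Psi> ` dual_carrier pE"
proof -
  have "car IL = (\<Union>n\<in>{1..}. (\<lambda>y. \<Psi> (\<Theta> n y)) ` UNIV)"
    unfolding ind_limit_vs_def by (auto simp: ind_class_ext_class image_image)
  also have "\<dots> = \<Psi> ` dual_carrier pE"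
  proof (intro equalityI subsetI)
    fix P assume "P \<in> \<Psi> ` dual_carrier pE"
    then obtain f where f: "f \<in> dual_carrier pE" "P = \<Psi> f" by blast
    obtain n y where "n \<ge> 1" "f = \<Theta> n y" by (rule dual_\<Theta>[OF f(1)]) (rule that)
    then show "P \<in> (\<Union>n\<in>{1..}. (\<lambda>y. \<Psi> (\<Theta> n y)) ` UNIV)" using f by auto
  qed (use \<Theta>_dual in auto)
  finally show ?thesis .
qed

lemma \<Psi>_memE:
  assumes "p \<in> \<Psi> f" obtains m z where "m \<ge> 1" "p = (m, ext_class m z)" "\<Theta> m z = f"
  using assms unfolding \<Psi>_def by blast

lemma \<Psi>_nonempty: "f \<in> dual_carrier pE \<Longrightarrow> \<exists>p. p \<in> \<Psi> f"
proof -
  assume f: "f \<in> dual_carrier pE"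
  obtain n y where "n \<ge> 1" "f = \<Theta> n y" by (rule dual_\<Theta>[OF f]) (rule that)
  then show ?thesis unfolding \<Psi>_def by blast
qed

lemma inj_\<Psi>: "f \<in> dual_carrier pE \<Longrightarrow> \<Psi> f = \<Psi> g \<Longrightarrow> f = g"
proof -
  assume f: "f \<in> dual_carrier pE" and eq: "\<Psi> f = \<Psi> g"
  obtain p where p: "p \<in> \<Psi> f" using \<Psi>_nonempty[OF f] by blast
  obtain m z where 1: "p = (m, ext_class m z)" "\<Theta> m z = f" by (rule \<Psi>_memE[OF p]) (rule that)
  have p': "p \<in> \<Psi> g" using p eq by simp
  obtain k w where 2: "p = (k, ext_class k w)" "\<Theta> k w = g" by (rule \<Psi>_memE[OF p']) (rule that)
  show "f = g" using 1 2 inj_ext_class by auto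
qed

text \<open>For any two representatives the sum formed at stage m + n represents the sum of the
  functionals by \<open>\<Theta>_add\<close>, so the double union is taken over a constant
  family.\<close>

lemma vadd_IL:
  assumes f: "f \<in> dual_carrier pE" and g: "g \<in> dual_carrier pE"
  shows "vadd IL (\<Psi> f) (\<Psi> g) = \<Psi> (vadd (strong_dual pE) f g)"
proof -
  have c: "(case p of (m, x) \<Rightarrow> \<Union>(n, y)\<in>\<Psi> g. ind_class ext_space (linking_map smul D A) (m + n)
        (vadd (ext_space (m + n)) (transit (linking_map smul D A) m n x) (transit (linking_map smul D A) n m y)))
      = \<Psi> (vadd (strong_dual pE) f g)" if p: "p \<in> \<Psi> f" for p
  proof -
    obtain m x where m: "p = (m, ext_class m x)" "\<Theta> m x = f" by (rule \<Psi>_memE[OF p]) (rule that)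
    have "(case q of (n, y) \<Rightarrow> ind_class ext_space (linking_map smul D A) (m + n)
        (vadd (ext_space (m + n)) (transit (linking_map smul D A) m n (ext_class m x))
          (transit (linking_map smul D A) n m y))) = \<Psi> (vadd (strong_dual pE) f g)" if q: "q \<in> \<Psi> g" for q
    proof -
      obtain n y where n: "q = (n, ext_class n y)" "\<Theta> n y = g" by (rule \<Psi>_memE[OF q]) (rule that)
      have "transit (linking_map smul D A) n m (ext_class n y) = ext_class (m + n) ((B ^^ m) y)"
        by (simp add: transit_ext_class add.commute)
      then show ?thesis
        unfolding n(1) prod.case transit_ext_class
        by (simp only: vadd_ext_space ind_class_ext_class \<Theta>_add[symmetric] m n)
    qed
    then have "(\<Union>(n, y)\<in>\<Psi> g. ind_class ext_space (linking_map smul D A) (m + n)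
        (vadd (ext_space (m + n)) (transit (linking_map smul D A) m n (ext_class m x))
          (transit (linking_map smul D A) n m y))) = (\<Union>q\<in>\<Psi> g. \<Psi> (vadd (strong_dual pE) f g))"
      by (intro SUP_cong refl)
    then show ?thesis using \<Psi>_nonempty[OF g] unfolding m(1) prod.case by auto
  qed
  have "vadd IL (\<Psi> f) (\<Psi> g) = (\<Union>p\<in>\<Psi> f. \<Psi> (vadd (strong_dual pE) f g))"
    unfolding ind_limit_vs_def using c by (simp del: strong_dual_simps cong: SUP_cong)
  also have "\<dots> = \<Psi> (vadd (strong_dual pE) f g)" using \<Psi>_nonempty[OF f] by auto
  finally show ?thesis .
qed

lemma vsmul_IL:
  assumes f: "f \<in> dual_carrier pE"
  shows "vsmul IL c (\<Psi> f) = \<Psi> (vsmul (strong_dual pE) c f)"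
proof -
  have *: "(case p of (m, x) \<Rightarrow> ind_class ext_space (linking_map smul D A) m (vsmul (ext_space m) c x))
      = \<Psi> (vsmul (strong_dual pE) c f)" if p: "p \<in> \<Psi> f" for p
  proof -
    obtain m x where m: "p = (m, ext_class m x)" "\<Theta> m x = f" by (rule \<Psi>_memE[OF p]) (rule that)
    show ?thesis unfolding m(1) prod.case
      by (simp only: vsmul_ext_space ind_class_ext_class \<Theta>_smul[symmetric] m)
  qed
  have "vsmul IL c (\<Psi> f) = (\<Union>p\<in>\<Psi> f. \<Psi> (vsmul (strong_dual pE) c f))"
    unfolding ind_limit_vs_def using * by (simp del: strong_dual_simps cong: SUP_cong)
  also have "\<dots> = \<Psi> (vsmul (strong_dual pE) c f)" using \<Psi>_nonempty[OF f] by auto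
  finally show ?thesis .
qed

lemma vzero_IL: "\<Psi> (vzero (strong_dual pE)) = vzero IL"
proof -
  have "vzero IL = ind_class ext_space (linking_map smul D A) 1 (ext_class 1 0)"
    by (simp add: ind_limit_vs_def vzero_ext_space)
  also have "\<dots> = \<Psi> (vzero (strong_dual pE))" unfolding ind_class_ext_class \<Theta>_0 ..
  finally show ?thesis ..
qed

lemma isomorphism_and_completeness:
  "tvs_isomorphic (strong_dual pE) (ind_extrapolation smul D A) \<and>
    complete_tvs (ind_extrapolation smul D A)"
proof -
  let ?V = "strong_dual pE" and ?W = "ind_extrapolation smul D A"
  let ?P = "\<lambda>T. \<forall>k\<ge>1. continuous_map (norm_topology (ext_space k)) T
      (ind_class ext_space (linking_map smul D A) k)"
  have V: "tvs ?V" by (rule tvs_strong_dual[OF tvs_pE])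
  then have vsV: "vector_space_on ?V" and LV: "linear_topology ?V (topo ?V)" by (auto simp: tvs_def)
  have W: "car ?W = car IL" "vadd ?W = vadd IL" "vzero ?W = vzero IL" "vsmul ?W = vsmul IL"
    and topW: "topo ?W = finest_linear_topology IL ?P"
    by (simp_all add: ind_extrapolation_def ind_limit_def Let_def)
  have bij: "bij_betw \<Psi> (car ?V) (car IL)"
    unfolding bij_betw_def car_IL using inj_\<Psi> by (auto intro!: inj_onI)
  have lin: "linear_on ?V IL \<Psi>"
    unfolding linear_on_def using vadd_IL vsmul_IL by (auto simp: car_IL simp del: strong_dual_simps(2-))
  have vsIL: "vector_space_on IL"
  proof (rule vector_space_on_transfer[OF vsV lin])
    show "\<Psi> ` car ?V = car IL" using bij by (simp add: bij_betw_def)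
    show "\<Psi> (vzero ?V) = vzero IL" by (rule vzero_IL)
  qed
  \<comment> \<open>The isometries replace the k-th extrapolation space by X, and the canonical map
    becomes \<open>\<Theta> k\<close> followed by \<open>\<Psi>\<close>. This is the form in which
    the universal property is transported from the strong dual.\<close>
  have P: "?P S \<longleftrightarrow> (\<forall>k\<in>{1..}. continuous_map euclidean S (\<lambda>y. \<Psi> (\<Theta> k y)))" for S
    by (simp add: continuous_map_ext_space comp_def ind_class_ext_class Ball_def)
  have hom: "homeomorphic_map (topo ?V) (topo ?W) \<Psi>" and LW: "linear_topology IL (topo ?W)"
    unfolding topW
    using homeomorphic_map_finest_linear_topology[OF vsV vsIL LV lin bij P continuous_\<Theta>]
      strong_dual_finest by auto
  have vsW: "vector_space_on ?W" using vsIL unfolding vector_space_on_def W .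
  have LW': "linear_topology ?W (topo ?W)" using LW unfolding linear_topology_def W .
  have tvsW: "tvs ?W" using vsW LW' by (simp add: tvs_def)
  have linW: "linear_on ?V ?W \<Psi>" using lin unfolding linear_on_def W .
  have zero: "\<Psi> (vzero ?V) = vzero ?W" by (simp only: W vzero_IL)
  have "complete_tvs ?V"
    by (rule complete_strong_dual[OF tvs_pE], rule bounded_on_bounded_imp_continuous) auto
  then have "complete_tvs ?W"
    by (rule complete_tvs_transfer[where f=\<Psi>, OF V tvsW linW hom zero])
  then show ?thesis using V tvsW linW hom by (auto simp: tvs_isomorphic_def)
qed

end

theorem theorem7:
  fixes smul :: "'k::rc_field \<Rightarrow> 'a::banach \<Rightarrow> 'a"
    and ip :: "'a \<Rightarrow> 'a \<Rightarrow> 'k"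
    and D :: "'a set"
    and A :: "'a \<Rightarrow> 'a"
  assumes "hilbert_space smul ip"
    and "linear_operator smul D A"
    and "densely_defined D"
    and "self_adjoint ip D A"
    and "bij_betw A D UNIV"
    and "bounded_operator smul (inv_into D A)"
  shows "tvs_isomorphic (strong_dual (proj_interpolation smul D A)) (ind_extrapolation smul D A)
    \<and> complete_tvs (ind_extrapolation smul D A)"
proof -
  interpret invertible_self_adjoint smul ip D A
    using assms by (simp add: invertible_self_adjoint_def invertible_self_adjoint_axioms_def)
  show ?thesis by (rule isomorphism_and_completeness)
qed

end
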